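(* Let $\sigma>0$ and let $g:\mathbb{R}^3\to\mathbb{R}$ be a locally Lipschitz function with $g(t,x,0)\equiv 0$ and $$\sup_{z_1\neq z_2}\frac{|g(t,x,z_1)-g(t,x,z_2)|}{|z_1-z_2|}\le \sigma\qquad\text{for all }(t,x)\in\mathbb{R}^2 .$$ Let $\delta>0$, let $N_0\in\mathbb{Z}_+$ satisfy $-\lambda_n+\sigma<-\delta$ for all $n>N_0$, and let $N\in\mathbb{N}$ satisfy $N\ge N_0$. Let $x_*\in[0,1]$ satisfy $c_n=\phi_n(x_* )\neq 0$ for $0\le n\le N_0$. Consider the ODE-PDE system $$\dot u(t)=-\mu u(t)+v(t),\quad u(0)=0,$$ $$w_t(x,t)=w_{xx}(x,t)+g\big(t,x,w(x,t)+\psi(x)u(t)\big)-\psi(x)v(t),\quad x\in(0,1),\ t\ge 0,$$ $$w_x(0,t)=w_x(1,t)=0,$$ with measurement $y(t)=w(x_*,t)+\psi(x_* )u(t)$. Let $L_0=\operatorname{col}\{l_n\}_{n=0}^{N_0}\in\mathbb{R}^{N_0+1}$ and $K_0\in\mathbb{R}^{1\times(N_0+2)}$ be such that there exist positive definite matrices $P_{\rm o}\in\mathbb{R}^{(N_0+1)\times(N_0+1)}$ and $P_{\rm c}\in\mathbb{R}^{(N_0+2)\times(N_0+2)}$ with $$P_{\rm o}(A_0-L_0C_0)+(A_0-L_0C_0)^TP_{\rm o}<-2\delta P_{\rm o},\qquad P_{\rm c}(\tilde A_0-\tilde B_0K_0)+(\tilde A_0-\tilde B_0K_0)^TP_{\rm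 c}<-2\delta P_{\rm c},$$ and set $l_n=0$ for $N_0+1\le n\le N$. Let the observer be $\hat w(x,t)=\sum_{n=0}^N\hat w_n(t)\phi_n(x)$, where, for $0\le n\le N$ and $t\ge 0$, $$\dot{\hat w}_n(t)=-\lambda_n\hat w_n(t)+\big\langle g(t,\cdot,\hat w(\cdot,t)+\psi(\cdot)u(t)),\phi_n\big\rangle+b_nv(t)-l_n\big[\hat w(x_*,t)+\psi(x_* )u(t)-y(t)\big],\quad \hat w_n(0)=0,$$ and let the control law be $v(t)=-K_0\operatorname{col}\{u(t),\hat w_0(t),\dots,\hat w_{N_0}(t)\}$. Given $\Gamma>0$, let there exist $0<P_X\in\mathbb{R}^{(2N+3)\times(2N+3)}$ and scalars $\alpha_1,\alpha_2,\alpha_3>0$ such that the matrix inequality $\Psi_0<0$ holds, where $\Psi_0$ is the symmetric matrix defined in the context. Then there exists a constant $D\ge 1$, independent of $w(\cdot,0)$, such that for every $w(\cdot,0)\in H^1(0,1)$ the solution $u(t),w(x,t)$ of the closed-loop system and the observer $\hat w(x,t)$ satisfy $$u^2(t)+\|w(\cdot,t)\|_{H^1}^2+\|\hat w(\cdot,t)\|_{H^1}^2\le D e^{-2\delta t}\|w(\cdot,0)\|_{H^1}^2,\qquad t\ge 0 .$$ Moreover, the matrix inequality is always feasible for $N$ large enough and $\sigma>0$ small enough: for fixed $\delta>0$, $\Gamma>0$, $x_*$, $N_0$ with $\lambda_n>\delta$ for all $n>N_0$, and fixed gains $L_0\in\mathbb{R}^{N_0+1}$, $K_0\in\mathbb{R}^{1\times(N_0+2)}$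 for which there exist positive definite matrices $P_{\rm o}\in\mathbb{R}^{(N_0+1)\times(N_0+1)}$ and $P_{\rm c}\in\mathbb{R}^{(N_0+2)\times(N_0+2)}$ with $P_{\rm o}(A_0-L_0C_0)+(A_0-L_0C_0)^TP_{\rm o}<-2\delta P_{\rm o}$ and $P_{\rm c}(\tilde A_0-\tilde B_0K_0)+(\tilde A_0-\tilde B_0K_0)^TP_{\rm c}<-2\delta P_{\rm c}$, there exists $N_*$ such that for every $N\ge N_*$ there exists $\sigma_*>0$ such that for every $\sigma\in(0,\sigma_*]$ there exist $P_X>0$ and $\alpha_1,\alpha_2,\alpha_3>0$ with $\Psi_0<0$.
   Context: Notation. $\mathbb{Z}_+$ denotes the nonnegative integers and $\mathbb{N}$ the positive integers. $\langle\cdot,\cdot\rangle$ and $\|\cdot\|$ are the inner product and norm of $L^2(0,1)$; $\|f\|_{H^1}^2=\|f\|^2+\|f'\|^2$. For a matrix $P$, $P>0$ means symmetric positive definite (and $P<0$ means $-P>0$); $*$ denotes the entries of a symmetric matrix determined by symmetry. $\operatorname{col}$ denotes vertical stacking. Spectral data. $\phi_0\equiv 1$, $\phi_n(x)=\sqrt2\cos(n\pi x)$ for $n\ge1$, $\lambda_n=n^2\pi^2$ for $n\in\mathbb{Z}_+$ (eigenfunctions and eigenvalues of $\phi''+\lambda\phi=0$, $\phi'(0)=\phi'(1)=0$). $\psi(x)=-\frac{2}{\pi}\cos\left(\frac{\pi}{2}x\right)$, $\mu=\frac{\pi^2}{4}$, $b_0=\frac{4}{\pi^2}$, $b_n=\frac{(-1)^{n+1}4\sqrt2}{\pi^2(4n^2-1)}$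 for $n\ge1$ (so $b_n=-\langle\psi,\phi_n\rangle$), and $c_n=\phi_n(x_* )$. Matrices. $A_0=\operatorname{diag}\{-\lambda_n\}_{n=0}^{N_0}$, $\tilde A_0=\operatorname{diag}\{-\mu,A_0\}$, $B_0=\operatorname{col}\{b_n\}_{n=0}^{N_0}$, $\tilde B_0=\operatorname{col}\{1,B_0\}$, $C_0=[c_0,\dots,c_{N_0}]$, $C_1=[c_{N_0+1},\dots,c_N]$, $A_1=\operatorname{diag}\{-\lambda_n\}_{n=N_0+1}^N$, $B_1=\operatorname{col}\{b_n\}_{n=N_0+1}^N$, $\tilde L_0=\operatorname{col}\{0,L_0\}\in\mathbb{R}^{N_0+2}$. With block sizes $N_0+2,\ N_0+1,\ N-N_0,\ N-N_0$, $$F_X=\begin{bmatrix}\tilde A_0-\tilde B_0K_0&\tilde L_0C_0&0&\tilde L_0C_1\\0&A_0-L_0C_0&0&-L_0C_1\\-B_1K_0&0&A_1&0\\0&0&0&A_1\end{bmatrix},\quad L_\zeta=\operatorname{col}\{\tilde L_0,-L_0,0,0\}\in\mathbb{R}^{2N+3},\quad K_X=[K_0,0,0,0]\in\mathbb{R}^{1\times(2N+3)},$$ $$\Xi_X=\operatorname{diag}\left\{\tfrac{2}{\pi^2},I_{N_0+1},0_{(N_0+1)\times(N_0+1)},I_{N-N_0},0_{(N-N_0)\times(N-N_0)}\right\},$$ $$\Xi_E=\operatorname{diag}\left\{0_{(N_0+2)\times(N_0+2)},I_{N_0+1},0_{(N-N_0)\times(N-N_0)},I_{N-N_0}\right\}.$$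 The matrix $\Psi_0$. Set $\xi_{N+1}=\left(1+\frac{1}{4(N+1)^2-1}\right)^2\frac1N$, $\kappa_{N+1}=1+\Gamma+\Gamma^{-1}\lambda_{N+1}$, $$\rho_{N+1}=\kappa_{N+1}^{-1}\left(-\lambda_{N+1}^2+\delta\lambda_{N+1}+\frac{\lambda_{N+1}}{2\alpha_3}+\frac{\lambda_{N+1}^2}{2\alpha_1}+\frac{\lambda_{N+1}^2}{2\alpha_2}+\frac{\alpha_2\sigma^2}{2}\right),$$ $$\psi_0=P_XF_X+F_X^TP_X+2\delta P_X+\frac{2\alpha_3\xi_{N+1}}{\pi^2}K_X^TK_X+2\alpha_1\sigma^2\Xi_X+\alpha_2\sigma^2\Xi_E,$$ $$\Psi_0=\begin{bmatrix}\psi_0&P_XL_\zeta&P_X&P_X\\ *&2\rho_{N+1}&0&0\\ *&*&-\alpha_1I_{2N+3}&0\\ *&*&*&-\alpha_2I_{2N+3}\end{bmatrix}.$$ Solution. For $w(\cdot,0)\in H^1(0,1)$, "the solution" is the unique classical solution of the closed-loop system: $\left(w(\cdot,t),u(t),\hat w_0(t),\dots,\hat w_N(t)\right)$ belongs to $C([0,\infty);L^2(0,1)\times\mathbb{R}^{N+2})\cap C^1((0,\infty);L^2(0,1)\times\mathbb{R}^{N+2})$, with $w(\cdot,t)\in H^2(0,1)$, $w_x(0,t)=w_x(1,t)=0$ for all $t>0$. *)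

theory Defs
  imports "HOL-Analysis.Analysis" "Jordan_Normal_Form.Matrix"
begin

section \<open>Function spaces on the unit interval\<close>

definition L2 :: "(real \<Rightarrow> real) set" where
  "L2 = {f. set_borel_measurable lborel {0..1} f \<and> set_integrable lborel {0..1} (\<lambda>x. (f x)\<^sup>2)}"

definition l2_inner :: "(real \<Rightarrow> real) \<Rightarrow> (real \<Rightarrow> real) \<Rightarrow> real" where
  "l2_inner f g = (LINT x:{0..1}|lborel. f x * g x)"

definition l2_norm :: "(real \<Rightarrow> real) \<Rightarrow> real" where
  "l2_norm f = sqrt (l2_inner f f)"

text \<open>
  The Sobolev space \<open>H\<^sup>1(0,1)\<close> is the space of absolutely continuous functions on \<open>[0,1]\<close> with
  square integrable derivative.  An element is represented by its continuous representative,
  so that point values (also at the two ends of the interval) are meaningful.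
  \<open>has_H1_deriv f f'\<close> says that \<open>f\<close> is such a function and that \<open>f'\<close> is (a version of)
  its derivative, which is determined up to a null set; see \<open>has_H1_deriv_unique\<close> below.
\<close>

definition has_H1_deriv :: "(real \<Rightarrow> real) \<Rightarrow> (real \<Rightarrow> real) \<Rightarrow> bool" where
  "has_H1_deriv f f' \<longleftrightarrow>
     f' \<in> L2 \<and> (\<forall>x\<in>{0..1}. f x = f 0 + (LINT y:{0..x}|lborel. f' y))"

definition H1 :: "(real \<Rightarrow> real) set" where
  "H1 = {f. \<exists>f'. has_H1_deriv f f'}"

definition H1_deriv :: "(real \<Rightarrow> real) \<Rightarrow> real \<Rightarrow> real" where
  "H1_deriv f = (SOME f'. has_H1_deriv f f')"

definition h1_norm :: "(real \<Rightarrow> real) \<Rightarrow> real" where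
  "h1_norm f = sqrt ((l2_norm f)\<^sup>2 + (l2_norm (H1_deriv f))\<^sup>2)"

text \<open>Continuity and differentiability of curves \<open>t \<mapsto> f t\<close> with values in \<open>L\<^sup>2(0,1)\<close>.\<close>

definition l2_continuous_on :: "real set \<Rightarrow> (real \<Rightarrow> real \<Rightarrow> real) \<Rightarrow> bool" where
  "l2_continuous_on S f \<longleftrightarrow> (\<forall>t\<in>S. f t \<in> L2) \<and>
     (\<forall>t\<in>S. ((\<lambda>s. l2_norm (\<lambda>x. f s x - f t x)) \<longlongrightarrow> 0) (at t within S))"

definition l2_has_derivative :: "(real \<Rightarrow> real \<Rightarrow> real) \<Rightarrow> (real \<Rightarrow> real) \<Rightarrow> real \<Rightarrow> bool" where
  "l2_has_derivative f f' t \<longleftrightarrow>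
     ((\<lambda>s. l2_norm (\<lambda>x. (f s x - f t x) / (s - t) - f' x)) \<longlongrightarrow> 0) (at t)"


section \<open>Spectral data\<close>

definition phi :: "nat \<Rightarrow> real \<Rightarrow> real" where
  "phi n x = (if n = 0 then 1 else sqrt 2 * cos (real n * pi * x))"

definition lam :: "nat \<Rightarrow> real" where
  "lam n = (real n)\<^sup>2 * pi\<^sup>2"

definition psi :: "real \<Rightarrow> real" where
  "psi x = - (2 / pi) * cos (pi / 2 * x)"

definition mu :: real where
  "mu = pi\<^sup>2 / 4"

definition bcoef :: "nat \<Rightarrow> real" where
  "bcoef n = (if n = 0 then 4 / pi\<^sup>2
     else (-1) ^ (n + 1) * 4 * sqrt 2 / (pi\<^sup>2 * (4 * (real n)\<^sup>2 - 1)))"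

definition ccoef :: "real \<Rightarrow> nat \<Rightarrow> real" where
  "ccoef xs n = phi n xs"


section \<open>Matrices\<close>

text \<open>
  Vectors are identified with one-column matrices.  The order \<open><\<close> that the library puts on
  matrices is entrywise, so definiteness is expressed by separate predicates.
\<close>

definition pos_def :: "nat \<Rightarrow> real mat \<Rightarrow> bool" where
  "pos_def n P \<longleftrightarrow> P \<in> carrier_mat n n \<and> P\<^sup>T = P \<and>
     (\<forall>v\<in>carrier_vec n. v \<noteq> 0\<^sub>v n \<longrightarrow> scalar_prod v (P *\<^sub>v v) > 0)"

definition neg_def :: "nat \<Rightarrow> real mat \<Rightarrow> bool" where
  "neg_def n P \<longleftrightarrow> pos_def n (- P)"

definition mat_less :: "nat \<Rightarrow> real mat \<Rightarrow> real mat \<Rightarrow> bool" where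
  "mat_less n P Q \<longleftrightarrow> neg_def n (P - Q)"

definition col_mat :: "nat \<Rightarrow> (nat \<Rightarrow> real) \<Rightarrow> real mat" where
  "col_mat n f = Matrix.mat n 1 (\<lambda>(i, _). f i)"

definition row_mat :: "nat \<Rightarrow> (nat \<Rightarrow> real) \<Rightarrow> real mat" where
  "row_mat n f = Matrix.mat 1 n (\<lambda>(_, j). f j)"

fun hcat :: "real mat list \<Rightarrow> real mat" where
  "hcat [] = 0\<^sub>m 0 0"
| "hcat (A # As) = (let B = hcat As in
     four_block_mat A B (0\<^sub>m 0 (dim_col A)) (0\<^sub>m 0 (dim_col B)))"

fun vcat :: "real mat list \<Rightarrow> real mat" where
  "vcat [] = 0\<^sub>m 0 0"
| "vcat (A # As) = (let B = vcat As in
     four_block_mat A (0\<^sub>m (dim_row A) 0) B (0\<^sub>m (dim_row B) 0))"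

text \<open>The argument is the list of block rows.\<close>

definition block_mat :: "real mat list list \<Rightarrow> real mat" where
  "block_mat Bs = vcat (map hcat Bs)"

definition A0 :: "nat \<Rightarrow> real mat" where
  "A0 N0 = mat_diag (N0 + 1) (\<lambda>n. - lam n)"

definition A0t :: "nat \<Rightarrow> real mat" where
  "A0t N0 = diag_block_mat [mat_diag 1 (\<lambda>_. - mu), A0 N0]"

definition B0 :: "nat \<Rightarrow> real mat" where
  "B0 N0 = col_mat (N0 + 1) bcoef"

definition B0t :: "nat \<Rightarrow> real mat" where
  "B0t N0 = vcat [1\<^sub>m 1, B0 N0]"

definition C0 :: "nat \<Rightarrow> real \<Rightarrow> real mat" where
  "C0 N0 xs = row_mat (N0 + 1) (ccoef xs)"

definition C1 :: "nat \<Rightarrow> nat \<Rightarrow> real \<Rightarrow> real mat" where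
  "C1 N0 N xs = row_mat (N - N0) (\<lambda>j. ccoef xs (N0 + 1 + j))"

definition A1 :: "nat \<Rightarrow> nat \<Rightarrow> real mat" where
  "A1 N0 N = mat_diag (N - N0) (\<lambda>i. - lam (N0 + 1 + i))"

definition B1 :: "nat \<Rightarrow> nat \<Rightarrow> real mat" where
  "B1 N0 N = col_mat (N - N0) (\<lambda>i. bcoef (N0 + 1 + i))"

definition L0t :: "real mat \<Rightarrow> real mat" where
  "L0t L0 = vcat [0\<^sub>m 1 1, L0]"

definition FX :: "nat \<Rightarrow> nat \<Rightarrow> real \<Rightarrow> real mat \<Rightarrow> real mat \<Rightarrow> real mat" where
  "FX N0 N xs L0 K0 = block_mat
    [[A0t N0 - B0t N0 * K0, L0t L0 * C0 N0 xs,
        0\<^sub>m (N0 + 2) (N - N0), L0t L0 * C1 N0 N xs],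
     [0\<^sub>m (N0 + 1) (N0 + 2), A0 N0 - L0 * C0 N0 xs,
        0\<^sub>m (N0 + 1) (N - N0), - (L0 * C1 N0 N xs)],
     [- (B1 N0 N * K0), 0\<^sub>m (N - N0) (N0 + 1),
        A1 N0 N, 0\<^sub>m (N - N0) (N - N0)],
     [0\<^sub>m (N - N0) (N0 + 2), 0\<^sub>m (N - N0) (N0 + 1),
        0\<^sub>m (N - N0) (N - N0), A1 N0 N]]"

definition Lzeta :: "nat \<Rightarrow> nat \<Rightarrow> real mat \<Rightarrow> real mat" where
  "Lzeta N0 N L0 = vcat [L0t L0, - L0, 0\<^sub>m (N - N0) 1, 0\<^sub>m (N - N0) 1]"

definition KX :: "nat \<Rightarrow> nat \<Rightarrow> real mat \<Rightarrow> real mat" where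
  "KX N0 N K0 = hcat [K0, 0\<^sub>m 1 (N0 + 1), 0\<^sub>m 1 (N - N0), 0\<^sub>m 1 (N - N0)]"

definition XiX :: "nat \<Rightarrow> nat \<Rightarrow> real mat" where
  "XiX N0 N = diag_block_mat
    [mat_diag 1 (\<lambda>_. 2 / pi\<^sup>2), 1\<^sub>m (N0 + 1), 0\<^sub>m (N0 + 1) (N0 + 1),
     1\<^sub>m (N - N0), 0\<^sub>m (N - N0) (N - N0)]"

definition XiE :: "nat \<Rightarrow> nat \<Rightarrow> real mat" where
  "XiE N0 N = diag_block_mat
    [0\<^sub>m (N0 + 2) (N0 + 2), 1\<^sub>m (N0 + 1), 0\<^sub>m (N - N0) (N - N0), 1\<^sub>m (N - N0)]"

text \<open>The three scalars with subscript \<open>N + 1\<close> are indexed here by \<open>N\<close>.\<close>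

definition xi :: "nat \<Rightarrow> real" where
  "xi N = (1 + 1 / (4 * (real (N + 1))\<^sup>2 - 1))\<^sup>2 * (1 / real N)"

definition kappa :: "real \<Rightarrow> nat \<Rightarrow> real" where
  "kappa \<Gamma> N = 1 + \<Gamma> + inverse \<Gamma> * lam (N + 1)"

definition rho :: "real \<Rightarrow> real \<Rightarrow> real \<Rightarrow> real \<Rightarrow> real \<Rightarrow> real \<Rightarrow> nat \<Rightarrow> real" where
  "rho \<delta> \<sigma> \<Gamma> \<alpha>1 \<alpha>2 \<alpha>3 N = inverse (kappa \<Gamma> N) *
     (- (lam (N + 1))\<^sup>2 + \<delta> * lam (N + 1) + lam (N + 1) / (2 * \<alpha>3)
      + (lam (N + 1))\<^sup>2 / (2 * \<alpha>1) + (lam (N + 1))\<^sup>2 / (2 * \<alpha>2) + \<alpha>2 * \<sigma>\<^sup>2 / 2)"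

definition psi0 :: "real \<Rightarrow> real \<Rightarrow> real \<Rightarrow> nat \<Rightarrow> nat \<Rightarrow> real mat \<Rightarrow> real mat \<Rightarrow>
    real mat \<Rightarrow> real \<Rightarrow> real \<Rightarrow> real \<Rightarrow> real mat" where
  "psi0 \<delta> \<sigma> xs N0 N L0 K0 PX \<alpha>1 \<alpha>2 \<alpha>3 =
     PX * FX N0 N xs L0 K0 + (FX N0 N xs L0 K0)\<^sup>T * PX + (2 * \<delta>) \<cdot>\<^sub>m PX
     + (2 * \<alpha>3 * xi N / pi\<^sup>2) \<cdot>\<^sub>m ((KX N0 N K0)\<^sup>T * KX N0 N K0)
     + (2 * \<alpha>1 * \<sigma>\<^sup>2) \<cdot>\<^sub>m XiX N0 N + (\<alpha>2 * \<sigma>\<^sup>2) \<cdot>\<^sub>m XiE N0 N"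

definition Psi0 :: "real \<Rightarrow> real \<Rightarrow> real \<Rightarrow> real \<Rightarrow> nat \<Rightarrow> nat \<Rightarrow> real mat \<Rightarrow> real mat \<Rightarrow>
    real mat \<Rightarrow> real \<Rightarrow> real \<Rightarrow> real \<Rightarrow> real mat" where
  "Psi0 \<delta> \<sigma> \<Gamma> xs N0 N L0 K0 PX \<alpha>1 \<alpha>2 \<alpha>3 =
    (let m = 2 * N + 3; PL = PX * Lzeta N0 N L0 in block_mat
      [[psi0 \<delta> \<sigma> xs N0 N L0 K0 PX \<alpha>1 \<alpha>2 \<alpha>3, PL, PX, PX],
       [PL\<^sup>T, mat_diag 1 (\<lambda>_. 2 * rho \<delta> \<sigma> \<Gamma> \<alpha>1 \<alpha>2 \<alpha>3 N), 0\<^sub>m 1 m, 0\<^sub>m 1 m],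
       [PX\<^sup>T, 0\<^sub>m m 1, (- \<alpha>1) \<cdot>\<^sub>m 1\<^sub>m m, 0\<^sub>m m m],
       [PX\<^sup>T, 0\<^sub>m m 1, 0\<^sub>m m m, (- \<alpha>2) \<cdot>\<^sub>m 1\<^sub>m m]])"


section \<open>The closed-loop system\<close>

definition locally_lipschitz :: "('a::metric_space \<Rightarrow> 'b::metric_space) \<Rightarrow> bool" where
  "locally_lipschitz f \<longleftrightarrow> (\<forall>p. \<exists>r>0. \<exists>C. C-lipschitz_on (cball p r) f)"

text \<open>
  Time comes first: \<open>w t x\<close> is \<open>w(x,t)\<close>.  The observer modes are \<open>wh n t\<close>.
\<close>

definition observer :: "nat \<Rightarrow> (nat \<Rightarrow> real \<Rightarrow> real) \<Rightarrow> real \<Rightarrow> real \<Rightarrow> real" where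
  "observer N wh t x = (\<Sum>n\<le>N. wh n t * phi n x)"

definition control :: "nat \<Rightarrow> real mat \<Rightarrow> (real \<Rightarrow> real) \<Rightarrow> (nat \<Rightarrow> real \<Rightarrow> real) \<Rightarrow> real \<Rightarrow> real" where
  "control N0 K0 u wh t =
     - (K0 * vcat [col_mat 1 (\<lambda>_. u t), col_mat (N0 + 1) (\<lambda>n. wh n t)]) $$ (0, 0)"

definition measurement :: "real \<Rightarrow> (real \<Rightarrow> real) \<Rightarrow> (real \<Rightarrow> real \<Rightarrow> real) \<Rightarrow> real \<Rightarrow> real" where
  "measurement xs u w t = w t xs + psi xs * u t"

definition obs_gain :: "nat \<Rightarrow> real mat \<Rightarrow> nat \<Rightarrow> real" where
  "obs_gain N0 L0 n = (if n \<le> N0 then L0 $$ (n, 0) else 0)"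

text \<open>
  Classical solutions: the state is continuous in \<open>L\<^sup>2(0,1) \<times> \<real>\<^sup>N\<^sup>+\<^sup>2\<close> on \<open>t \<ge> 0\<close> and continuously
  differentiable on \<open>t > 0\<close>, where the differential equations hold.  For \<open>t > 0\<close> the functions
  \<open>wx\<close> and \<open>wxx\<close> are the first and second space derivatives of \<open>w(\<cdot>,t) \<in> H\<^sup>2(0,1)\<close>;
  \<open>wx\<close> is the absolutely continuous representative.
\<close>

definition closed_loop_solution ::
  "(real \<Rightarrow> real \<Rightarrow> real \<Rightarrow> real) \<Rightarrow> real \<Rightarrow> nat \<Rightarrow> nat \<Rightarrow> real mat \<Rightarrow> real mat \<Rightarrow> (real \<Rightarrow> real) \<Rightarrow>
   (real \<Rightarrow> real) \<Rightarrow> (real \<Rightarrow> real \<Rightarrow> real) \<Rightarrow> (nat \<Rightarrow> real \<Rightarrow> real) \<Rightarrow> bool" where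
  "closed_loop_solution g xs N0 N L0 K0 w0 u w wh \<longleftrightarrow>
     (let v = control N0 K0 u wh; y = measurement xs u w; what = observer N wh in
      u 0 = 0 \<and> (\<forall>n\<le>N. wh n 0 = 0) \<and> (\<forall>x\<in>{0..1}. w 0 x = w0 x) \<and>
      continuous_on {0..} u \<and> u C1_differentiable_on {0<..} \<and>
      (\<forall>t>0. (u has_real_derivative - mu * u t + v t) (at t)) \<and>
      (\<forall>n\<le>N. continuous_on {0..} (wh n) \<and> wh n C1_differentiable_on {0<..} \<and>
         (\<forall>t>0. (wh n has_real_derivative
            - lam n * wh n t + l2_inner (\<lambda>x. g t x (what t x + psi x * u t)) (phi n)
            + bcoef n * v t
            - obs_gain N0 L0 n * (what t xs + psi xs * u t - y t)) (at t))) \<and>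
      l2_continuous_on {0..} w \<and>
      (\<exists>wt. l2_continuous_on {0<..} wt \<and>
         (\<forall>t>0. l2_has_derivative w (wt t) t \<and>
            (\<exists>wx wxx. has_H1_deriv (w t) wx \<and> has_H1_deriv wx wxx \<and> wx 0 = 0 \<and> wx 1 = 0 \<and>
               (AE x in lborel. x \<in> {0<..<1} \<longrightarrow>
                  wt t x = wxx x + g t x (w t x + psi x * u t) - psi x * v t)))))"


section \<open>Consistency of the encoding\<close>

lemma dim_hcat [simp]:
  "dim_row (hcat (A # As)) = dim_row A" "dim_col (hcat As) = sum_list (map dim_col As)"
  by (simp add: Let_def) (induction As; simp add: Let_def)

lemma dim_vcat [simp]:
  "dim_col (vcat (A # As)) = dim_col A" "dim_row (vcat As) = sum_list (map dim_row As)"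
  by (simp add: Let_def) (induction As; simp add: Let_def)

lemma dim_parts [simp]:
  "dim_row (mat_diag n f) = n" "dim_col (mat_diag n f) = n"
  "dim_row (A0t N0) = N0 + 2" "dim_col (A0t N0) = N0 + 2"
  "dim_row (B1 N0 N) = N - N0"
  by (simp_all add: mat_diag_def A0t_def A0_def B1_def col_mat_def Let_def)

lemma block_carriers:
  assumes "L0 \<in> carrier_mat (N0 + 1) 1" "K0 \<in> carrier_mat 1 (N0 + 2)" "N0 \<le> N"
  shows "FX N0 N xs L0 K0 \<in> carrier_mat (2 * N + 3) (2 * N + 3)"
    and "Lzeta N0 N L0 \<in> carrier_mat (2 * N + 3) 1"
    and "KX N0 N K0 \<in> carrier_mat 1 (2 * N + 3)"
    and "XiX N0 N \<in> carrier_mat (2 * N + 3) (2 * N + 3)"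
    and "XiE N0 N \<in> carrier_mat (2 * N + 3) (2 * N + 3)"
proof -
  note [simp del] = hcat.simps vcat.simps diag_block_mat.simps
  note [simp] = dim_diag_block_mat
  have d: "dim_row L0 = N0 + 1" "dim_col L0 = 1" "dim_row K0 = 1" "dim_col K0 = N0 + 2"
    using assms by auto
  note [simp] = d
  show "FX N0 N xs L0 K0 \<in> carrier_mat (2 * N + 3) (2 * N + 3)"
    using assms(3) by (intro carrier_matI)
      (simp_all add: FX_def block_mat_def B0t_def L0t_def A1_def C0_def C1_def B0_def
        row_mat_def col_mat_def)
  show "Lzeta N0 N L0 \<in> carrier_mat (2 * N + 3) 1"
    using assms(3) by (intro carrier_matI) (simp_all add: Lzeta_def L0t_def)
  show "KX N0 N K0 \<in> carrier_mat 1 (2 * N + 3)"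
    using assms(3) by (intro carrier_matI) (simp_all add: KX_def)
  show "XiX N0 N \<in> carrier_mat (2 * N + 3) (2 * N + 3)"
    using assms(3) by (intro carrier_matI) (simp_all add: XiX_def)
  show "XiE N0 N \<in> carrier_mat (2 * N + 3) (2 * N + 3)"
    using assms(3) by (intro carrier_matI) (simp_all add: XiE_def)
qed

lemma Psi0_carrier:
  assumes "L0 \<in> carrier_mat (N0 + 1) 1" "K0 \<in> carrier_mat 1 (N0 + 2)" "N0 \<le> N"
    and "PX \<in> carrier_mat (2 * N + 3) (2 * N + 3)"
  shows "Psi0 \<delta> \<sigma> \<Gamma> xs N0 N L0 K0 PX \<alpha>1 \<alpha>2 \<alpha>3 \<in> carrier_mat (6 * N + 10) (6 * N + 10)"
proof -
  note [simp del] = hcat.simps vcat.simps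
  have "dim_row PX = 2 * N + 3" "dim_col PX = 2 * N + 3"
    "dim_col (Lzeta N0 N L0) = 1" "dim_row (XiE N0 N) = 2 * N + 3" "dim_col (XiE N0 N) = 2 * N + 3"
    using assms(4) block_carriers(2,5)[OF assms(1-3)] by auto
  then show ?thesis
    by (intro carrier_matI) (simp_all add: Psi0_def psi0_def block_mat_def Let_def)
qed

lemma L2_set_integrable:
  assumes "f \<in> L2"
  shows "set_integrable lborel {0..1} f"
proof -
  have m: "(\<lambda>x. indicator {0..1} x *\<^sub>R f x) \<in> borel_measurable lborel"
    using assms by (simp add: L2_def set_borel_measurable_def)
  have "set_integrable lborel {0..1} (\<lambda>x. 1 + (f x)\<^sup>2)"
    using assms by (intro set_integral_add) (auto simp: L2_def set_integrable_def)
  then show ?thesis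
  proof (rule set_integrable_bound)
    show "set_borel_measurable lborel {0..1} f"
      using m by (simp add: set_borel_measurable_def)
    have "\<bar>f x\<bar> \<le> 1 + (f x)\<^sup>2" for x
    proof -
      have "0 \<le> (\<bar>f x\<bar> - 1)\<^sup>2" by simp
      then have "2 * \<bar>f x\<bar> \<le> 1 + (f x)\<^sup>2" by (simp add: power2_diff)
      then show ?thesis by (smt (verit) zero_le_power2)
    qed
    then show "AE x in lborel. x \<in> {0..1} \<longrightarrow> norm (f x) \<le> norm (1 + (f x)\<^sup>2)"
      by (auto simp: abs_of_nonneg add_nonneg_nonneg)
  qed
qed

lemma set_integral_zero_imp_AE_zero:
  fixes d :: "real \<Rightarrow> real"
  assumes d: "set_integrable lborel {0..1} d"
    and z: "\<And>x. x \<in> {0..1} \<Longrightarrow> (LINT y:{0..x}|lborel. d y) = 0"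
  shows "AE x in lborel. x \<in> {0..1} \<longrightarrow> d x = 0"
proof -
  define h where "h = (\<lambda>x. indicator {0..1} x * d x)"
  have h: "integrable lborel h"
    using d by (simp add: set_integrable_def h_def)
  have hs: "set_integrable lborel A h" if "A \<in> sets lborel" for A
    by (rule set_integrable_subset[of lborel UNIV]) (use h that in \<open>auto simp: set_integrable_def\<close>)
  have cut: "(LINT x:A|lborel. h x) = (LINT x:(A \<inter> {0..1})|lborel. d x)" for A
    unfolding set_lebesgue_integral_def h_def
    by (rule Bochner_Integration.integral_cong) (auto simp: indicator_def)
  have "UNIV \<inter> {0..1} = {0..1::real}" by simp
  then have full: "(LINT x:UNIV|lborel. h x) = 0"
    using z[of 1] cut[of UNIV] by (metis atLeastAtMost_iff order_refl zero_le_one)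
  have base: "(LINT x:{..a}|lborel. h x) = 0" for a
  proof -
    have "{..a} \<inter> {0..1} = {0..min a 1}" by auto
    then have "(LINT x:{..a}|lborel. h x) = (LINT x:{0..min a 1}|lborel. d x)"
      using cut[of "{..a}"] by metis
    also have "\<dots> = 0"
    proof (cases "a < 0")
      case True
      then have "{0..min a 1} = {}" by auto
      then show ?thesis by (simp add: set_lebesgue_integral_def)
    next
      case False
      then show ?thesis by (intro z) auto
    qed
    finally show ?thesis .
  qed
  have gen: "sets lborel = sigma_sets UNIV (range (atMost :: real \<Rightarrow> real set))"
  proof -
    have "sets (borel :: real measure) = sets (sigma UNIV (range (atMost :: real \<Rightarrow> real set)))"
      by (metis borel_eq_atMost)
    then show ?thesis by (metis sets_lborel sets_measure_of subset_Pow_Union subset_UNIV Pow_UNIV)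
  qed
  have "(LINT x:A|lborel. h x) = 0" if "A \<in> sets lborel" for A
  proof -
    have "{..a} \<inter> {..b} = {..min a b}" for a b :: real by auto
    then have "Int_stable (range (atMost :: real \<Rightarrow> real set))"
      unfolding Int_stable_def by blast
    moreover have "range (atMost :: real \<Rightarrow> real set) \<subseteq> Pow UNIV" by simp
    moreover have "A \<in> sigma_sets UNIV (range atMost)"
      using that unfolding gen .
    ultimately show ?thesis
    proof (induction rule: sigma_sets_induct_disjoint)
      case (basic A)
      then show ?case using base by blast
    next
      case empty
      show ?case by (simp add: set_lebesgue_integral_def)
    next
      case (compl A)
      have A: "A \<in> sets lborel" using compl(1) unfolding gen .
      have A': "UNIV - A \<in> sets lborel" using A by (intro sets.Diff) simp_all
      have "(LINT x:(A \<union> (UNIV - A))|lborel. h x)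
          = (LINT x:A|lborel. h x) + (LINT x:(UNIV - A)|lborel. h x)"
        by (intro set_integral_Un hs A A') blast
      moreover have "A \<union> (UNIV - A) = UNIV" by blast
      ultimately show ?case using compl(2) full by (metis add_0)
    next
      case (union A)
      have A: "A i \<in> sets lborel" for i
        using union(2) unfolding gen by blast
      have "A i \<inter> A j = {}" if "i \<noteq> j" for i j
        using union(1) that by (metis disjoint_family_on_def UNIV_I)
      then have "(LINT x:(\<Union>i. A i)|lborel. h x) = (\<Sum>i. (LINT x:A i|lborel. h x))"
        using A by (intro lebesgue_integral_countable_add hs sets.countable_UN) blast+
      also have "\<dots> = (\<Sum>i::nat. 0)" unfolding union(3) ..
      finally show ?case by (metis suminf_zero)
    qed
  qed
  then have "AE x in lborel. h x = 0"
    by (intro sigma_finite_measure.density_zero[OF _ h])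
       (auto intro: lborel.sigma_finite_measure_axioms)
  then show ?thesis
    by eventually_elim (auto simp: h_def)
qed

lemma has_H1_derivD:
  assumes "has_H1_deriv f f'"
  shows "f' \<in> L2" "x \<in> {0..1} \<Longrightarrow> (LINT y:{0..x}|lborel. f' y) = f x - f 0"
proof -
  show "f' \<in> L2" using assms unfolding has_H1_deriv_def by (rule conjunct1)
  assume x: "x \<in> {0..1}"
  have "f x = f 0 + (LINT y:{0..x}|lborel. f' y)"
    using assms x unfolding has_H1_deriv_def by blast
  then show "(LINT y:{0..x}|lborel. f' y) = f x - f 0" by linarith
qed

lemma has_H1_deriv_unique:
  assumes "has_H1_deriv f f'" "has_H1_deriv f f''"
  shows "AE x in lborel. x \<in> {0..1} \<longrightarrow> f' x = f'' x"
proof -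
  have i: "set_integrable lborel {0..1} f'" "set_integrable lborel {0..1} f''"
    using assms by (auto intro: L2_set_integrable has_H1_derivD(1))
  have "AE x in lborel. x \<in> {0..1} \<longrightarrow> f' x - f'' x = 0"
  proof (rule set_integral_zero_imp_AE_zero)
    show "set_integrable lborel {0..1} (\<lambda>x. f' x - f'' x)"
      using i by (rule set_integral_diff)
    fix x :: real assume x: "x \<in> {0..1}"
    have "set_integrable lborel {0..x} f'" "set_integrable lborel {0..x} f''"
      using x by (auto intro: set_integrable_subset[OF i(1)] set_integrable_subset[OF i(2)])
    then have "(LINT y:{0..x}|lborel. f' y - f'' y)
        = (LINT y:{0..x}|lborel. f' y) - (LINT y:{0..x}|lborel. f'' y)"
      by (rule set_integral_diff)
    then show "(LINT y:{0..x}|lborel. f' y - f'' y) = 0"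
      using has_H1_derivD(2)[OF assms(1) x] has_H1_derivD(2)[OF assms(2) x] by linarith
  qed
  then show ?thesis by eventually_elim auto
qed

lemma h1_norm_eq:
  assumes "has_H1_deriv f f'"
  shows "h1_norm f = sqrt ((l2_norm f)\<^sup>2 + (l2_norm f')\<^sup>2)"
proof -
  have s: "has_H1_deriv f (H1_deriv f)"
    unfolding H1_deriv_def using assms by (rule someI[where P = "has_H1_deriv f"])
  have "(\<lambda>x. indicator {0..1} x *\<^sub>R g x) \<in> borel_measurable lborel" if "has_H1_deriv f g" for g
    using has_H1_derivD(1)[OF that] by (simp add: L2_def set_borel_measurable_def)
  from this[OF s] this[OF assms]
  have m: "(\<lambda>x. indicator {0..1} x * H1_deriv f x) \<in> borel_measurable lborel"
    "(\<lambda>x. indicator {0..1} x * f' x) \<in> borel_measurable lborel" by simp_all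
  have e: "(\<lambda>x. indicator {0..1} x * (g x * g x)) =
      (\<lambda>x. (indicator {0..1} x * g x) * (indicator {0..1} x * g x))" for g :: "real \<Rightarrow> real"
    by (auto simp: indicator_def)
  have "l2_inner (H1_deriv f) (H1_deriv f) = l2_inner f' f'"
    unfolding l2_inner_def set_lebesgue_integral_def real_scaleR_def
  proof (rule integral_cong_AE)
    show "(\<lambda>x. indicator {0..1} x * (H1_deriv f x * H1_deriv f x)) \<in> borel_measurable lborel"
      "(\<lambda>x. indicator {0..1} x * (f' x * f' x)) \<in> borel_measurable lborel"
      unfolding e using m by measurable
    show "AE x in lborel. indicat_real {0..1} x * (H1_deriv f x * H1_deriv f x)
        = indicat_real {0..1} x * (f' x * f' x)"
      using has_H1_deriv_unique[OF s assms] by eventually_elim (auto simp: indicator_def)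
  qed
  then show ?thesis by (simp add: h1_norm_def l2_norm_def)
qed

end

theory Submission
  imports Defs "Jordan_Normal_Form.Determinant"
begin

text \<open>
  The stability part is a Lyapunov argument for
  \<open>V(t) = X \<bullet> P\<^sub>X X + \<Sum>\<^sub>n\<^sub>>\<^sub>N \<lambda>\<^sub>n w\<^sub>n\<^sup>2\<close>, where \<open>w\<^sub>n = \<langle>w(\<cdot>,t), \<phi>\<^sub>n\<rangle>\<close> and \<open>X\<close> collects \<open>u\<close>, the observer modes and the
  errors up to \<open>N\<close>.  The state satisfies \<open>X' = F\<^sub>X X + L\<^sub>\<zeta> \<zeta> + G + H\<close> (\<open>state_dynamics\<close>): \<open>\<zeta>\<close> is the part of the
  measurement due to the modes beyond \<open>N\<close>, and \<open>G\<close>, \<open>H\<close> are the modes of the nonlinearity at the estimate and of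
  the error made there.  The form of \<open>\<Psi>\<^sub>0\<close> at \<open>(X, \<zeta>, G, H)\<close> is the derivative of \<open>X \<bullet> P\<^sub>X X\<close>, plus \<open>2 \<delta>\<close> times this
  functional, plus multiples of quantities with a sign: \<open>\<alpha>\<^sub>1\<close> and \<open>\<alpha>\<^sub>2\<close> belong to Bessel's inequality combined with the
  Lipschitz bound on \<open>g\<close>, \<open>\<rho>\<close> to a Sobolev bound of \<open>\<zeta>\<^sup>2\<close> by the tails of \<open>\<parallel>w\<parallel>\<^sup>2\<close> and \<open>\<parallel>w\<^sub>x\<parallel>\<^sup>2\<close>, and \<open>\<alpha>\<^sub>3\<close> to the
  control acting on the modes beyond \<open>N\<close>, where \<open>\<Sum>\<^sub>n\<^sub>>\<^sub>N \<lambda>\<^sub>n b\<^sub>n\<^sup>2 \<le> 2 \<xi> / \<pi>\<^sup>2\<close>.  What remains in these modes is a multiple of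
  \<open>w\<^sub>n\<^sup>2\<close> that is worst, relative to the Sobolev weight \<open>\<kappa>\<close>, at \<open>n = N + 1\<close>; there it is \<open>2 \<rho> \<kappa>\<close>.  Thus \<open>\<Psi>\<^sub>0 < 0\<close> gives
  \<open>V' + 2 \<delta> V \<le> 0\<close>, which is the content of \<open>lyapunov_pointwise\<close>.

  The analytic difficulty is that \<open>w\<close> is differentiable in time only as a curve in \<open>L\<^sup>2\<close>, and only continuous
  at \<open>t = 0\<close>, so that \<open>V\<close> itself cannot be differentiated.  The sum is therefore cut off at a finite \<open>M\<close>.  The
  inequality then has an excess, made of the parts of \<open>\<parallel>w\<parallel>\<^sup>2\<close> and \<open>\<parallel>w\<^sub>x\<parallel>\<^sup>2\<close> beyond \<open>M\<close>.  It tends to zero at each time: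
  for \<open>\<parallel>w\<parallel>\<^sup>2\<close> by Parseval's identity, which follows from the Stone--Weierstrass theorem, and for
  \<open>\<parallel>w\<^sub>x\<parallel>\<^sup>2 = - \<langle>w\<^sub>x\<^sub>x, w\<rangle>\<close> by the Neumann conditions.  An energy estimate bounds it down to the initial time, so dominated
  convergence (\<open>vanishing_excess_comparison\<close>) yields \<open>exp (2 \<delta> t) V(t) \<le> V(0)\<close>.  Coercivity of \<open>P\<^sub>X\<close>
  (\<open>pos_def_coercive\<close>) on the left and Bessel's inequality for the sines \<open>\<phi>\<^sub>n'\<close> on the right translate this into
  \<open>H\<^sup>1\<close> norms.

  For feasibility, \<open>P\<^sub>X\<close> is block diagonal, with \<open>P\<^sub>c\<close>, a multiple of \<open>P\<^sub>o\<close>, and multiples of the identity on the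
  high modes of the observer and of the error.  The linear closed loop is a cascade, in which the high errors drive the
  low errors, both drive the controlled part, and this drives the high observer modes; so weights can be chosen
  one after the other that make the functional decrease (\<open>cascade_inequality\<close>), up to a multiple of \<open>\<zeta>\<^sup>2\<close> that is
  independent of \<open>N\<close>.  Since \<open>\<rho>\<close> tends to \<open>-\<infinity>\<close> and \<open>\<xi>\<close> to zero as \<open>N\<close> grows, a large \<open>N\<close> takes care of these two
  terms.  Large \<open>\<alpha>\<^sub>1 = \<alpha>\<^sub>2\<close> then absorb the columns of the nonlinear terms, and a small \<open>\<sigma>\<close> the terms with \<open>\<sigma>\<^sup>2\<close>.
\<close>

section \<open>Square integrable functions on the unit interval\<close>

text \<open>With the restricted measure, set integrals over the unit interval become ordinary Bochner
  integrals, to which the library rules apply.\<close>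

abbreviation unit_meas :: "real measure" where
  "unit_meas \<equiv> restrict_space lborel {0..1}"

lemma L2_iff:
  "f \<in> L2 \<longleftrightarrow> f \<in> borel_measurable unit_meas \<and> integrable unit_meas (\<lambda>x. (f x)\<^sup>2)"
  by (simp add: L2_def set_borel_measurable_def set_integrable_def
      borel_measurable_restrict_space_iff integrable_restrict_space)

lemma l2_inner_eq: "l2_inner f g = (LINT x|unit_meas. f x * g x)"
  by (simp add: l2_inner_def set_lebesgue_integral_def integral_restrict_space)

lemma finite_unit_meas: "finite_measure unit_meas"
  by (rule finite_measureI) (simp add: emeasure_restrict_space space_restrict_space)

lemma integrable_unit_const: "integrable unit_meas (\<lambda>_. c :: real)"
  using finite_unit_meas finite_measure.integrable_const by blast

lemma measure_unit_meas [simp]: "measure unit_meas {0..1} = 1"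
  by (simp add: measure_restrict_space)

lemma integral_unit_const: "(LINT x|unit_meas. c) = (c :: real)"
  by simp

lemma L2_mult_integrable:
  assumes "f \<in> L2" "g \<in> L2"
  shows "integrable unit_meas (\<lambda>x. f x * g x)"
proof (rule Bochner_Integration.integrable_bound)
  show "integrable unit_meas (\<lambda>x. (f x)\<^sup>2 + (g x)\<^sup>2)"
    using assms by (auto simp: L2_iff)
  show "(\<lambda>x. f x * g x) \<in> borel_measurable unit_meas"
    using assms by (auto simp: L2_iff)
  have "\<bar>a * b\<bar> \<le> a\<^sup>2 + b\<^sup>2" for a b :: real
  proof -
    have "2 * \<bar>a * b\<bar> \<le> a\<^sup>2 + b\<^sup>2"
      using sum_squares_bound[of "\<bar>a\<bar>" "\<bar>b\<bar>"] by (simp add: abs_mult)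
    then show ?thesis by linarith
  qed
  then show "AE x in unit_meas. norm (f x * g x) \<le> norm ((f x)\<^sup>2 + (g x)\<^sup>2)"
    by auto
qed

lemma L2_add [intro]:
  assumes "f \<in> L2" "g \<in> L2"
  shows "(\<lambda>x. f x + g x) \<in> L2"
proof -
  have "integrable unit_meas (\<lambda>x. (f x)\<^sup>2 + 2 * (f x * g x) + (g x)\<^sup>2)"
    using assms L2_mult_integrable[OF assms] by (auto simp: L2_iff)
  then show ?thesis using assms by (auto simp: L2_iff power2_sum algebra_simps)
qed

lemma L2_scale [intro]: "f \<in> L2 \<Longrightarrow> (\<lambda>x. c * f x) \<in> L2"
  by (auto simp: L2_iff power_mult_distrib)

lemma L2_minus [intro]: "f \<in> L2 \<Longrightarrow> (\<lambda>x. - f x) \<in> L2"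
  by (auto simp: L2_iff)

lemma L2_diff [intro]: "f \<in> L2 \<Longrightarrow> g \<in> L2 \<Longrightarrow> (\<lambda>x. f x - g x) \<in> L2"
  using L2_add[OF _ L2_minus] by fastforce

lemma L2_continuous:
  assumes "continuous_on {0..1} f"
  shows "f \<in> L2"
proof -
  have "set_integrable lborel {0..1} (\<lambda>x. (f x)\<^sup>2)"
    unfolding set_integrable_def using assms
    by (intro borel_integrable_compact) (auto intro: continuous_intros)
  moreover have "set_borel_measurable lborel {0..1} f"
    using borel_measurable_continuous_on_indicator[OF _ assms]
    by (simp add: set_borel_measurable_def)
  ultimately show ?thesis by (simp add: L2_def)
qed

lemma L2_sum [intro]: "(\<And>i. i \<in> I \<Longrightarrow> f i \<in> L2) \<Longrightarrow> (\<lambda>x. \<Sum>i\<in>I. f i x) \<in> L2"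
  by (induction I rule: infinite_finite_induct) (auto intro: L2_continuous)

lemma l2_inner_commute: "l2_inner f g = l2_inner g f"
  by (simp add: l2_inner_def mult.commute)

lemma l2_inner_add_left:
  "f \<in> L2 \<Longrightarrow> g \<in> L2 \<Longrightarrow> h \<in> L2 \<Longrightarrow> l2_inner (\<lambda>x. f x + g x) h = l2_inner f h + l2_inner g h"
  by (simp add: l2_inner_eq distrib_right L2_mult_integrable)

lemma l2_inner_diff_left:
  "f \<in> L2 \<Longrightarrow> g \<in> L2 \<Longrightarrow> h \<in> L2 \<Longrightarrow> l2_inner (\<lambda>x. f x - g x) h = l2_inner f h - l2_inner g h"
  by (simp add: l2_inner_eq left_diff_distrib L2_mult_integrable)

lemma l2_inner_scale_left: "l2_inner (\<lambda>x. c * f x) h = c * l2_inner f h"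
  by (simp add: l2_inner_eq mult.assoc)

lemma l2_inner_sum_left:
  assumes "\<And>i. i \<in> I \<Longrightarrow> f i \<in> L2" "h \<in> L2"
  shows "l2_inner (\<lambda>x. \<Sum>i\<in>I. f i x) h = (\<Sum>i\<in>I. l2_inner (f i) h)"
  using assms by (simp add: l2_inner_eq sum_distrib_right L2_mult_integrable)

lemma l2_inner_diff_right:
  "f \<in> L2 \<Longrightarrow> g \<in> L2 \<Longrightarrow> h \<in> L2 \<Longrightarrow> l2_inner h (\<lambda>x. f x - g x) = l2_inner h f - l2_inner h g"
  by (metis l2_inner_commute l2_inner_diff_left)

lemma l2_inner_self_nonneg: "0 \<le> l2_inner f f"
  by (simp add: l2_inner_eq)

lemma l2_norm_nonneg [simp]: "0 \<le> l2_norm f"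
  by (simp add: l2_norm_def l2_inner_self_nonneg)

lemma l2_norm_sq: "(l2_norm f)\<^sup>2 = l2_inner f f"
  by (simp add: l2_norm_def l2_inner_self_nonneg)

lemma l2_inner_cong:
  "(\<And>x. x \<in> {0..1} \<Longrightarrow> f x = f' x) \<Longrightarrow> (\<And>x. x \<in> {0..1} \<Longrightarrow> g x = g' x) \<Longrightarrow>
    l2_inner f g = l2_inner f' g'"
  unfolding l2_inner_eq by (rule Bochner_Integration.integral_cong) (auto simp: space_restrict_space)

lemma AE_unit_meas:
  assumes "AE x in lborel. x \<in> {0<..<1} \<longrightarrow> P x"
  shows "AE x in unit_meas. P x"
proof -
  have "AE x in lborel. x \<noteq> (0::real)" "AE x in lborel. x \<noteq> (1::real)"
    by (rule AE_lborel_singleton)+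
  with assms have "AE x in lborel. x \<in> {0..1} \<longrightarrow> P x"
    by eventually_elim auto
  then show ?thesis by (subst AE_restrict_space_iff) auto
qed

lemma l2_inner_cong_AE:
  assumes "AE x in unit_meas. f x = f' x" "f \<in> L2" "f' \<in> L2" "h \<in> L2"
  shows "l2_inner f h = l2_inner f' h"
  unfolding l2_inner_eq using assms
  by (intro integral_cong_AE) (auto simp: L2_iff)

lemma l2_inner_mono:
  assumes "f \<in> L2" "g \<in> L2" "\<And>x. x \<in> {0..1} \<Longrightarrow> \<bar>f x\<bar> \<le> \<bar>g x\<bar>"
  shows "l2_inner f f \<le> l2_inner g g"
  unfolding l2_inner_eq
proof (rule integral_mono)
  show "f x * f x \<le> g x * g x" if "x \<in> space unit_meas" for x
  proof -
    have "\<bar>f x\<bar> * \<bar>f x\<bar> \<le> \<bar>g x\<bar> * \<bar>g x\<bar>"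
      by (intro mult_mono assms(3)) (use that in \<open>auto simp: space_restrict_space\<close>)
    then show ?thesis by simp
  qed
qed (use assms in \<open>auto intro: L2_mult_integrable\<close>)

lemma l2_norm_expand:
  assumes "f \<in> L2" "g \<in> L2"
  shows "l2_inner (\<lambda>x. f x + c * g x) (\<lambda>x. f x + c * g x)
    = l2_inner f f + 2 * c * l2_inner f g + c\<^sup>2 * l2_inner g g"
proof -
  have cg: "(\<lambda>x. c * g x) \<in> L2" using assms by auto
  have s: "(\<lambda>x. f x + c * g x) \<in> L2" using assms by auto
  have "l2_inner (\<lambda>x. f x + c * g x) (\<lambda>x. f x + c * g x)
      = l2_inner f (\<lambda>x. f x + c * g x) + c * l2_inner g (\<lambda>x. f x + c * g x)"
    using l2_inner_add_left[OF assms(1) cg s] l2_inner_scale_left by simp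
  moreover have "l2_inner h (\<lambda>x. f x + c * g x) = l2_inner f h + c * l2_inner g h" if "h \<in> L2" for h
    using l2_inner_add_left[OF assms(1) cg that] l2_inner_scale_left
    by (metis l2_inner_commute)
  ultimately show ?thesis using assms
    by (simp add: l2_inner_commute[of g f] algebra_simps power2_eq_square)
qed

text \<open>\<open>\<parallel>f + s g\<parallel>\<^sup>2\<close> is a quadratic polynomial in \<open>s\<close> without negative values.  A \<open>g\<close> that vanishes almost
  everywhere makes it linear, hence the case distinction.\<close>

lemma l2_Cauchy_Schwarz:
  assumes "f \<in> L2" "g \<in> L2"
  shows "\<bar>l2_inner f g\<bar> \<le> l2_norm f * l2_norm g"
proof -
  let ?a = "l2_inner f f" and ?b = "l2_inner f g" and ?c = "l2_inner g g"
  have q: "0 \<le> ?a + 2 * s * ?b + s\<^sup>2 * ?c" for s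
    using l2_norm_expand[OF assms, of s] l2_inner_self_nonneg by metis
  have "?b\<^sup>2 \<le> ?a * ?c"
  proof (cases "?c = 0")
    case True
    have "?b = 0"
    proof (rule ccontr)
      assume b: "?b \<noteq> 0"
      have "0 \<le> ?a + 2 * (- (?a + 1) / (2 * ?b)) * ?b" using q[of "- (?a + 1) / (2 * ?b)"] True by simp
      then show False using b by (simp add: field_simps)
    qed
    then show ?thesis using True by simp
  next
    case False
    then have c: "?c > 0" using l2_inner_self_nonneg[of g] by simp
    have "0 \<le> ?a - ?b\<^sup>2 / ?c"
      using q[of "- ?b / ?c"] c by (simp add: field_simps power2_eq_square)
    then show ?thesis using c by (simp add: field_simps)
  qed
  then have "\<bar>?b\<bar> \<le> sqrt (?a * ?c)"
    by (metis real_sqrt_abs real_sqrt_le_iff)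
  then show ?thesis by (simp add: l2_norm_def real_sqrt_mult)
qed

lemma l2_norm_diff_triangle:
  assumes "f \<in> L2" "g \<in> L2"
  shows "\<bar>l2_norm f - l2_norm g\<bar> \<le> l2_norm (\<lambda>x. f x - g x)"
proof -
  have "(l2_norm f - l2_norm g)\<^sup>2 \<le> (l2_norm (\<lambda>x. f x - g x))\<^sup>2"
  proof -
    have "(l2_norm (\<lambda>x. f x - g x))\<^sup>2 = l2_inner f f - 2 * l2_inner f g + l2_inner g g"
      using l2_norm_expand[OF assms, of "-1"] by (simp add: l2_norm_sq)
    moreover have "l2_inner f g \<le> l2_norm f * l2_norm g"
      using l2_Cauchy_Schwarz[OF assms] by linarith
    ultimately show ?thesis by (simp add: power2_diff l2_norm_sq)
  qed
  then show ?thesis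
    by (metis abs_le_square_iff abs_of_nonneg l2_norm_nonneg)
qed

text \<open>The parallelogram law without the square of the difference.  The factor two is the one in the term
  \<open>2 \<alpha>\<^sub>1 \<sigma>\<^sup>2 \<Xi>\<^sub>X\<close> of \<open>\<psi>\<^sub>0\<close>.\<close>

lemma l2_inner_self_add_le:
  assumes "f \<in> L2" "g \<in> L2"
  shows "l2_inner (\<lambda>x. f x + g x) (\<lambda>x. f x + g x) \<le> 2 * l2_inner f f + 2 * l2_inner g g"
  using l2_norm_expand[OF assms, of 1] l2_norm_expand[OF assms, of "-1"]
    l2_inner_self_nonneg[of "\<lambda>x. f x + -1 * g x"] by simp

subsection \<open>Orthonormal families\<close>

definition orthonormal :: "(nat \<Rightarrow> real \<Rightarrow> real) \<Rightarrow> bool" where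
  "orthonormal e \<longleftrightarrow> (\<forall>n. e n \<in> L2) \<and> (\<forall>m n. l2_inner (e m) (e n) = (if m = n then 1 else 0))"

lemma orthonormal_comb_inner:
  assumes "orthonormal e"
  shows "l2_inner (\<lambda>x. \<Sum>n\<le>M. a n * e n x) (e k) = (if k \<le> M then a k else 0)"
proof -
  have "l2_inner (\<lambda>x. \<Sum>n\<le>M. a n * e n x) (e k) = (\<Sum>n\<le>M. l2_inner (\<lambda>x. a n * e n x) (e k))"
    using assms by (intro l2_inner_sum_left) (auto simp: orthonormal_def)
  also have "\<dots> = (\<Sum>n\<le>M. if n = k then a n else 0)"
    using assms by (intro sum.cong) (auto simp: l2_inner_scale_left orthonormal_def)
  also have "\<dots> = (if k \<le> M then a k else 0)" by simp
  finally show ?thesis .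
qed

lemma orthonormal_comb_L2: "orthonormal e \<Longrightarrow> (\<lambda>x. \<Sum>n\<le>M. a n * e n x) \<in> L2"
  by (intro L2_sum L2_scale) (auto simp: orthonormal_def)

lemma orthonormal_inner_comb:
  assumes "orthonormal e" "f \<in> L2"
  shows "l2_inner f (\<lambda>x. \<Sum>n\<le>M. a n * e n x) = (\<Sum>n\<le>M. a n * l2_inner f (e n))"
proof -
  have "l2_inner f (\<lambda>x. \<Sum>n\<le>M. a n * e n x) = (\<Sum>n\<le>M. l2_inner (\<lambda>x. a n * e n x) f)"
    using assms by (subst l2_inner_commute, intro l2_inner_sum_left) (auto simp: orthonormal_def)
  then show ?thesis by (simp add: l2_inner_scale_left l2_inner_commute)
qed

lemma orthonormal_comb_norm:
  assumes "orthonormal e"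
  shows "l2_inner (\<lambda>x. \<Sum>n\<le>M. a n * e n x) (\<lambda>x. \<Sum>n\<le>M. a n * e n x) = (\<Sum>n\<le>M. (a n)\<^sup>2)"
  using assms
  by (simp add: orthonormal_inner_comb orthonormal_comb_L2 orthonormal_comb_inner power2_eq_square)

text \<open>Completing the square coefficient by coefficient.  The right-hand side is least when the \<open>a n\<close> are
  the Fourier coefficients, so that a single good approximation of \<open>f\<close> forces the Fourier sums to be
  as good; at the minimum, nonnegativity is Bessel's inequality.\<close>

lemma orthonormal_distance:
  assumes "orthonormal e" "f \<in> L2"
  shows "l2_inner (\<lambda>x. f x - (\<Sum>n\<le>M. a n * e n x)) (\<lambda>x. f x - (\<Sum>n\<le>M. a n * e n x))
    = l2_inner f f - (\<Sum>n\<le>M. (l2_inner f (e n))\<^sup>2) + (\<Sum>n\<le>M. (a n - l2_inner f (e n))\<^sup>2)"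
proof -
  let ?s = "\<lambda>x. \<Sum>n\<le>M. a n * e n x"
  have "l2_inner (\<lambda>x. f x - ?s x) (\<lambda>x. f x - ?s x)
      = l2_inner f f - 2 * l2_inner f ?s + l2_inner ?s ?s"
    using l2_norm_expand[OF assms(2) orthonormal_comb_L2[OF assms(1)], of "-1"] by simp
  also have "\<dots> = l2_inner f f - 2 * (\<Sum>n\<le>M. a n * l2_inner f (e n)) + (\<Sum>n\<le>M. (a n)\<^sup>2)"
    using orthonormal_comb_norm[OF assms(1)] orthonormal_inner_comb[OF assms] by simp
  also have "\<dots> = l2_inner f f - (\<Sum>n\<le>M. (l2_inner f (e n))\<^sup>2) + (\<Sum>n\<le>M. (a n - l2_inner f (e n))\<^sup>2)"
    by (simp add: power2_diff sum.distrib sum_subtractf sum_distrib_left mult_ac)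
  finally show ?thesis .
qed

lemma Bessel_inequality:
  assumes "orthonormal e" "f \<in> L2"
  shows "(\<Sum>n\<le>M. (l2_inner f (e n))\<^sup>2) \<le> l2_inner f f"
  using orthonormal_distance[OF assms, where M = M and a = "\<lambda>n. l2_inner f (e n)"]
    l2_inner_self_nonneg[of "\<lambda>x. f x - (\<Sum>n\<le>M. l2_inner f (e n) * e n x)"] by simp

section \<open>Absolutely continuous functions\<close>

lemma H1_FTC:
  assumes "has_H1_deriv f f'" "0 \<le> a" "a \<le> b" "b \<le> 1"
  shows "set_integrable lborel {a..b} f'" "(f' has_integral (f b - f a)) {a..b}"
    "(LINT y:{a..b}|lborel. f' y) = f b - f a"
proof -
  have i: "set_integrable lborel {c..d} f'" if "0 \<le> c" "d \<le> 1" for c d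
    by (rule set_integrable_subset[OF L2_set_integrable[OF has_H1_derivD(1)[OF assms(1)]]])
      (use that in auto)
  show "set_integrable lborel {a..b} f'" using i assms by blast
  have h: "(f' has_integral (f d - f 0)) {0..d}" if "0 \<le> d" "d \<le> 1" for d
    using set_borel_integral_eq_integral[OF i[of 0 d]] has_H1_derivD(2)[OF assms(1), of d] that
    by (simp add: has_integral_iff)
  have "f' integrable_on {a..b}"
    using set_borel_integral_eq_integral(1)[OF i] assms by blast
  moreover have "integral {0..a} f' + integral {a..b} f' = integral {0..b} f'"
    using assms h[of b] by (intro Henstock_Kurzweil_Integration.integral_combine) auto
  ultimately show *: "(f' has_integral (f b - f a)) {a..b}"
    using h[of a] h[of b] assms by (simp add: has_integral_iff)
  show "(LINT y:{a..b}|lborel. f' y) = f b - f a"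
    using set_borel_integral_eq_integral(2)[OF i[of a b]] * assms by (simp add: has_integral_iff)
qed

lemma H1_continuous:
  assumes "has_H1_deriv f f'"
  shows "continuous_on {0..1} f"
proof -
  have "f' integrable_on {0..1}"
    using H1_FTC(2)[OF assms, of 0 1] by auto
  then have "continuous_on {0..1} (\<lambda>x. f 0 + integral {0..x} f')"
    by (intro continuous_intros indefinite_integral_continuous_1)
  moreover have "f 0 + integral {0..x} f' = f x" if "x \<in> {0..1}" for x
    using H1_FTC(2)[OF assms, of 0 x] that by (simp add: has_integral_iff)
  ultimately show ?thesis by (rule continuous_on_eq)
qed

lemma H1_L2: "has_H1_deriv f f' \<Longrightarrow> f \<in> L2" "has_H1_deriv f f' \<Longrightarrow> f' \<in> L2"
  by (auto intro: L2_continuous H1_continuous has_H1_derivD(1))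

lemma has_H1_deriv_smooth:
  assumes "\<And>x. (f has_real_derivative f' x) (at x)" "continuous_on UNIV f'"
  shows "has_H1_deriv f f'"
  unfolding has_H1_deriv_def
proof (intro conjI ballI)
  have c: "continuous_on S f'" for S using assms(2) continuous_on_subset by blast
  then show "f' \<in> L2" by (intro L2_continuous)
  fix x :: real assume x: "x \<in> {0..1}"
  have "(f' has_integral (f x - f 0)) {0..x}"
    using x by (intro fundamental_theorem_of_calculus)
      (auto simp: has_real_derivative_iff_has_vector_derivative[symmetric] intro: assms(1) DERIV_subset)
  moreover have "set_integrable lborel {0..x} f'"
    unfolding set_integrable_def by (intro borel_integrable_compact c) simp
  ultimately show "f x = f 0 + (LINT y:{0..x}|lborel. f' y)"
    using set_borel_integral_eq_integral(2)[of "{0..x}" f'] by (simp add: has_integral_iff)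
qed

lemma has_H1_deriv_add:
  assumes "has_H1_deriv f f'" "has_H1_deriv g g'"
  shows "has_H1_deriv (\<lambda>x. f x + c * g x) (\<lambda>x. f' x + c * g' x)"
  unfolding has_H1_deriv_def
proof (intro conjI ballI)
  show "(\<lambda>x. f' x + c * g' x) \<in> L2"
    by (intro L2_add L2_scale H1_L2(2)[OF assms(1)] H1_L2(2)[OF assms(2)])
  fix x :: real assume x: "x \<in> {0..1}"
  have i: "set_integrable lborel {0..x} f'" "set_integrable lborel {0..x} g'"
    using H1_FTC(1)[OF assms(1)] H1_FTC(1)[OF assms(2)] x by auto
  then show "f x + c * g x = f 0 + c * g 0 + (LINT y:{0..x}|lborel. f' y + c * g' y)"
    using has_H1_derivD(2)[OF assms(1) x] has_H1_derivD(2)[OF assms(2) x]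
    by (simp add: set_integral_add right_diff_distrib)
qed

lemma has_H1_deriv_diff:
  assumes "has_H1_deriv f f'" "has_H1_deriv g g'"
  shows "has_H1_deriv (\<lambda>x. f x - g x) (\<lambda>x. f' x - g' x)"
  using has_H1_deriv_add[OF assms, of "-1"] by simp

lemma has_H1_deriv_zero: "has_H1_deriv (\<lambda>_. 0) (\<lambda>_. 0)"
  by (rule has_H1_deriv_smooth) auto

lemma has_H1_deriv_sum:
  assumes "\<And>n. has_H1_deriv (e n) (e' n)" "finite I"
  shows "has_H1_deriv (\<lambda>x. \<Sum>n\<in>I. a n * e n x) (\<lambda>x. \<Sum>n\<in>I. a n * e' n x)"
  using assms(2)
proof (induction I)
  case empty
  show ?case using has_H1_deriv_zero by simp
next
  case (insert i I)
  then show ?case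
    using has_H1_deriv_add[OF insert.IH assms(1), of "a i" i] by (simp add: add.commute)
qed

text \<open>Exchanging the order of integration over the triangle \<open>a \<le> y \<le> x \<le> b\<close> turns the integral of
  \<open>f' (g - g a)\<close> into that of \<open>(f b - f) g'\<close>.  This is how integration by parts is obtained for
  functions that are defined as integrals of square integrable functions.\<close>

lemma triangle_Fubini:
  fixes p q :: "real \<Rightarrow> real"
  assumes "integrable lborel p" "integrable lborel q"
  shows "(LINT y|lborel. q y * (LINT x|lborel. indicator {y..} x * p x))
    = (LINT x|lborel. p x * (LINT y|lborel. indicator {..x} y * q y))"
proof -
  have pm [measurable]: "p \<in> borel_measurable borel" "q \<in> borel_measurable borel"
    using assms by auto
  let ?F = "\<lambda>(x, y). (if y \<le> x then p x * q y else 0)"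
  have m: "?F \<in> borel_measurable (lborel \<Otimes>\<^sub>M lborel)"
    by measurable
  have i: "integrable lborel (\<lambda>y. if y \<le> x then p x * q y else 0)" for x
  proof (rule Bochner_Integration.integrable_bound)
    show "integrable lborel (\<lambda>y. p x * q y)" using assms by simp
  qed (use pm in auto)
  have "integrable (lborel \<Otimes>\<^sub>M lborel) ?F"
  proof (rule lborel_pair.Fubini_integrable[OF m])
    show "integrable lborel (\<lambda>x. LINT y|lborel. norm (?F (x, y)))"
    proof (rule Bochner_Integration.integrable_bound)
      show "integrable lborel (\<lambda>x. \<bar>p x\<bar> * (LINT y|lborel. \<bar>q y\<bar>))" using assms by simp
      show "(\<lambda>x. LINT y|lborel. norm (?F (x, y))) \<in> borel_measurable lborel"
        using m by measurable
      have "(LINT y|lborel. norm (?F (x, y))) \<le> (LINT y|lborel. \<bar>p x\<bar> * \<bar>q y\<bar>)" for x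
        using i[of x] assms by (intro integral_mono) (auto simp: abs_mult)
      moreover have "0 \<le> (LINT y|lborel. norm (?F (x, y)))" for x by simp
      ultimately show "AE x in lborel. norm (LINT y|lborel. norm (?F (x, y)))
          \<le> norm (\<bar>p x\<bar> * (LINT y|lborel. \<bar>q y\<bar>))"
        by (auto simp: abs_mult)
    qed
    show "AE x in lborel. integrable lborel (\<lambda>y. ?F (x, y))"
      using i by simp
  qed
  then have "(LINT y|lborel. LINT x|lborel. ?F (x, y)) = (LINT x|lborel. LINT y|lborel. ?F (x, y))"
    using lborel_pair.Fubini_integral[of "\<lambda>x y. ?F (x, y)"] by simp
  moreover have "(LINT x|lborel. ?F (x, y)) = q y * (LINT x|lborel. indicator {y..} x * p x)" for y
    by (subst Bochner_Integration.integral_mult_right_zero[symmetric],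
        rule Bochner_Integration.integral_cong) (auto simp: indicator_def)
  moreover have "(LINT y|lborel. ?F (x, y)) = p x * (LINT y|lborel. indicator {..x} y * q y)" for x
    by (subst Bochner_Integration.integral_mult_right_zero[symmetric],
        rule Bochner_Integration.integral_cong) (auto simp: indicator_def)
  ultimately show ?thesis by simp
qed

lemma H1_integration_by_parts:
  assumes f: "has_H1_deriv f f'" and g: "has_H1_deriv g g'"
    and ab: "0 \<le> a" "a \<le> b" "b \<le> 1"
  shows "(LINT x:{a..b}|lborel. f' x * g x + f x * g' x) = f b * g b - f a * g a"
proof -
  define p q where "p = (\<lambda>x. indicator {a..b} x * f' x)" and "q = (\<lambda>x. indicator {a..b} x * g' x)"
  have pq: "integrable lborel p" "integrable lborel q"
    using H1_FTC(1)[OF f ab] H1_FTC(1)[OF g ab]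
    by (simp_all add: set_integrable_def p_def q_def)
  have ip: "(LINT x|lborel. indicator {y..} x * p x) = f b - f y" if "y \<in> {a..b}" for y
  proof -
    have "(LINT x|lborel. indicator {y..} x * p x) = (LINT x:{y..b}|lborel. f' x)"
      unfolding set_lebesgue_integral_def p_def
      by (rule Bochner_Integration.integral_cong) (use that in \<open>auto simp: indicator_def\<close>)
    then show ?thesis
      using H1_FTC(3)[OF f, of y b] that ab by simp
  qed
  have iq: "(LINT y|lborel. indicator {..x} y * q y) = g x - g a" if "x \<in> {a..b}" for x
  proof -
    have "(LINT y|lborel. indicator {..x} y * q y) = (LINT y:{a..x}|lborel. g' y)"
      unfolding set_lebesgue_integral_def q_def
      by (rule Bochner_Integration.integral_cong) (use that in \<open>auto simp: indicator_def\<close>)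
    then show ?thesis
      using H1_FTC(3)[OF g, of a x] that ab by simp
  qed
  have prod: "set_integrable lborel {a..b} (\<lambda>x. h x * k x)" if "h \<in> L2" "k \<in> L2" for h k
  proof (rule set_integrable_subset)
    show "set_integrable lborel {0..1} (\<lambda>x. h x * k x)"
      using L2_mult_integrable[OF that] by (simp add: set_integrable_def integrable_restrict_space)
  qed (use ab in auto)
  have "(LINT y|lborel. q y * (LINT x|lborel. indicator {y..} x * p x))
      = (LINT y:{a..b}|lborel. g' y * (f b - f y))"
    unfolding set_lebesgue_integral_def
  proof (rule Bochner_Integration.integral_cong)
    show "q y * (LINT x|lborel. indicator {y..} x * p x)
        = indicator {a..b} y *\<^sub>R (g' y * (f b - f y))" for y
      using ip[of y] by (cases "y \<in> {a..b}") (simp_all add: q_def)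
  qed simp
  moreover have "(LINT x|lborel. p x * (LINT y|lborel. indicator {..x} y * q y))
      = (LINT x:{a..b}|lborel. f' x * (g x - g a))"
    unfolding set_lebesgue_integral_def
  proof (rule Bochner_Integration.integral_cong)
    show "p x * (LINT y|lborel. indicator {..x} y * q y)
        = indicator {a..b} x *\<^sub>R (f' x * (g x - g a))" for x
      using iq[of x] by (cases "x \<in> {a..b}") (simp_all add: p_def)
  qed simp
  ultimately have e: "(LINT y:{a..b}|lborel. g' y * (f b - f y))
      = (LINT x:{a..b}|lborel. f' x * (g x - g a))"
    using triangle_Fubini[OF pq] by simp
  have L: "f \<in> L2" "f' \<in> L2" "g \<in> L2" "g' \<in> L2"
    by (rule H1_L2(1)[OF f], rule H1_L2(2)[OF f], rule H1_L2(1)[OF g], rule H1_L2(2)[OF g])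
  have If: "(LINT x:{a..b}|lborel. f' x) = f b - f a" and Ig: "(LINT x:{a..b}|lborel. g' x) = g b - g a"
    by (rule H1_FTC(3)[OF f ab], rule H1_FTC(3)[OF g ab])
  have "(LINT y:{a..b}|lborel. g' y * (f b - f y))
      = (LINT y:{a..b}|lborel. f b * g' y) - (LINT y:{a..b}|lborel. f y * g' y)"
    using set_integral_diff(2)[of lborel "{a..b}" "\<lambda>y. f b * g' y" "\<lambda>y. f y * g' y"]
      H1_FTC(1)[OF g ab] prod[OF L(1,4)] by (simp add: algebra_simps)
  moreover have "(LINT x:{a..b}|lborel. f' x * (g x - g a))
      = (LINT x:{a..b}|lborel. f' x * g x) - (LINT x:{a..b}|lborel. g a * f' x)"
    using set_integral_diff(2)[of lborel "{a..b}" "\<lambda>x. f' x * g x" "\<lambda>x. g a * f' x"]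
      H1_FTC(1)[OF f ab] prod[OF L(2,3)] by (simp add: algebra_simps)
  moreover have "(LINT x:{a..b}|lborel. f' x * g x + f x * g' x)
      = (LINT x:{a..b}|lborel. f' x * g x) + (LINT x:{a..b}|lborel. f x * g' x)"
    by (intro set_integral_add(2) prod L)
  ultimately show ?thesis using e If Ig by (simp add: algebra_simps)
qed

lemma H1_inner_by_parts:
  assumes "has_H1_deriv f f'" "has_H1_deriv g g'"
  shows "l2_inner f' g = f 1 * g 1 - f 0 * g 0 - l2_inner f g'"
proof -
  have "l2_inner f' g + l2_inner f g' = (LINT x:{0..1}|lborel. f' x * g x + f x * g' x)"
  proof -
    have "l2_inner f' g + l2_inner f g' = (LINT x|unit_meas. f' x * g x + f x * g' x)"
      using L2_mult_integrable[OF H1_L2(2)[OF assms(1)] H1_L2(1)[OF assms(2)]]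
        L2_mult_integrable[OF H1_L2(1)[OF assms(1)] H1_L2(2)[OF assms(2)]]
      by (simp add: l2_inner_eq)
    then show ?thesis by (simp add: integral_restrict_space set_lebesgue_integral_def)
  qed
  then show ?thesis using H1_integration_by_parts[OF assms, of 0 1] by simp
qed

text \<open>A value of \<open>f\<^sup>2\<close> differs from any other by at most the integral of \<open>2 \<bar>f f'\<bar>\<close>.  Averaging over the
  other point bounds it by \<open>\<parallel>f\<parallel>\<^sup>2\<close> plus that integral, and Young's inequality with the weight \<open>\<Gamma>\<close>
  splits the product.\<close>

lemma Sobolev_inequality:
  assumes f: "has_H1_deriv f f'" and x: "x \<in> {0..1}" and \<Gamma>: "\<Gamma> > 0"
  shows "(f x)\<^sup>2 \<le> (1 + \<Gamma>) * l2_inner f f + inverse \<Gamma> * l2_inner f' f'"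
proof -
  have L: "f \<in> L2" "f' \<in> L2" by (rule H1_L2(1)[OF f], rule H1_L2(2)[OF f])
  have abs: "(\<lambda>x. \<bar>h x\<bar>) \<in> L2" if "h \<in> L2" for h
    using that by (auto simp: L2_iff)
  let ?c = "LINT x|unit_meas. \<bar>f x\<bar> * \<bar>f' x\<bar>"
  have ci: "integrable unit_meas (\<lambda>x. \<bar>f x\<bar> * \<bar>f' x\<bar>)"
    by (intro L2_mult_integrable abs L)
  have seg: "\<bar>(f b)\<^sup>2 - (f a)\<^sup>2\<bar> \<le> 2 * ?c" if ab: "0 \<le> a" "a \<le> b" "b \<le> 1" for a b
  proof -
    have "set_integrable lborel {0..1} (\<lambda>x. f' x * f x + f x * f' x)"
      using L2_mult_integrable[OF L] L2_mult_integrable[OF L(2) L(1)]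
      by (intro set_integral_add) (auto simp: set_integrable_def integrable_restrict_space)
    then have i: "set_integrable lborel {a..b} (\<lambda>x. f' x * f x + f x * f' x)"
      by (rule set_integrable_subset) (use ab in auto)
    have "\<bar>(f b)\<^sup>2 - (f a)\<^sup>2\<bar> = \<bar>LINT x:{a..b}|lborel. f' x * f x + f x * f' x\<bar>"
      using H1_integration_by_parts[OF f f ab] by (simp add: power2_eq_square)
    also have "\<dots> \<le> (LINT x|lborel. \<bar>indicator {a..b} x * (f' x * f x + f x * f' x)\<bar>)"
      unfolding set_lebesgue_integral_def real_scaleR_def by (rule integral_abs_bound)
    also have "\<dots> \<le> (LINT x|lborel. indicator {0..1} x * (2 * (\<bar>f x\<bar> * \<bar>f' x\<bar>)))"
    proof (rule integral_mono)
      show "integrable lborel (\<lambda>x. \<bar>indicat_real {a..b} x * (f' x * f x + f x * f' x)\<bar>)"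
        using i by (intro integrable_abs) (simp add: set_integrable_def)
      have "integrable unit_meas (\<lambda>x. 2 * (\<bar>f x\<bar> * \<bar>f' x\<bar>))" using ci by simp
      then have "integrable lborel (\<lambda>x. indicat_real {0..1} x *\<^sub>R (2 * (\<bar>f x\<bar> * \<bar>f' x\<bar>)))"
        by (subst integrable_restrict_space[symmetric]) auto
      then show "integrable lborel (\<lambda>x. indicat_real {0..1} x * (2 * (\<bar>f x\<bar> * \<bar>f' x\<bar>)))"
        by (simp only: real_scaleR_def)
      show "\<bar>indicat_real {a..b} x * (f' x * f x + f x * f' x)\<bar>
          \<le> indicat_real {0..1} x * (2 * (\<bar>f x\<bar> * \<bar>f' x\<bar>))" for x
        using ab by (auto simp: indicator_def abs_mult mult.commute)
    qed
    also have "\<dots> = 2 * ?c"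
      using integral_restrict_space[of "{0..1}" lborel "\<lambda>x. 2 * (\<bar>f x\<bar> * \<bar>f' x\<bar>)"]
      by simp
    finally show ?thesis .
  qed
  have pt: "(f x)\<^sup>2 \<le> (f y)\<^sup>2 + 2 * ?c" if "y \<in> {0..1}" for y
    using seg[of x y] seg[of y x] x that by (cases "x \<le> y") auto
  have "(LINT y|unit_meas. (f x)\<^sup>2) \<le> (LINT y|unit_meas. (f y)\<^sup>2 + 2 * ?c)"
  proof (rule integral_mono)
    show "integrable unit_meas (\<lambda>y. (f y)\<^sup>2 + 2 * ?c)"
      using L by (intro Bochner_Integration.integrable_add integrable_unit_const) (auto simp: L2_iff)
  qed (use pt in \<open>auto simp: space_restrict_space intro: integrable_unit_const\<close>)
  also have "\<dots> = l2_inner f f + 2 * ?c"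
    using L by (subst Bochner_Integration.integral_add)
      (auto simp: L2_iff integrable_unit_const integral_unit_const l2_inner_eq power2_eq_square)
  finally have "(f x)\<^sup>2 \<le> l2_inner f f + 2 * ?c" by (simp add: integral_unit_const)
  moreover have "2 * ?c \<le> \<Gamma> * l2_inner f f + inverse \<Gamma> * l2_inner f' f'"
  proof -
    have "2 * ?c = (LINT x|unit_meas. 2 * (\<bar>f x\<bar> * \<bar>f' x\<bar>))" by simp
    also have "\<dots> \<le> (LINT x|unit_meas. \<Gamma> * (f x * f x) + inverse \<Gamma> * (f' x * f' x))"
    proof (rule integral_mono)
      show "2 * (\<bar>f x\<bar> * \<bar>f' x\<bar>) \<le> \<Gamma> * (f x * f x) + inverse \<Gamma> * (f' x * f' x)" for x
      proof -
        have "0 \<le> (\<Gamma> * \<bar>f x\<bar> - \<bar>f' x\<bar>)\<^sup>2" by simp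
        then have "\<Gamma> * (2 * (\<bar>f x\<bar> * \<bar>f' x\<bar>)) \<le> \<Gamma> * (\<Gamma> * (f x * f x)) + f' x * f' x"
          by (simp add: power2_eq_square algebra_simps)
        then show ?thesis using \<Gamma> by (simp add: field_simps)
      qed
      show "integrable unit_meas (\<lambda>x. 2 * (\<bar>f x\<bar> * \<bar>f' x\<bar>))" using ci by simp
      show "integrable unit_meas (\<lambda>x. \<Gamma> * (f x * f x) + inverse \<Gamma> * (f' x * f' x))"
        by (intro Bochner_Integration.integrable_add integrable_mult_right L2_mult_integrable L)
    qed
    also have "\<dots> = \<Gamma> * l2_inner f f + inverse \<Gamma> * l2_inner f' f'"
      using L by (simp add: l2_inner_eq L2_mult_integrable)
    finally show ?thesis .
  qed
  ultimately show ?thesis by (simp add: algebra_simps)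
qed

section \<open>The Neumann cosine basis\<close>

definition dphi :: "nat \<Rightarrow> real \<Rightarrow> real" where
  "dphi n x = - (sqrt 2 * (real n * pi)) * sin (real n * pi * x)"

lemma DERIV_phi: "(phi n has_real_derivative dphi n x) (at x)"
proof (cases "n = 0")
  case True
  have "phi n = (\<lambda>_. 1)" using True by (simp add: phi_def fun_eq_iff)
  then show ?thesis using True by (simp add: dphi_def)
next
  case False
  have "phi n = (\<lambda>x. sqrt 2 * cos (real n * pi * x))" using False by (simp add: phi_def fun_eq_iff)
  then show ?thesis by (auto intro!: derivative_eq_intros simp: dphi_def)
qed

lemma DERIV_dphi: "(dphi n has_real_derivative - lam n * phi n x) (at x)"
proof -
  have "dphi n = (\<lambda>x. - (sqrt 2 * (real n * pi)) * sin (real n * pi * x))"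
    by (simp add: dphi_def fun_eq_iff)
  then show ?thesis
    by (auto intro!: derivative_eq_intros simp: phi_def lam_def power2_eq_square)
qed

lemma continuous_on_phi: "continuous_on S (phi n)"
  using DERIV_phi by (intro DERIV_continuous_on) (auto intro: DERIV_subset)

lemma continuous_on_dphi: "continuous_on S (dphi n)"
  using DERIV_dphi by (intro DERIV_continuous_on) (auto intro: DERIV_subset)

lemma phi_L2 [simp]: "phi n \<in> L2"
  by (intro L2_continuous continuous_on_phi)

lemma has_H1_deriv_phi: "has_H1_deriv (phi n) (dphi n)"
  by (intro has_H1_deriv_smooth DERIV_phi continuous_on_dphi)

lemma has_H1_deriv_dphi: "has_H1_deriv (dphi n) (\<lambda>x. - lam n * phi n x)"
  by (intro has_H1_deriv_smooth DERIV_dphi continuous_intros continuous_on_phi)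

lemma dphi_L2 [simp]: "dphi n \<in> L2"
  by (intro L2_continuous continuous_on_dphi)

lemma dphi_ends: "dphi n 0 = 0" "dphi n 1 = 0"
  by (simp_all add: dphi_def)

lemma lam_nonneg: "0 \<le> lam n"
  by (simp add: lam_def)

lemma lam_mono: "m \<le> n \<Longrightarrow> lam m \<le> lam n"
  by (simp add: lam_def mult_right_mono power_mono)

lemma lam_ge: "real n \<le> lam n"
proof -
  have p: "1 \<le> pi\<^sup>2" using pi_gt3 by (simp add: power2_eq_square) (smt (verit) mult_less_cancel_left1)
  have "real n \<le> (real n)\<^sup>2"
    by (cases n) (auto simp: power2_eq_square)
  also have "\<dots> \<le> (real n)\<^sup>2 * pi\<^sup>2"
    using p mult_left_mono[of 1 "pi\<^sup>2" "(real n)\<^sup>2"] by simp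
  finally show ?thesis by (simp add: lam_def)
qed

lemma lam_inj: "lam m = lam n \<Longrightarrow> m = n"
  by (simp add: lam_def)

lemma H1_inner_dphi:
  assumes "has_H1_deriv f f'"
  shows "l2_inner f' (dphi n) = lam n * l2_inner f (phi n)"
proof -
  have "l2_inner f (\<lambda>x. - lam n * phi n x) = - lam n * l2_inner f (phi n)"
    by (metis l2_inner_commute l2_inner_scale_left)
  then show ?thesis
    using H1_inner_by_parts[OF assms has_H1_deriv_dphi, of n] by (simp add: dphi_ends)
qed

text \<open>Both families are orthogonal because \<open>\<langle>\<phi>\<^sub>m', \<phi>\<^sub>n'\<rangle>\<close> is symmetric in \<open>m\<close> and \<open>n\<close> and equals
  \<open>\<lambda>\<^sub>n \<langle>\<phi>\<^sub>m, \<phi>\<^sub>n\<rangle>\<close>; the normalisation comes from \<open>cos\<^sup>2 + sin\<^sup>2 = 1\<close>.\<close>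

lemma phi_orthonormal: "orthonormal phi"
proof -
  have d: "l2_inner (dphi m) (dphi n) = lam n * l2_inner (phi m) (phi n)" for m n
    by (rule H1_inner_dphi[OF has_H1_deriv_phi])
  have o: "l2_inner (phi m) (phi n) = 0" if "m \<noteq> n" for m n
  proof -
    have "lam n * l2_inner (phi m) (phi n) = lam m * l2_inner (phi m) (phi n)"
      using d[of m n] d[of n m] l2_inner_commute by metis
    then show ?thesis using lam_inj that by auto
  qed
  have u: "l2_inner (phi n) (phi n) = 1" for n
  proof (cases "n = 0")
    case True
    then have "phi n = (\<lambda>_. 1)" by (simp add: phi_def fun_eq_iff)
    then show ?thesis by (simp add: l2_inner_eq)
  next
    case False
    then have l: "lam n > 0" by (simp add: lam_def)
    have "lam n * (phi n x * phi n x) + dphi n x * dphi n x = 2 * lam n" for x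
    proof -
      have "(phi n x)\<^sup>2 = 2 * (cos (real n * pi * x))\<^sup>2"
        using False by (simp add: phi_def power_mult_distrib)
      moreover have "(dphi n x)\<^sup>2 = lam n * (2 * (sin (real n * pi * x))\<^sup>2)"
        by (simp add: dphi_def lam_def power_mult_distrib)
      ultimately have "lam n * (phi n x)\<^sup>2 + (dphi n x)\<^sup>2
          = lam n * (2 * ((cos (real n * pi * x))\<^sup>2 + (sin (real n * pi * x))\<^sup>2))"
        by (simp only: distrib_left)
      then show ?thesis by (simp add: power2_eq_square)
    qed
    then have "(LINT x|unit_meas. lam n * (phi n x * phi n x) + dphi n x * dphi n x) = 2 * lam n"
      using integral_unit_const[of "2 * lam n"] by simp
    then have "lam n * l2_inner (phi n) (phi n) + l2_inner (dphi n) (dphi n) = 2 * lam n"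
      by (simp add: l2_inner_eq L2_mult_integrable)
    then show ?thesis using d[of n n] l by simp
  qed
  show ?thesis using o u by (auto simp: orthonormal_def)
qed

text \<open>The index is shifted because \<open>\<phi>\<^sub>0' = 0\<close>.\<close>

lemma sine_orthonormal: "orthonormal (\<lambda>n x. inverse (sqrt (lam (Suc n))) * dphi (Suc n) x)"
proof -
  have l: "lam (Suc n) > 0" for n by (simp add: lam_def)
  have "l2_inner (\<lambda>x. a * dphi (Suc m) x) (\<lambda>x. b * dphi (Suc n) x)
      = a * b * (lam (Suc n) * (if m = n then 1 else 0))" for a b m n
  proof -
    have "l2_inner (\<lambda>x. a * dphi (Suc m) x) (\<lambda>x. b * dphi (Suc n) x)
        = a * (b * l2_inner (dphi (Suc m)) (dphi (Suc n)))"
      by (metis l2_inner_commute l2_inner_scale_left)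
    also have "l2_inner (dphi (Suc m)) (dphi (Suc n)) = lam (Suc n) * (if m = n then 1 else 0)"
      using H1_inner_dphi[OF has_H1_deriv_phi, of "Suc m" "Suc n"] phi_orthonormal
      by (simp add: orthonormal_def)
    finally show ?thesis by (simp add: mult.assoc)
  qed
  moreover have "inverse (sqrt (lam (Suc n))) * (inverse (sqrt (lam (Suc n))) * lam (Suc n)) = 1" for n
  proof -
    have "inverse s * (inverse s * (s * s)) = 1" if "s \<noteq> 0" for s :: real
      using that by (simp add: field_simps)
    from this[of "sqrt (lam (Suc n))"] l[of n] show ?thesis by simp
  qed
  ultimately show ?thesis
    unfolding orthonormal_def by (intro conjI allI L2_scale dphi_L2) simp_all
qed

text \<open>Bessel's inequality for the normalised sines: since \<open>\<phi>\<^sub>n'\<close> vanishes at both ends,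
  \<open>\<langle>f', \<phi>\<^sub>n'\<rangle> = \<lambda>\<^sub>n \<langle>f, \<phi>\<^sub>n\<rangle>\<close> for every \<open>f\<close> in \<open>H\<^sup>1\<close>.  It bounds the Lyapunov
  functional at the initial time, where \<open>w\<close> is an arbitrary element of \<open>H\<^sup>1\<close>.\<close>

lemma H1_Bessel:
  assumes "has_H1_deriv f f'"
  shows "(\<Sum>n\<le>M. lam n * (l2_inner f (phi n))\<^sup>2) \<le> l2_inner f' f'"
proof (cases M)
  case 0
  then show ?thesis by (simp add: lam_def l2_inner_self_nonneg)
next
  case (Suc K)
  have "(\<Sum>n\<le>K. (l2_inner f' (\<lambda>x. inverse (sqrt (lam (Suc n))) * dphi (Suc n) x))\<^sup>2) \<le> l2_inner f' f'"
    using Bessel_inequality[OF sine_orthonormal H1_L2(2)[OF assms], of K] by simp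
  moreover have "(l2_inner f' (\<lambda>x. inverse (sqrt (lam (Suc n))) * dphi (Suc n) x))\<^sup>2
      = lam (Suc n) * (l2_inner f (phi (Suc n)))\<^sup>2" for n
  proof -
    have "lam (Suc n) > 0" by (simp add: lam_def)
    moreover have "l2_inner f' (\<lambda>x. inverse (sqrt (lam (Suc n))) * dphi (Suc n) x)
        = inverse (sqrt (lam (Suc n))) * (lam (Suc n) * l2_inner f (phi (Suc n)))"
      using H1_inner_dphi[OF assms] by (metis l2_inner_commute l2_inner_scale_left)
    moreover have "(inverse (sqrt l))\<^sup>2 * (l * m)\<^sup>2 = l * m\<^sup>2" if "l > 0" for l m :: real
      using that by (simp add: power_mult_distrib power_inverse) (simp add: power2_eq_square)
    ultimately show ?thesis by (simp add: power_mult_distrib)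
  qed
  ultimately show ?thesis
    unfolding Suc sum.atMost_Suc_shift by (simp add: lam_def)
qed

subsection \<open>Completeness\<close>

text \<open>The span of the cosines.  The formula for a product of cosines closes it under multiplication,
  which makes it an algebra that separates points, as Stone--Weierstrass demands.\<close>

inductive_set cos_poly :: "(real \<Rightarrow> real) set" where
  "(\<lambda>x. cos (real n * pi * x)) \<in> cos_poly"
| "f \<in> cos_poly \<Longrightarrow> (\<lambda>x. c * f x) \<in> cos_poly"
| "f \<in> cos_poly \<Longrightarrow> g \<in> cos_poly \<Longrightarrow> (\<lambda>x. f x + g x) \<in> cos_poly"

lemma continuous_on_cos_poly: "f \<in> cos_poly \<Longrightarrow> continuous_on S f"
proof (induction rule: cos_poly.induct)
  case (1 n)
  show ?case by (intro continuous_intros)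
next
  case (2 f c)
  then show ?case by (intro continuous_on_mult continuous_on_const)
next
  case (3 f g)
  then show ?case by (intro continuous_on_add)
qed

lemma cos_poly_mult:
  assumes "f \<in> cos_poly" "g \<in> cos_poly"
  shows "(\<lambda>x. f x * g x) \<in> cos_poly"
  using assms(1)
proof (induction rule: cos_poly.induct)
  case (1 m)
  show ?case using assms(2)
  proof (induction rule: cos_poly.induct)
    case (1 n)
    have p: "cos (real m * pi * x) * cos (real n * pi * x)
        = (1/2) * cos (real (max m n - min m n) * pi * x) + (1/2) * cos (real (m + n) * pi * x)" for x
    proof (cases "m \<le> n")
      case True
      then have "cos (real m * pi * x) * cos (real n * pi * x)
          = (cos (real n * pi * x - real m * pi * x) + cos (real n * pi * x + real m * pi * x)) / 2"
        by (metis cos_times_cos mult.commute)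
      then show ?thesis using True by (simp add: algebra_simps add_divide_distrib)
    next
      case False
      then show ?thesis
        using cos_times_cos[of "real m * pi * x" "real n * pi * x"]
        by (simp add: algebra_simps add_divide_distrib max_def min_def)
    qed
    show ?case unfolding p by (intro cos_poly.intros)
  next
    case (2 f c)
    from cos_poly.intros(2)[OF 2(2), of c] show ?case by (simp add: mult_ac)
  next
    case (3 f g)
    from cos_poly.intros(3)[OF 3(3,4)] show ?case by (simp add: algebra_simps)
  qed
next
  case (2 f c)
  from cos_poly.intros(2)[OF 2(2), of c] show ?case by (simp add: mult_ac)
next
  case (3 f g)
  from cos_poly.intros(3)[OF 3(3,4)] show ?case by (simp add: algebra_simps)
qed

lemma cos_poly_phi_comb:
  assumes "f \<in> cos_poly"
  shows "\<exists>M a. \<forall>x. f x = (\<Sum>n\<le>M. a n * phi n x)"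
  using assms
proof (induction rule: cos_poly.induct)
  case (1 m)
  have "(\<Sum>n\<le>m. (if n = m then inverse (if m = 0 then 1 else sqrt 2) else 0) * phi n x)
      = (\<Sum>n\<le>m. if n = m then inverse (if m = 0 then 1 else sqrt 2) * phi n x else 0)" for x
    by (intro sum.cong) auto
  then have "cos (real m * pi * x)
      = (\<Sum>n\<le>m. (if n = m then inverse (if m = 0 then 1 else sqrt 2) else 0) * phi n x)" for x
    by (simp add: phi_def)
  then show ?case
    by (intro exI[of _ m] exI[of _ "\<lambda>n. if n = m then inverse (if m = 0 then 1 else sqrt 2) else 0"]) blast
next
  case (2 f c)
  then obtain M a where "\<forall>x. f x = (\<Sum>n\<le>M. a n * phi n x)" by blast
  then have "\<forall>x. c * f x = (\<Sum>n\<le>M. (c * a n) * phi n x)"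
    by (simp add: sum_distrib_left mult.assoc)
  then show ?case by (intro exI[of _ M] exI[of _ "\<lambda>n. c * a n"])
next
  case (3 f g)
  then obtain M a K b where f: "\<forall>x. f x = (\<Sum>n\<le>M. a n * phi n x)"
    and g: "\<forall>x. g x = (\<Sum>n\<le>K. b n * phi n x)" by blast
  have pad: "(\<Sum>n\<le>M. a n * phi n x) = (\<Sum>n\<le>L. (if n \<le> M then a n else 0) * phi n x)"
    if "M \<le> L" for M L a x
    using that by (intro sum.mono_neutral_cong_left) auto
  have "\<forall>x. f x + g x = (\<Sum>n\<le>max M K. ((if n \<le> M then a n else 0) + (if n \<le> K then b n else 0)) * phi n x)"
    using f g pad[of M "max M K" a] pad[of K "max M K" b] by (simp add: distrib_right sum.distrib)
  then show ?case by (intro exI[of _ "max M K"] exI)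
qed

lemma cos_poly_dense:
  assumes f: "continuous_on {0..1} f" and e: "0 < e"
  shows "\<exists>M a. \<forall>x\<in>{0..1}. \<bar>f x - (\<Sum>n\<le>M. a n * phi n x)\<bar> < e"
proof -
  have "\<exists>g. g \<in> cos_poly \<and> (\<forall>x\<in>{0..1}. \<bar>f x - g x\<bar> < e)"
  proof (rule Stone_Weierstrass_HOL[where P = "\<lambda>g. g \<in> cos_poly"])
    show "(\<lambda>x. c) \<in> cos_poly" for c
      using cos_poly.intros(2)[OF cos_poly.intros(1)[of 0], of c] by simp
    show "continuous_on {0..1} g" if "g \<in> cos_poly" for g
      using that by (rule continuous_on_cos_poly)
    show "\<exists>g. g \<in> cos_poly \<and> g x \<noteq> g y" if "x \<in> {0..1} \<and> y \<in> {0..1} \<and> x \<noteq> y" for x y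
    proof -
      have "cos (real 1 * pi * x) \<noteq> cos (real 1 * pi * y)"
      proof
        assume "cos (real 1 * pi * x) = cos (real 1 * pi * y)"
        then have "cos (pi * x) = cos (pi * y)" by simp
        then have "pi * x = pi * y"
        proof (rule cos_inj_pi[rotated 4])
          have "pi * z \<le> pi" if "z \<le> 1" for z using mult_left_mono[OF that, of pi] by simp
          then show "pi * x \<le> pi" "pi * y \<le> pi" using that by auto
        qed (use that in \<open>simp_all\<close>)
        then show False using that by simp
      qed
      with cos_poly.intros(1)[of 1] show ?thesis by blast
    qed
    show "(\<lambda>x. g x + h x) \<in> cos_poly" if "g \<in> cos_poly \<and> h \<in> cos_poly" for g h
      using that by (intro cos_poly.intros(3)) auto
    show "(\<lambda>x. g x * h x) \<in> cos_poly" if "g \<in> cos_poly \<and> h \<in> cos_poly" for g h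
      using that by (intro cos_poly_mult) auto
  qed (use f e in simp_all)
  then obtain g where "g \<in> cos_poly" "\<forall>x\<in>{0..1}. \<bar>f x - g x\<bar> < e" by blast
  moreover from this(1) obtain M a where "\<forall>x. g x = (\<Sum>n\<le>M. a n * phi n x)"
    using cos_poly_phi_comb by blast
  ultimately show ?thesis by (intro exI[of _ M] exI[of _ a]) auto
qed

abbreviation mode :: "(real \<Rightarrow> real) \<Rightarrow> nat \<Rightarrow> real" where
  "mode f n \<equiv> l2_inner f (phi n)"

text \<open>A uniformly close cosine polynomial is also close in the mean, and the Fourier sum of the
  same or a higher order is closer still.\<close>

lemma Parseval:
  assumes f: "continuous_on {0..1} f"
  shows "(\<lambda>M. \<Sum>n\<le>M. (mode f n)\<^sup>2) \<longlonglongrightarrow> l2_inner f f"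
proof (rule LIMSEQ_I)
  fix e :: real assume e: "0 < e"
  have L: "f \<in> L2" using f by (rule L2_continuous)
  obtain K a where a: "\<forall>x\<in>{0..1}. \<bar>f x - (\<Sum>n\<le>K. a n * phi n x)\<bar> < sqrt (e / 2)"
    using cos_poly_dense[OF f, of "sqrt (e / 2)"] e by auto
  let ?d = "\<lambda>x. f x - (\<Sum>n\<le>K. a n * phi n x)"
  have dL: "?d \<in> L2" using L orthonormal_comb_L2[OF phi_orthonormal] by auto
  have "l2_inner ?d ?d \<le> l2_inner (\<lambda>_. sqrt (e / 2)) (\<lambda>_. sqrt (e / 2))"
    using a e by (intro l2_inner_mono dL) (auto intro: L2_continuous simp: less_imp_le)
  also have "\<dots> = e / 2"
    using e integral_unit_const[of "e / 2"] by (simp add: l2_inner_eq)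
  finally have d: "l2_inner ?d ?d \<le> e / 2" .
  have K: "l2_inner f f - (\<Sum>n\<le>K. (mode f n)\<^sup>2) \<le> e / 2"
    using d orthonormal_distance[OF phi_orthonormal L, where M = K and a = a]
      sum_nonneg[of "{..K}" "\<lambda>n. (a n - mode f n)\<^sup>2"] by auto
  show "\<exists>no. \<forall>M\<ge>no. norm ((\<Sum>n\<le>M. (mode f n)\<^sup>2) - l2_inner f f) < e"
  proof (intro exI allI impI)
    fix M assume "M \<ge> K"
    then have "(\<Sum>n\<le>K. (mode f n)\<^sup>2) \<le> (\<Sum>n\<le>M. (mode f n)\<^sup>2)"
      by (intro sum_mono2) auto
    with K e Bessel_inequality[OF phi_orthonormal L, of M]
    show "norm ((\<Sum>n\<le>M. (mode f n)\<^sup>2) - l2_inner f f) < e" by simp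
  qed
qed

subsection \<open>Functions with Neumann boundary conditions\<close>

text \<open>The derivatives are arguments, and not chosen by a description operator, because \<open>f''\<close> is determined
  only up to a null set.\<close>

definition neumann :: "(real \<Rightarrow> real) \<Rightarrow> (real \<Rightarrow> real) \<Rightarrow> (real \<Rightarrow> real) \<Rightarrow> bool" where
  "neumann f f' f'' \<longleftrightarrow> has_H1_deriv f f' \<and> has_H1_deriv f' f'' \<and> f' 0 = 0 \<and> f' 1 = 0"

lemma neumann_L2:
  assumes "neumann f f' f''"
  shows "f \<in> L2" "f' \<in> L2" "f'' \<in> L2"
proof -
  have *: "has_H1_deriv f f'" "has_H1_deriv f' f''" using assms unfolding neumann_def by blast+
  show "f \<in> L2" "f' \<in> L2" "f'' \<in> L2"
    by (rule H1_L2(1)[OF *(1)], rule H1_L2(2)[OF *(1)], rule H1_L2(2)[OF *(2)])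
qed

lemma neumann_by_parts:
  assumes "neumann f f' f''" "has_H1_deriv g g'"
  shows "l2_inner f'' g = - l2_inner f' g'"
  using H1_inner_by_parts[of f' f'' g g'] assms unfolding neumann_def by simp

lemma neumann_mode:
  assumes "neumann f f' f''"
  shows "mode f'' n = - lam n * mode f n"
  using neumann_by_parts[OF assms has_H1_deriv_phi, of n] H1_inner_dphi[of f f' n] assms
  unfolding neumann_def by simp

lemma neumann_tail:
  assumes f: "neumann f f' f''"
  shows "neumann (\<lambda>x. f x - (\<Sum>n\<le>N. mode f n * phi n x)) (\<lambda>x. f' x - (\<Sum>n\<le>N. mode f n * dphi n x))
    (\<lambda>x. f'' x + (\<Sum>n\<le>N. (mode f n * lam n) * phi n x))"
proof -
  have "has_H1_deriv (\<lambda>x. \<Sum>n\<le>N. mode f n * phi n x) (\<lambda>x. \<Sum>n\<le>N. mode f n * dphi n x)"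
    by (intro has_H1_deriv_sum has_H1_deriv_phi) simp
  moreover have "has_H1_deriv (\<lambda>x. \<Sum>n\<le>N. mode f n * dphi n x) (\<lambda>x. - (\<Sum>n\<le>N. (mode f n * lam n) * phi n x))"
    using has_H1_deriv_sum[OF has_H1_deriv_dphi, where I = "{..N}" and a = "mode f"] by (simp add: sum_negf mult.assoc)
  moreover have "has_H1_deriv f f'" "has_H1_deriv f' f''" "f' 0 = 0" "f' 1 = 0"
    using f unfolding neumann_def by blast+
  ultimately show ?thesis
    using has_H1_deriv_diff[of f f'] has_H1_deriv_diff[of f' f'' _ "\<lambda>x. - (\<Sum>n\<le>N. (mode f n * lam n) * phi n x)"]
    unfolding neumann_def by (simp add: dphi_ends)
qed

text \<open>Removing Fourier modes preserves the Neumann conditions.  So \<open>\<parallel>h'\<parallel>\<^sup>2 = - \<langle>h'', h\<rangle>\<close> for the tail \<open>h\<close> too,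
  and both factors are orthogonal to the removed modes.\<close>

lemma neumann_tail_norms:
  fixes N :: nat
  assumes f: "neumann f f' f''"
  defines "h \<equiv> \<lambda>x. f x - (\<Sum>n\<le>N. mode f n * phi n x)"
    and "h' \<equiv> \<lambda>x. f' x - (\<Sum>n\<le>N. mode f n * dphi n x)"
  shows "l2_inner h h = l2_inner f f - (\<Sum>n\<le>N. (mode f n)\<^sup>2)"
    and "l2_inner h' h' = l2_inner f' f' - (\<Sum>n\<le>N. lam n * (mode f n)\<^sup>2)"
proof -
  let ?h'' = "\<lambda>x. f'' x + (\<Sum>n\<le>N. (mode f n * lam n) * phi n x)"
  have h: "neumann h h' ?h''" unfolding h_def h'_def by (rule neumann_tail[OF f])
  note L = neumann_L2[OF f] neumann_L2[OF h]
  have S: "(\<lambda>x. \<Sum>n\<le>N. a n * phi n x) \<in> L2" for a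
    by (rule orthonormal_comb_L2[OF phi_orthonormal])
  show "l2_inner h h = l2_inner f f - (\<Sum>n\<le>N. (mode f n)\<^sup>2)"
    using orthonormal_distance[OF phi_orthonormal L(1), where M = N and a = "mode f"]
    by (simp add: h_def)
  have hm: "mode h n = 0" if "n \<le> N" for n
    using that orthonormal_comb_inner[OF phi_orthonormal, where M = N and a = "mode f" and k = n]
    unfolding h_def by (simp add: l2_inner_diff_left L(1) S)
  have "l2_inner h' h' = - l2_inner ?h'' h"
    using neumann_by_parts[OF h, of h h'] h unfolding neumann_def by simp
  also have "l2_inner ?h'' h = l2_inner ?h'' f - (\<Sum>n\<le>N. mode f n * mode ?h'' n)"
    unfolding h_def using l2_inner_diff_right[OF L(1) S L(6)]
      orthonormal_inner_comb[OF phi_orthonormal L(6)] by simp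
  also have "(\<Sum>n\<le>N. mode f n * mode ?h'' n) = 0"
    using neumann_mode[OF h] hm by (intro sum.neutral) auto
  also have "l2_inner ?h'' f = l2_inner f'' f + (\<Sum>n\<le>N. (mode f n * lam n) * mode f n)"
    using l2_inner_add_left[OF L(3) S L(1)] orthonormal_inner_comb[OF phi_orthonormal L(1)]
    by (simp add: l2_inner_commute[of _ f])
  also have "l2_inner f'' f = - l2_inner f' f'"
    using neumann_by_parts[OF f, of f f'] f unfolding neumann_def by simp
  finally show "l2_inner h' h' = l2_inner f' f' - (\<Sum>n\<le>N. lam n * (mode f n)\<^sup>2)"
    by (simp add: power2_eq_square mult_ac)
qed

text \<open>By \<open>\<parallel>f'\<parallel>\<^sup>2 = - \<langle>f'', f\<rangle>\<close> the defect of a partial sum is the inner product of \<open>f''\<close> with the remainder of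
  the Fourier series of \<open>f\<close>, and this remainder tends to zero in the mean.\<close>

lemma neumann_Parseval_deriv:
  assumes f: "neumann f f' f''"
  shows "(\<lambda>M. \<Sum>n\<le>M. lam n * (mode f n)\<^sup>2) \<longlonglongrightarrow> l2_inner f' f'"
proof -
  note L = neumann_L2[OF f]
  have S: "(\<lambda>x. \<Sum>n\<le>N. a n * phi n x) \<in> L2" for N a
    by (rule orthonormal_comb_L2[OF phi_orthonormal])
  define r where "r M = l2_inner f f - (\<Sum>n\<le>M. (mode f n)\<^sup>2)" for M
  have cf: "continuous_on {0..1} f" using f H1_continuous unfolding neumann_def by blast
  have "r \<longlonglongrightarrow> 0"
    using tendsto_diff[OF tendsto_const Parseval[OF cf], of "l2_inner f f"] by (simp add: r_def [abs_def])
  then have lim: "(\<lambda>M. l2_norm f'' * sqrt (r M)) \<longlonglongrightarrow> 0"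
    using tendsto_mult_left[OF tendsto_real_sqrt, of r 0 sequentially "l2_norm f''"] by simp
  have "norm ((\<Sum>n\<le>M. lam n * (mode f n)\<^sup>2) - l2_inner f' f') \<le> l2_norm f'' * sqrt (r M)" for M
  proof -
    let ?h = "\<lambda>x. f x - (\<Sum>n\<le>M. mode f n * phi n x)"
    have "l2_inner f'' ?h = l2_inner f'' f - (\<Sum>n\<le>M. mode f n * mode f'' n)"
      using l2_inner_diff_right[OF L(1) S L(3)] orthonormal_inner_comb[OF phi_orthonormal L(3)] by simp
    also have "\<dots> = - l2_inner f' f' + (\<Sum>n\<le>M. lam n * (mode f n)\<^sup>2)"
      using neumann_by_parts[OF f, of f f'] f unfolding neumann_mode[OF f] neumann_def
      by (simp add: power2_eq_square sum_negf mult_ac)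
    finally have "(\<Sum>n\<le>M. lam n * (mode f n)\<^sup>2) - l2_inner f' f' = l2_inner f'' ?h" by simp
    moreover have "l2_norm ?h = sqrt (r M)"
      using neumann_tail_norms(1)[OF f] by (simp add: l2_norm_def r_def)
    moreover have "\<bar>l2_inner f'' ?h\<bar> \<le> l2_norm f'' * l2_norm ?h"
      by (intro l2_Cauchy_Schwarz L L2_diff S)
    ultimately show ?thesis by simp
  qed
  then have "(\<lambda>M. (\<Sum>n\<le>M. lam n * (mode f n)\<^sup>2) - l2_inner f' f') \<longlonglongrightarrow> 0"
    by (intro Lim_null_comparison[OF _ lim]) auto
  then show ?thesis by (rule LIM_zero_cancel)
qed

text \<open>At the position of the sensor this bounds the part of the measurement that the observed modes
  do not explain; the two weights are those of \<open>\<kappa>\<close>.\<close>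

lemma neumann_tail_value:
  assumes f: "neumann f f' f''" and x: "x \<in> {0..1}" and \<Gamma>: "\<Gamma> > 0"
  shows "(f x - (\<Sum>n\<le>N. mode f n * phi n x))\<^sup>2
    \<le> (1 + \<Gamma>) * (l2_inner f f - (\<Sum>n\<le>N. (mode f n)\<^sup>2))
      + inverse \<Gamma> * (l2_inner f' f' - (\<Sum>n\<le>N. lam n * (mode f n)\<^sup>2))"
proof -
  let ?h = "\<lambda>x. f x - (\<Sum>n\<le>N. mode f n * phi n x)"
  have "has_H1_deriv ?h (\<lambda>x. f' x - (\<Sum>n\<le>N. mode f n * dphi n x))"
    using neumann_tail[OF f, of N] unfolding neumann_def by blast
  from Sobolev_inequality[OF this x \<Gamma>] show ?thesis
    unfolding neumann_tail_norms[OF f] .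
qed

section \<open>The lifting function \<open>\<psi>\<close> and its cosine coefficients\<close>

definition dpsi :: "real \<Rightarrow> real" where
  "dpsi x = sin (pi / 2 * x)"

lemma DERIV_psi: "(psi has_real_derivative dpsi x) (at x)"
proof -
  have *: "psi = (\<lambda>x. - (2 / pi) * cos (pi / 2 * x))" by (simp add: psi_def fun_eq_iff)
  show ?thesis unfolding * by (auto intro!: derivative_eq_intros simp: dpsi_def)
qed

lemma DERIV_dpsi: "(dpsi has_real_derivative - mu * psi x) (at x)"
proof -
  have *: "dpsi = (\<lambda>x. sin (pi / 2 * x))" by (simp add: dpsi_def fun_eq_iff)
  show ?thesis
    unfolding * by (auto intro!: derivative_eq_intros simp: psi_def mu_def power2_eq_square)
qed

lemma continuous_on_psi: "continuous_on S psi"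
  using DERIV_psi by (intro DERIV_continuous_on) (auto intro: DERIV_subset)

lemma psi_L2 [simp]: "psi \<in> L2"
  by (intro L2_continuous continuous_on_psi)

lemma has_H1_deriv_psi: "has_H1_deriv psi dpsi"
  by (intro has_H1_deriv_smooth DERIV_psi DERIV_continuous_on[OF DERIV_subset[OF DERIV_dpsi]]) simp

lemma has_H1_deriv_dpsi: "has_H1_deriv dpsi (\<lambda>x. - mu * psi x)"
  by (intro has_H1_deriv_smooth DERIV_dpsi continuous_intros continuous_on_psi)

text \<open>\<open>\<psi>'' = - \<mu> \<psi>\<close> with \<open>\<psi>'(0) = 0\<close> and \<open>\<psi>'(1) = 1\<close>; the inhomogeneous boundary value is the only
  boundary term that survives.\<close>

lemma psi_inner_parts:
  assumes "has_H1_deriv g g'"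
  shows "mu * l2_inner psi g = l2_inner dpsi g' - g 1"
  using H1_inner_by_parts[OF has_H1_deriv_dpsi assms] l2_inner_scale_left[of "- mu" psi g]
  by (simp add: dpsi_def)

text \<open>Both \<open>\<psi>\<close> and \<open>\<phi>\<^sub>n\<close> solve an eigenvalue equation.  Computing \<open>\<langle>\<psi>', \<phi>\<^sub>n'\<rangle>\<close> in both ways leaves
  \<open>(\<lambda>\<^sub>n - \<mu>) \<langle>\<psi>, \<phi>\<^sub>n\<rangle> = \<phi>\<^sub>n(1)\<close>.\<close>

lemma mode_psi: "mode psi n = - bcoef n"
proof -
  have "mu * mode psi n = lam n * mode psi n - phi n 1"
    using psi_inner_parts[OF has_H1_deriv_phi] H1_inner_dphi[OF has_H1_deriv_psi] by simp
  then have e: "(lam n - mu) * mode psi n = phi n 1" by (simp add: algebra_simps)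
  have l: "lam n - mu = pi\<^sup>2 * (4 * (real n)\<^sup>2 - 1) / 4"
    by (simp add: lam_def mu_def field_simps)
  show ?thesis
  proof (cases "n = 0")
    case True
    then show ?thesis using e unfolding l by (simp add: phi_def bcoef_def field_simps)
  next
    case False
    then have "1 \<le> real n" by simp
    then have "1 \<le> (real n)\<^sup>2" by (simp add: one_le_power)
    then have nz: "4 * (real n)\<^sup>2 - 1 \<noteq> 0" by linarith
    have "phi n 1 = sqrt 2 * (- 1) ^ n" using False by (simp add: phi_def)
    then have "pi\<^sup>2 * (4 * (real n)\<^sup>2 - 1) * mode psi n = 4 * (sqrt 2 * (- 1) ^ n)"
      using e unfolding l by simp
    then have "mode psi n = 4 * (sqrt 2 * (- 1) ^ n) / (pi\<^sup>2 * (4 * (real n)\<^sup>2 - 1))"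
      using nz by (simp add: eq_divide_eq mult.commute)
    then show ?thesis using False by (simp add: bcoef_def)
  qed
qed

text \<open>\<open>\<mu> \<psi>\<^sup>2 + \<psi>'\<^sup>2 = 1\<close>, and the two terms have the same integral because \<open>\<psi>(1) = 0\<close>.  This is the first
  entry of \<open>\<Xi>\<^sub>X\<close>.\<close>

lemma psi_norm: "l2_inner psi psi = 2 / pi\<^sup>2"
proof -
  have "mu * l2_inner psi psi = l2_inner dpsi dpsi"
    using psi_inner_parts[OF has_H1_deriv_psi] by (simp add: psi_def)
  moreover have "mu * l2_inner psi psi + l2_inner dpsi dpsi = 1"
  proof -
    have "mu * (psi x * psi x) + dpsi x * dpsi x = 1" for x
    proof -
      have "mu * (psi x)\<^sup>2 = (cos (pi / 2 * x))\<^sup>2"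
        by (simp add: psi_def mu_def power_mult_distrib power_divide)
      then show ?thesis by (simp add: dpsi_def power2_eq_square[symmetric])
    qed
    then have "(LINT x|unit_meas. mu * (psi x * psi x) + dpsi x * dpsi x) = 1"
      by simp
    then show ?thesis
      using L2_mult_integrable[OF psi_L2 psi_L2] L2_mult_integrable[of dpsi dpsi] H1_L2(2)[OF has_H1_deriv_psi]
      by (simp add: l2_inner_eq)
  qed
  ultimately have "2 * (mu * l2_inner psi psi) = 1" by simp
  then show ?thesis by (simp add: mu_def field_simps)
qed

text \<open>Telescoping \<open>1/n\<^sup>2 \<le> 1/(n-1) - 1/n\<close> is where the factor \<open>1/N\<close> of \<open>\<xi>\<close> comes from.\<close>

lemma sum_inverse_squares_tail:
  assumes "N \<ge> 1"
  shows "(\<Sum>n\<in>{N<..M}. 1 / (real n)\<^sup>2) \<le> 1 / real N"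
proof -
  have "(\<Sum>n\<in>{N<..M}. 1 / (real n)\<^sup>2) \<le> 1 / real N - 1 / real M" if "N \<le> M"
    using that
  proof (induction M rule: dec_induct)
    case base
    show ?case by simp
  next
    case (step M)
    have M: "real M > 0" using step assms by simp
    have "1 / (real (Suc M))\<^sup>2 \<le> 1 / real M - 1 / real (Suc M)"
    proof -
      have "1 / real M - 1 / real (Suc M) = 1 / (real M * real (Suc M))"
        using M by (simp add: field_simps)
      moreover have "real M * real (Suc M) \<le> (real (Suc M))\<^sup>2"
        by (simp add: power2_eq_square)
      ultimately show ?thesis using M by (simp add: frac_le)
    qed
    moreover have "{N<..Suc M} = insert (Suc M) {N<..M}" using step by auto
    ultimately show ?case using step by simp
  qed
  then show ?thesis by (cases "N \<le> M") (auto intro: order_trans)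
qed

text \<open>\<open>\<lambda>\<^sub>n b\<^sub>n\<^sup>2 = (2 / \<pi>\<^sup>2) (1 + 1 / (4 n\<^sup>2 - 1))\<^sup>2 / n\<^sup>2\<close>, and the middle factor decreases in \<open>n\<close>.\<close>

lemma sum_lam_bcoef_tail:
  assumes "N \<ge> 1"
  shows "(\<Sum>n\<in>{N<..M}. lam n * (bcoef n)\<^sup>2) \<le> 2 * xi N / pi\<^sup>2"
proof -
  define c where "c = 1 + 1 / (4 * (real (N + 1))\<^sup>2 - 1)"
  have bd: "lam n * (bcoef n)\<^sup>2 \<le> 2 / pi\<^sup>2 * c\<^sup>2 * (1 / (real n)\<^sup>2)" if n: "n \<in> {N<..M}" for n
  proof -
    define s where "s = (real n)\<^sup>2"
    have "real (N + 1) \<le> real n" using n by simp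
    then have "(real (N + 1))\<^sup>2 \<le> s" unfolding s_def by (intro power_mono) auto
    moreover have s1: "1 \<le> (real (N + 1))\<^sup>2" by (simp add: one_le_power)
    ultimately have s: "1 \<le> s" and "4 * (real (N + 1))\<^sup>2 - 1 \<le> 4 * s - 1"
      "0 < 4 * (real (N + 1))\<^sup>2 - 1" by linarith+
    then have sc: "1 + 1 / (4 * s - 1) \<le> c"
      unfolding c_def by (intro add_left_mono divide_left_mono mult_pos_pos) linarith+
    have "lam n * (bcoef n)\<^sup>2 = s * pi\<^sup>2 * (32 / ((pi\<^sup>2)\<^sup>2 * (4 * s - 1)\<^sup>2))"
      using n by (simp add: lam_def bcoef_def s_def power_divide power_mult_distrib minus_one_power_iff)
    also have "\<dots> = 2 / pi\<^sup>2 * (1 + 1 / (4 * s - 1))\<^sup>2 * (1 / s)"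
    proof -
      have "1 + 1 / (4 * s - 1) = 4 * s / (4 * s - 1)" using s by (simp add: field_simps)
      moreover have "s * p * (32 / (p\<^sup>2 * q\<^sup>2)) = 2 / p * (4 * s / q)\<^sup>2 * (1 / s)"
        if "p > 0" "q > 0" for p q :: real
        using that s by (simp add: field_simps power2_eq_square)
      moreover have "pi\<^sup>2 > 0" "4 * s - 1 > 0" using s by simp_all
      ultimately show ?thesis by presburger
    qed
    also have "\<dots> \<le> 2 / pi\<^sup>2 * c\<^sup>2 * (1 / s)"
      using s sc by (intro mult_right_mono mult_left_mono power_mono) auto
    finally show ?thesis by (simp add: s_def)
  qed
  have "(\<Sum>n\<in>{N<..M}. lam n * (bcoef n)\<^sup>2) \<le> (\<Sum>n\<in>{N<..M}. 2 / pi\<^sup>2 * c\<^sup>2 * (1 / (real n)\<^sup>2))"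
    by (intro sum_mono bd)
  also have "\<dots> = 2 / pi\<^sup>2 * c\<^sup>2 * (\<Sum>n\<in>{N<..M}. 1 / (real n)\<^sup>2)"
    by (simp add: sum_distrib_left)
  also have "\<dots> \<le> 2 / pi\<^sup>2 * c\<^sup>2 * (1 / real N)"
    by (intro mult_left_mono sum_inverse_squares_tail assms) auto
  also have "\<dots> = 2 * xi N / pi\<^sup>2" by (simp add: xi_def c_def)
  finally show ?thesis .
qed

section \<open>A comparison principle\<close>

text \<open>If the derivatives exceed zero only by an amount that is bounded and tends to zero pointwise, then
  the increments tend to something nonpositive, by dominated convergence.  It is the positive part of
  the derivative that is integrated: it has an integrable bound, while the derivative itself may tend to
  \<open>-\<infinity>\<close> at the left end.\<close>

lemma vanishing_excess_comparison:
  fixes h h' R :: "nat \<Rightarrow> real \<Rightarrow> real"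
  assumes T: "0 < T"
    and cont: "\<And>M. continuous_on {0..T} (h M)"
    and der: "\<And>M s. s \<in> {0<..<T} \<Longrightarrow> (h M has_real_derivative h' M s) (at s)"
    and cont': "\<And>M. continuous_on {0<..<T} (h' M)"
    and le: "\<And>M s. s \<in> {0<..<T} \<Longrightarrow> h' M s \<le> R M s"
    and bound: "\<And>M s. s \<in> {0<..<T} \<Longrightarrow> R M s \<le> K"
    and lim: "\<And>s. s \<in> {0<..<T} \<Longrightarrow> (\<lambda>M. R M s) \<longlonglongrightarrow> 0"
    and e: "0 < e"
  shows "\<forall>\<^sub>F M in sequentially. h M T \<le> h M 0 + e"
proof -
  define D where "D M s = indicator {0<..<T} s *\<^sub>R max 0 (h' M s)" for M s
  have cD: "continuous_on {0<..<T} (\<lambda>s. max 0 (h' M s))" for M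
    by (intro continuous_on_max continuous_on_const cont')
  have Dm: "D M \<in> borel_measurable lborel" for M
    using borel_measurable_continuous_on_indicator[OF _ cD, of M] by (simp add: D_def [abs_def])
  have D_le: "D M s \<le> indicator {0<..<T} s * max 0 K" "D M s \<ge> 0" for M s
    using le[of s M] bound[of s M] by (auto simp: D_def indicator_def)
  have w: "integrable lborel (\<lambda>s. indicator {0<..<T} s * max 0 K)"
    by (intro integrable_mult_left integrable_real_indicator) (use T in auto)
  have Dlim: "(\<lambda>M. D M s) \<longlonglongrightarrow> 0" for s
  proof (cases "s \<in> {0<..<T}")
    case True
    have "(\<lambda>M. max 0 (R M s)) \<longlonglongrightarrow> max 0 0" by (intro tendsto_max tendsto_const lim True)
    then have "(\<lambda>M. max 0 (R M s)) \<longlonglongrightarrow> 0" by simp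
    then show ?thesis
    proof (rule Lim_null_comparison[rotated])
      show "\<forall>\<^sub>F M in sequentially. norm (D M s) \<le> max 0 (R M s)"
        using le[OF True] True by (intro always_eventually) (auto simp: D_def max_def intro: order_trans)
    qed
  qed (simp add: D_def)
  have conv: "(\<lambda>M. LINT s|lborel. D M s) \<longlonglongrightarrow> (LINT s::real|lborel. 0)"
  proof (rule integral_dominated_convergence[where w = "\<lambda>s. indicator {0<..<T} s * max 0 K"])
    show "AE s in lborel. norm (D M s) \<le> indicator {0<..<T} s * max 0 K" for M
      using D_le by simp
  qed (use Dlim Dm w in auto)
  have DI: "integrable lborel (D M)" for M
    by (rule Bochner_Integration.integrable_bound[OF w Dm]) (use D_le in \<open>auto simp: abs_of_nonneg\<close>)
  have step: "h M T - h M 0 \<le> (LINT s|lborel. D M s)" for M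
  proof -
    have i: "D M integrable_on {0..T}"
      using integrable_on_lborel[OF DI] by (rule integrable_on_subinterval) simp
    define G where "G t = integral {0..t} (D M)" for t
    have cG: "continuous_on {0..T} G"
      unfolding G_def by (rule indefinite_integral_continuous_1[OF i])
    have dG: "(G has_real_derivative D M s) (at s)" if s: "s \<in> {0<..<T}" for s
    proof -
      have "continuous (at s) (\<lambda>s. max 0 (h' M s))"
        using cD s by (simp add: continuous_on_eq_continuous_at)
      moreover have "\<forall>\<^sub>F x in nhds s. max 0 (h' M x) = D M x"
        using eventually_nhds_in_open[of "{0<..<T}" s] s by (auto simp: D_def elim: eventually_mono)
      ultimately have "isCont (D M) s"
        using isCont_cong[of "\<lambda>s. max 0 (h' M s)" "D M" s] by blast
      then have "continuous (at s within {0..T} - {}) (D M)"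
        by (rule continuous_at_imp_continuous_at_within)
      then have "(G has_vector_derivative D M s) (at s within {0..T} - {})"
        unfolding G_def using s by (intro integral_has_vector_derivative_continuous_at[OF i]) auto
      moreover have "at s within {0..T} = at s"
        using s by (intro at_within_interior) (simp add: interior_atLeastAtMost_real)
      ultimately show ?thesis by (simp add: has_real_derivative_iff_has_vector_derivative)
    qed
    have "h M 0 - G 0 \<ge> h M T - G T"
    proof (rule DERIV_nonpos_imp_decreasing_open[where f = "\<lambda>t. h M t - G t"])
      show "\<exists>y. ((\<lambda>t. h M t - G t) has_real_derivative y) (at s) \<and> y \<le> 0" if "0 < s" "s < T" for s
        using der[of s M] dG[of s] that
        by (intro exI[of _ "h' M s - D M s"]) (auto intro: DERIV_diff simp: D_def)
    qed (use T cont cG in \<open>auto intro: continuous_on_diff\<close>)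
    moreover have "G 0 = 0" by (simp add: G_def)
    moreover have "G T = (LINT s|lborel. D M s)"
    proof -
      have "(D M has_integral (LINT s|lborel. D M s)) UNIV"
        by (rule has_integral_integral_lborel[OF DI])
      moreover have "(\<lambda>s. if s \<in> {0..T} then D M s else 0) = D M"
        by (auto simp: D_def fun_eq_iff)
      ultimately have "(D M has_integral (LINT s|lborel. D M s)) {0..T}"
        using has_integral_restrict_UNIV[of "{0..T}" "D M"] by simp
      then show ?thesis unfolding G_def by (rule integral_unique)
    qed
    ultimately show ?thesis by simp
  qed
  have "\<forall>\<^sub>F M in sequentially. (LINT s|lborel. D M s) < e"
    using order_tendstoD(2)[OF conv] e by simp
  then show ?thesis
  proof eventually_elim
    case (elim M)
    then show ?case using step[of M] by linarith
  qed
qed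

section \<open>Quadratic forms on column vectors\<close>

text \<open>The symbols \<open>$\<close> and \<open>\<bullet>\<close> denote the operations on vectors of variable dimension from here on.\<close>

unbundle no vec_syntax and no inner_syntax

lemma scalar_prod_self_nonneg: "0 \<le> (x :: real vec) \<bullet> x"
  by (simp add: scalar_prod_def sum_nonneg)

lemma scalar_prod_self_pos:
  assumes "(x :: real vec) \<in> carrier_vec n" "x \<noteq> 0\<^sub>v n"
  shows "0 < x \<bullet> x"
proof -
  have "\<exists>i<n. x $ i \<noteq> 0"
  proof (rule ccontr)
    assume "\<not> ?thesis"
    then have "x = 0\<^sub>v n" using assms(1) by (intro eq_vecI) auto
    then show False using assms(2) by simp
  qed
  then obtain i where i: "i < n" "x $ i \<noteq> 0" by blast
  have "0 < x $ i * x $ i" using i by (simp add: zero_less_mult_iff not_less) linarith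
  also have "\<dots> \<le> x \<bullet> x"
    unfolding scalar_prod_def using assms(1) i by (intro member_le_sum) auto
  finally show ?thesis .
qed

definition vnorm :: "real vec \<Rightarrow> real" where
  "vnorm x = sqrt (x \<bullet> x)"

lemma vnorm_nonneg [simp]: "0 \<le> vnorm x"
  by (simp add: vnorm_def scalar_prod_self_nonneg)

lemma vnorm_sq: "(vnorm x)\<^sup>2 = x \<bullet> x"
  by (simp add: vnorm_def scalar_prod_self_nonneg)

lemma abs_component_le_vnorm: "i < dim_vec x \<Longrightarrow> \<bar>x $ i\<bar> \<le> vnorm x"
proof -
  assume i: "i < dim_vec x"
  have "(x $ i)\<^sup>2 \<le> x \<bullet> x"
    unfolding scalar_prod_def power2_eq_square using i
    by (intro member_le_sum[where f = "\<lambda>i. x $ i * x $ i"]) auto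
  then show ?thesis
    unfolding vnorm_def by (metis real_sqrt_abs real_sqrt_le_iff)
qed

lemma bilinear_bounded:
  fixes M :: "real mat"
  assumes M: "M \<in> carrier_mat n m"
  obtains C where "C \<ge> 0"
    "\<And>x y. x \<in> carrier_vec n \<Longrightarrow> y \<in> carrier_vec m \<Longrightarrow> \<bar>x \<bullet> (M *\<^sub>v y)\<bar> \<le> C * vnorm x * vnorm y"
proof
  let ?C = "\<Sum>i<n. \<Sum>j<m. \<bar>M $$ (i, j)\<bar>"
  show "?C \<ge> 0" by (intro sum_nonneg) auto
  fix x y :: "real vec" assume x: "x \<in> carrier_vec n" and y: "y \<in> carrier_vec m"
  have "x \<bullet> (M *\<^sub>v y) = (\<Sum>i<n. \<Sum>j<m. x $ i * (M $$ (i, j) * y $ j))"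
    using x y M by (simp add: scalar_prod_def sum_distrib_left atLeast0LessThan)
  also have "\<bar>\<dots>\<bar> \<le> (\<Sum>i<n. \<Sum>j<m. \<bar>x $ i * (M $$ (i, j) * y $ j)\<bar>)"
    by (rule order_trans[OF sum_abs sum_mono]) (rule sum_abs)
  also have "\<dots> \<le> (\<Sum>i<n. \<Sum>j<m. vnorm x * (\<bar>M $$ (i, j)\<bar> * vnorm y))"
    using x y unfolding abs_mult
    by (intro sum_mono mult_mono abs_component_le_vnorm mult_left_mono) auto
  also have "\<dots> = ?C * vnorm x * vnorm y"
    by (simp add: sum_distrib_left sum_distrib_right mult_ac)
  finally show "\<bar>x \<bullet> (M *\<^sub>v y)\<bar> \<le> ?C * vnorm x * vnorm y" .
qed

lemma mult_mat_vec_bounded: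
  fixes M :: "real mat"
  assumes M: "M \<in> carrier_mat n m"
  obtains C where "C \<ge> 0" "\<And>y. y \<in> carrier_vec m \<Longrightarrow> vnorm (M *\<^sub>v y) \<le> C * vnorm y"
proof -
  from bilinear_bounded[OF M] obtain C where C: "C \<ge> 0"
    "\<And>x y. x \<in> carrier_vec n \<Longrightarrow> y \<in> carrier_vec m \<Longrightarrow> \<bar>x \<bullet> (M *\<^sub>v y)\<bar> \<le> C * vnorm x * vnorm y"
    by blast
  show ?thesis
  proof
    fix y :: "real vec" assume y: "y \<in> carrier_vec m"
    have "vnorm (M *\<^sub>v y) * vnorm (M *\<^sub>v y) \<le> vnorm (M *\<^sub>v y) * (C * vnorm y)"
      using C(2)[of "M *\<^sub>v y" y] M y vnorm_sq[of "M *\<^sub>v y"]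
      by (simp add: power2_eq_square mult_ac)
    then show "vnorm (M *\<^sub>v y) \<le> C * vnorm y"
      using C(1) vnorm_nonneg[of "M *\<^sub>v y"] vnorm_nonneg[of y]
      by (cases "vnorm (M *\<^sub>v y) = 0") auto
  qed (rule C(1))
qed

lemma symmetric_scalar_prod:
  fixes P :: "real mat"
  assumes "P \<in> carrier_mat n n" "P\<^sup>T = P" "x \<in> carrier_vec n" "y \<in> carrier_vec n"
  shows "x \<bullet> (P *\<^sub>v y) = y \<bullet> (P *\<^sub>v x)"
proof -
  have "x \<bullet> (P *\<^sub>v y) = (P *\<^sub>v x) \<bullet> y"
    using transpose_vec_mult_scalar[OF assms(1,4,3)] assms(2) by simp
  also have "\<dots> = y \<bullet> (P *\<^sub>v x)"
    using assms by (intro comm_scalar_prod[of _ n]) auto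
  finally show ?thesis .
qed

lemma symmetric_matI:
  fixes P :: "real mat"
  assumes P: "P \<in> carrier_mat n n"
    and sym: "\<And>x y. x \<in> carrier_vec n \<Longrightarrow> y \<in> carrier_vec n \<Longrightarrow> x \<bullet> (P *\<^sub>v y) = y \<bullet> (P *\<^sub>v x)"
  shows "P\<^sup>T = P"
proof (rule eq_matI)
  fix i j assume "i < dim_row P" "j < dim_col P"
  then have ij: "i < n" "j < n" using P by auto
  have e: "unit_vec n i \<bullet> (P *\<^sub>v unit_vec n j) = P $$ (i, j)" if "i < n" "j < n" for i j
    using that P by simp
  show "P\<^sup>T $$ (i, j) = P $$ (i, j)"
    using sym[of "unit_vec n i" "unit_vec n j"] e[of i j] e[of j i] ij P by simp
qed (use P in auto)

lemma quadratic_form_add_smult: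
  fixes P :: "real mat"
  assumes P: "P \<in> carrier_mat n n" "P\<^sup>T = P" and xy: "x \<in> carrier_vec n" "y \<in> carrier_vec n"
  shows "(x + s \<cdot>\<^sub>v y) \<bullet> (P *\<^sub>v (x + s \<cdot>\<^sub>v y))
    = x \<bullet> (P *\<^sub>v x) + 2 * s * (x \<bullet> (P *\<^sub>v y)) + s\<^sup>2 * (y \<bullet> (P *\<^sub>v y))"
proof -
  have "(x + s \<cdot>\<^sub>v y) \<bullet> (P *\<^sub>v (x + s \<cdot>\<^sub>v y))
      = (x + s \<cdot>\<^sub>v y) \<bullet> (P *\<^sub>v x + s \<cdot>\<^sub>v (P *\<^sub>v y))"
    using P xy by (simp add: mult_add_distrib_mat_vec[of _ n n] mult_mat_vec[of _ n n])
  also have "\<dots> = x \<bullet> (P *\<^sub>v x) + s * (x \<bullet> (P *\<^sub>v y)) + s * (y \<bullet> (P *\<^sub>v x)) + s * (s * (y \<bullet> (P *\<^sub>v y)))"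
    using P xy by (simp add: add_scalar_prod_distrib[of _ n] scalar_prod_add_distrib[of _ n] distrib_left)
  finally show ?thesis
    using symmetric_scalar_prod[OF P xy] by (simp add: power2_eq_square)
qed

text \<open>A positive definite \<open>P\<close> is injective, so it has an inverse \<open>Q\<close> and \<open>\<parallel>x\<parallel> \<le> C \<parallel>P x\<parallel>\<close>.  The form
  of \<open>P\<close> is nonnegative at \<open>x - s P x\<close>; for a fixed small \<open>s\<close> this bounds \<open>\<parallel>P x\<parallel>\<^sup>2\<close> by the form at \<open>x\<close>.\<close>

lemma pos_def_coercive:
  assumes P: "pos_def n P"
  obtains c where "c > 0" "\<And>x. x \<in> carrier_vec n \<Longrightarrow> c * (x \<bullet> x) \<le> x \<bullet> (P *\<^sub>v x)"
proof -
  have Pc: "P \<in> carrier_mat n n" "P\<^sup>T = P"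
    and pos: "\<And>v. v \<in> carrier_vec n \<Longrightarrow> v \<noteq> 0\<^sub>v n \<Longrightarrow> v \<bullet> (P *\<^sub>v v) > 0"
    using P by (auto simp: pos_def_def)
  have nonneg: "v \<bullet> (P *\<^sub>v v) \<ge> 0" if "v \<in> carrier_vec n" for v
    using pos[OF that] Pc(1) by (cases "v = 0\<^sub>v n") (auto intro: less_imp_le)
  have "det P \<noteq> 0"
  proof
    assume "det P = 0"
    then obtain v where "v \<in> carrier_vec n" "v \<noteq> 0\<^sub>v n" "P *\<^sub>v v = 0\<^sub>v n"
      using det_0_iff_vec_prod_zero_field[OF Pc(1)] by blast
    then show False using pos[of v] by simp
  qed
  then have "P \<in> Units (ring_mat TYPE(real) n ())"
    by (rule det_non_zero_imp_unit[OF Pc(1)])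
  then obtain Q where Q: "Q \<in> carrier_mat n n" "Q * P = 1\<^sub>m n"
    unfolding Units_def by (auto simp: ring_mat_def)
  from mult_mat_vec_bounded[OF Q(1)] obtain C where C: "C \<ge> 0"
    "\<And>y. y \<in> carrier_vec n \<Longrightarrow> vnorm (Q *\<^sub>v y) \<le> C * vnorm y" by blast
  from bilinear_bounded[OF Pc(1)] obtain D where D: "D \<ge> 0"
    "\<And>x y. x \<in> carrier_vec n \<Longrightarrow> y \<in> carrier_vec n \<Longrightarrow> \<bar>x \<bullet> (P *\<^sub>v y)\<bar> \<le> D * vnorm x * vnorm y"
    by blast
  define s where "s = 1 / (D + 1)"
  have s: "s > 0" "s * D \<le> 1" using D(1) by (auto simp: s_def field_simps)
  define c where "c = s / (C\<^sup>2 + 1)"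
  have c: "c > 0" using s by (auto simp: c_def intro!: divide_pos_pos add_nonneg_pos)
  show ?thesis
  proof (rule that[OF c])
    fix x :: "real vec" assume x: "x \<in> carrier_vec n"
    define y where "y = P *\<^sub>v x"
    have y: "y \<in> carrier_vec n" using Pc x by (simp add: y_def)
    have "x = Q *\<^sub>v y"
      using Q x Pc assoc_mult_mat_vec[OF Q(1) Pc(1) x] by (simp add: y_def)
    then have "vnorm x \<le> C * vnorm y" using C(2)[OF y] by simp
    then have "(vnorm x)\<^sup>2 \<le> (C * vnorm y)\<^sup>2" by (intro power_mono) auto
    then have xy: "x \<bullet> x \<le> C\<^sup>2 * (y \<bullet> y)" by (simp add: power_mult_distrib vnorm_sq)
    have "0 \<le> (x + (- s) \<cdot>\<^sub>v y) \<bullet> (P *\<^sub>v (x + (- s) \<cdot>\<^sub>v y))"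
      using x y by (intro nonneg) auto
    also have "\<dots> = x \<bullet> (P *\<^sub>v x) - 2 * s * (x \<bullet> (P *\<^sub>v y)) + s\<^sup>2 * (y \<bullet> (P *\<^sub>v y))"
      using quadratic_form_add_smult[OF Pc x y, of "- s"] by simp
    also have "x \<bullet> (P *\<^sub>v y) = y \<bullet> y"
      using symmetric_scalar_prod[OF Pc x y] by (simp add: y_def)
    also have "y \<bullet> (P *\<^sub>v y) \<le> D * (y \<bullet> y)"
      using D(2)[OF y y] vnorm_sq[of y] by (simp add: power2_eq_square mult.assoc)
    finally have "2 * s * (y \<bullet> y) \<le> x \<bullet> (P *\<^sub>v x) + s\<^sup>2 * (D * (y \<bullet> y))"
      using s by simp
    also have "s\<^sup>2 * (D * (y \<bullet> y)) \<le> s * (y \<bullet> y)"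
    proof -
      have "(s * D) * (s * (y \<bullet> y)) \<le> 1 * (s * (y \<bullet> y))"
        using s scalar_prod_self_nonneg[of y] by (intro mult_right_mono) auto
      then show ?thesis by (simp add: power2_eq_square mult_ac)
    qed
    finally have sy: "s * (y \<bullet> y) \<le> x \<bullet> (P *\<^sub>v x)" by simp
    have "c * (x \<bullet> x) \<le> c * (C\<^sup>2 * (y \<bullet> y))" using xy c by simp
    also have "\<dots> \<le> c * ((C\<^sup>2 + 1) * (y \<bullet> y))"
      using c scalar_prod_self_nonneg[of y] by (intro mult_left_mono) (auto simp: distrib_right)
    also have "\<dots> = s * (y \<bullet> y)"
    proof -
      have "C\<^sup>2 + 1 \<noteq> 0" by (metis add.commute power_one sum_power2_gt_zero_iff zero_neq_one less_irrefl)
      then show ?thesis by (simp add: c_def)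
    qed
    finally show "c * (x \<bullet> x) \<le> x \<bullet> (P *\<^sub>v x)" using sy by simp
  qed
qed

section \<open>Block matrices\<close>

text \<open>Block matrices are handled through their action on appended vectors, which keeps index arithmetic
  out of all later arguments.\<close>

lemma hcat_single [simp]: "hcat [A] = A"
  by (auto simp: Let_def intro!: eq_matI)

lemma vcat_single [simp]: "vcat [A] = A"
  by (auto simp: Let_def intro!: eq_matI)

lemma append_vec_zero_dim [simp]: "dim_vec y = 0 \<Longrightarrow> x @\<^sub>v y = x"
  by (intro eq_vecI) auto

lemma append_vec_assoc: "(x @\<^sub>v y) @\<^sub>v z = x @\<^sub>v (y @\<^sub>v z)"
  by (intro eq_vecI) (auto simp: less_diff_conv2 not_less)

lemma hcat_carrier:
  assumes "A \<in> carrier_mat r c" "hcat As \<in> carrier_mat r d"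
  shows "hcat (A # As) \<in> carrier_mat r (c + d)"
  using assms by (intro carrier_matI) (auto simp del: dim_hcat)

lemma vcat_carrier:
  assumes "A \<in> carrier_mat r c" "vcat As \<in> carrier_mat s c"
  shows "vcat (A # As) \<in> carrier_mat (r + s) c"
  using assms by (intro carrier_matI) (auto simp del: dim_vcat)

lemma hcat_mult_vec:
  assumes "A \<in> carrier_mat r c" "hcat As \<in> carrier_mat r d" "x \<in> carrier_vec c" "y \<in> carrier_vec d"
  shows "hcat (A # As) *\<^sub>v (x @\<^sub>v y) = A *\<^sub>v x + hcat As *\<^sub>v y"
proof -
  have "four_block_mat A (hcat As) (0\<^sub>m 0 c) (0\<^sub>m 0 d) *\<^sub>v (x @\<^sub>v y)
      = (A *\<^sub>v x + hcat As *\<^sub>v y) @\<^sub>v (0\<^sub>m 0 c *\<^sub>v x + 0\<^sub>m 0 d *\<^sub>v y)"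
    by (rule four_block_mat_mult_vec[OF assms(1,2) zero_carrier_mat zero_carrier_mat assms(3,4)])
  moreover have "dim_col A = c" "dim_col (hcat As) = d" using assms by auto
  ultimately show "hcat (A # As) *\<^sub>v (x @\<^sub>v y) = A *\<^sub>v x + hcat As *\<^sub>v y"
    by (simp add: Let_def del: dim_hcat)
qed

lemma vcat_mult_vec:
  assumes "A \<in> carrier_mat r c" "vcat As \<in> carrier_mat s c" "x \<in> carrier_vec c"
  shows "vcat (A # As) *\<^sub>v x = A *\<^sub>v x @\<^sub>v vcat As *\<^sub>v x"
proof -
  let ?z = "vec 0 (\<lambda>_. 0) :: real vec"
  have "four_block_mat A (0\<^sub>m r 0) (vcat As) (0\<^sub>m s 0) *\<^sub>v (x @\<^sub>v ?z)
      = (A *\<^sub>v x + 0\<^sub>m r 0 *\<^sub>v ?z) @\<^sub>v (vcat As *\<^sub>v x + 0\<^sub>m s 0 *\<^sub>v ?z)"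
    by (rule four_block_mat_mult_vec[OF assms(1) zero_carrier_mat assms(2) zero_carrier_mat assms(3)]) simp
  moreover have "0\<^sub>m k 0 *\<^sub>v ?z = 0\<^sub>v k" for k
    by (intro eq_vecI) (auto simp: scalar_prod_def)
  moreover have "dim_row A = r" "dim_row (vcat As) = s" using assms by auto
  moreover have "A *\<^sub>v x + 0\<^sub>v r = A *\<^sub>v x" "vcat As *\<^sub>v x + 0\<^sub>v s = vcat As *\<^sub>v x"
    using assms by auto
  ultimately show "vcat (A # As) *\<^sub>v x = A *\<^sub>v x @\<^sub>v vcat As *\<^sub>v x"
    by (simp add: Let_def del: dim_vcat)
qed

lemma hcat4_carrier:
  assumes "A \<in> carrier_mat r a" "B \<in> carrier_mat r b" "C \<in> carrier_mat r c" "D \<in> carrier_mat r d"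
  shows "hcat [A, B, C, D] \<in> carrier_mat r (a + (b + (c + d)))"
  by (intro hcat_carrier assms(1-3)) (simp only: hcat_single assms(4))

lemma hcat4_mult_vec:
  assumes "A \<in> carrier_mat r a" "B \<in> carrier_mat r b" "C \<in> carrier_mat r c" "D \<in> carrier_mat r d"
    and "x \<in> carrier_vec a" "y \<in> carrier_vec b" "z \<in> carrier_vec c" "w \<in> carrier_vec d"
  shows "hcat [A, B, C, D] *\<^sub>v (x @\<^sub>v y @\<^sub>v z @\<^sub>v w) = A *\<^sub>v x + (B *\<^sub>v y + (C *\<^sub>v z + D *\<^sub>v w))"
proof -
  have D: "hcat [D] \<in> carrier_mat r d" using assms(4) by (simp only: hcat_single)
  note C = hcat_carrier[OF assms(3) D]
  note B = hcat_carrier[OF assms(2) C]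
  show ?thesis
    using assms by (simp only: hcat_mult_vec[OF assms(1) B] hcat_mult_vec[OF assms(2) C]
        hcat_mult_vec[OF assms(3) D] hcat_single append_carrier_vec)
qed

lemma vcat4_mult_vec:
  assumes "A \<in> carrier_mat a n" "B \<in> carrier_mat b n" "C \<in> carrier_mat c n" "D \<in> carrier_mat d n"
    and "x \<in> carrier_vec n"
  shows "vcat [A, B, C, D] *\<^sub>v x = A *\<^sub>v x @\<^sub>v B *\<^sub>v x @\<^sub>v C *\<^sub>v x @\<^sub>v D *\<^sub>v x"
proof -
  have D: "vcat [D] \<in> carrier_mat d n" using assms(4) by (simp only: vcat_single)
  note C = vcat_carrier[OF assms(3) D]
  note B = vcat_carrier[OF assms(2) C]
  show ?thesis
    by (simp only: vcat_mult_vec[OF assms(1) B assms(5)] vcat_mult_vec[OF assms(2) C assms(5)]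
        vcat_mult_vec[OF assms(3) D assms(5)] vcat_single)
qed

lemma diag_block_carrier:
  assumes "A \<in> carrier_mat r r" "diag_block_mat As \<in> carrier_mat s s"
  shows "diag_block_mat (A # As) \<in> carrier_mat (r + s) (r + s)"
  using assms by (auto simp: Let_def)

lemma diag_block_mult_vec:
  assumes "A \<in> carrier_mat r r" "diag_block_mat As \<in> carrier_mat s s"
    and "x \<in> carrier_vec r" "y \<in> carrier_vec s"
  shows "diag_block_mat (A # As) *\<^sub>v (x @\<^sub>v y) = A *\<^sub>v x @\<^sub>v diag_block_mat As *\<^sub>v y"
proof -
  have e: "diag_block_mat (A # As) = four_block_mat A (0\<^sub>m r s) (0\<^sub>m s r) (diag_block_mat As)"
    using assms by (auto simp: Let_def)
  show ?thesis unfolding e by (rule mult_mat_vec_split[OF assms])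
qed

lemma mult_singleton_vec:
  fixes M :: "real mat"
  assumes "M \<in> carrier_mat n 1"
  shows "M *\<^sub>v vec 1 (\<lambda>_. s) = vec n (\<lambda>i. M $$ (i, 0) * s)"
  using assms by (intro eq_vecI) (auto simp: scalar_prod_def)

lemma mat_diag_mult_vec:
  "mat_diag n f *\<^sub>v vec n g = vec n (\<lambda>i. f i * (g i :: real))"
proof (rule eq_vecI)
  fix i assume "i < dim_vec (vec n (\<lambda>i. f i * g i))"
  then have i: "i < n" by simp
  have "(mat_diag n f *\<^sub>v vec n g) $ i = (\<Sum>j = 0..<n. (if i = j then f j else 0) * g j)"
    using i by (auto simp: mat_diag_def scalar_prod_def)
  also have "\<dots> = (\<Sum>j = 0..<n. if j = i then f i * g i else 0)"
    by (intro sum.cong) auto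
  also have "\<dots> = vec n (\<lambda>i. f i * g i) $ i" using i by simp
  finally show "(mat_diag n f *\<^sub>v vec n g) $ i = vec n (\<lambda>i. f i * g i) $ i" .
qed simp

lemma zero_mat_mult_vec: "0\<^sub>m r c *\<^sub>v vec c f = vec r (\<lambda>_. 0 :: real)"
  by (intro eq_vecI) (auto simp: scalar_prod_def)

lemma vec_plus_vec: "vec n f + vec n g = vec n (\<lambda>i. f i + g i :: real)"
  by (intro eq_vecI) auto

lemma vec_minus_vec: "vec n f - vec n g = vec n (\<lambda>i. f i - g i :: real)"
  by (intro eq_vecI) auto

lemma uminus_vec: "- vec n f = vec n (\<lambda>i. - f i :: real)"
  by (intro eq_vecI) auto

lemma scalar_prod_vec: "vec n f \<bullet> vec n g = (\<Sum>i<n. f i * g i)"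
  by (simp add: scalar_prod_def atLeast0LessThan)

section \<open>The finite-dimensional state\<close>

text \<open>The blocks of \<open>F\<^sub>X\<close> list \<open>u\<close> and the observer modes up to \<open>N\<^sub>0\<close>, then the errors up to \<open>N\<^sub>0\<close>, then the remaining
  modes and the remaining errors.  Encoding a state by two sequences \<open>a\<close> and \<open>e\<close>, indexed by the number
  of the mode, hides this order.\<close>

definition state_vec :: "nat \<Rightarrow> nat \<Rightarrow> real \<Rightarrow> (nat \<Rightarrow> real) \<Rightarrow> (nat \<Rightarrow> real) \<Rightarrow> real vec" where
  "state_vec N0 N u a e = vec (N0 + 2) (case_nat u a) @\<^sub>v vec (N0 + 1) e
    @\<^sub>v vec (N - N0) (\<lambda>i. a (N0 + 1 + i)) @\<^sub>v vec (N - N0) (\<lambda>i. e (N0 + 1 + i))"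

definition feedback :: "nat \<Rightarrow> real mat \<Rightarrow> real \<Rightarrow> (nat \<Rightarrow> real) \<Rightarrow> real" where
  "feedback N0 K0 u a = (\<Sum>i<N0 + 2. K0 $$ (0, i) * case_nat u a i)"

lemma block_dim: "(N0 :: nat) \<le> N \<Longrightarrow> (N0 + 2) + ((N0 + 1) + ((N - N0) + (N - N0))) = 2 * N + 3"
  by simp

lemma state_vec_carrier:
  assumes "N0 \<le> N"
  shows "state_vec N0 N u a e \<in> carrier_vec (2 * N + 3)"
  unfolding state_vec_def block_dim[OF assms, symmetric] by (intro append_carrier_vec) auto

lemma sum_split_modes:
  fixes f :: "nat \<Rightarrow> real"
  assumes "N0 \<le> N"
  shows "(\<Sum>i<N0 + 1. f i) + (\<Sum>i<N - N0. f (N0 + 1 + i)) = (\<Sum>n\<le>N. f n)"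
proof -
  have "(\<Sum>i<N0 + 1. f i) + (\<Sum>i<k. f (N0 + 1 + i)) = (\<Sum>n<N0 + 1 + k. f n)" for k
    by (induction k) (simp_all add: add.assoc)
  from this[of "N - N0"] assms show ?thesis by (simp add: lessThan_Suc_atMost)
qed

lemma state_vec_inner:
  assumes "N0 \<le> N"
  shows "state_vec N0 N u a e \<bullet> state_vec N0 N u' a' e'
    = u * u' + (\<Sum>n\<le>N. a n * a' n) + (\<Sum>n\<le>N. e n * e' n)"
proof -
  have "(\<Sum>i<N0 + 2. case_nat u a i * case_nat u' a' i) = u * u' + (\<Sum>i<N0 + 1. a i * a' i)"
    using sum.lessThan_Suc_shift[of "\<lambda>i. case_nat u a i * case_nat u' a' i" "N0 + 1"] by simp
  then have "state_vec N0 N u a e \<bullet> state_vec N0 N u' a' e' = u * u' + (\<Sum>i<N0 + 1. a i * a' i)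
      + ((\<Sum>i<N0 + 1. e i * e' i) + ((\<Sum>i<N - N0. a (N0 + 1 + i) * a' (N0 + 1 + i))
        + (\<Sum>i<N - N0. e (N0 + 1 + i) * e' (N0 + 1 + i))))"
    unfolding state_vec_def
    by (simp only: scalar_prod_append[of _ "N0 + 2" _ "(N0 + 1) + ((N - N0) + (N - N0))"]
      scalar_prod_append[of _ "N0 + 1" _ "(N - N0) + (N - N0)"] scalar_prod_append[of _ "N - N0" _ "N - N0"]
      append_carrier_vec vec_carrier scalar_prod_vec)
  then show ?thesis
    using sum_split_modes[OF assms, of "\<lambda>n. a n * a' n"] sum_split_modes[OF assms, of "\<lambda>n. e n * e' n"]
    by linarith
qed

lemma state_vec_add:
  "state_vec N0 N u a e + state_vec N0 N u' a' e'
    = state_vec N0 N (u + u') (\<lambda>n. a n + a' n) (\<lambda>n. e n + e' n)"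
  unfolding state_vec_def
  by (intro eq_vecI) (auto split: nat.split)

lemma state_vec_cong:
  assumes "N0 \<le> N" "u = u'" "\<And>n. n \<le> N \<Longrightarrow> a n = a' n" "\<And>n. n \<le> N \<Longrightarrow> e n = e' n"
  shows "state_vec N0 N u a e = state_vec N0 N u' a' e'"
proof -
  have "vec (N0 + 2) (case_nat u a) = vec (N0 + 2) (case_nat u' a')"
    by (intro eq_vecI) (use assms in \<open>auto split: nat.split\<close>)
  moreover have "vec (N0 + 1) e = vec (N0 + 1) e'"
    "vec (N - N0) (\<lambda>i. a (N0 + 1 + i)) = vec (N - N0) (\<lambda>i. a' (N0 + 1 + i))"
    "vec (N - N0) (\<lambda>i. e (N0 + 1 + i)) = vec (N - N0) (\<lambda>i. e' (N0 + 1 + i))"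
    using assms by (auto intro!: eq_vecI)
  ultimately show ?thesis by (simp add: state_vec_def)
qed

text \<open>By this lemma, statements on quadratic forms can be checked mode by mode.\<close>

lemma state_vec_surj:
  assumes "N0 \<le> N" "x \<in> carrier_vec (2 * N + 3)"
  obtains u a e where "x = state_vec N0 N u a e"
proof
  define a where "a n = (if n \<le> N0 then x $ (n + 1) else x $ (n + N0 + 2))" for n
  define e where "e n = (if n \<le> N0 then x $ (n + N0 + 2) else x $ (n + N + 2))" for n
  show "x = state_vec N0 N (x $ 0) a e"
  proof (rule eq_vecI)
    show d: "dim_vec x = dim_vec (state_vec N0 N (x $ 0) a e)"
      using assms state_vec_carrier[OF assms(1), of "x $ 0" a e] by auto
    fix i assume "i < dim_vec (state_vec N0 N (x $ 0) a e)"
    then have "i < 2 * N + 3" using state_vec_carrier[OF assms(1), of "x $ 0" a e] by auto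
    then show "x $ i = state_vec N0 N (x $ 0) a e $ i"
      using assms(1) by (auto simp: state_vec_def a_def e_def not_less less_diff_conv2
          intro!: arg_cong[where f = "vec_index x"] split: nat.split)
  qed
qed

subsection \<open>Action of the blocks\<close>

lemma A0t_eq: "A0t N0 = mat_diag (N0 + 2) (case_nat (- mu) (\<lambda>n. - lam n))"
  by (rule eq_matI) (auto simp: A0t_def A0_def mat_diag_def Let_def split: nat.split)

lemma B0t_eq: "B0t N0 = col_mat (N0 + 2) (case_nat 1 bcoef)"
  by (rule eq_matI) (auto simp: B0t_def B0_def col_mat_def Let_def split: nat.split)

lemma L0t_eq: "L0 \<in> carrier_mat (N0 + 1) 1 \<Longrightarrow> L0t L0 = col_mat (N0 + 2) (case_nat 0 (\<lambda>n. L0 $$ (n, 0)))"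
  by (rule eq_matI) (auto simp: L0t_def col_mat_def Let_def split: nat.split)

lemma col_mat_carrier: "col_mat n f \<in> carrier_mat n 1"
  by (simp add: col_mat_def)

lemma col_mat_mult_vec: "col_mat n f *\<^sub>v vec 1 (\<lambda>_. s) = vec n (\<lambda>i. f i * s)"
  by (intro eq_vecI) (auto simp: col_mat_def scalar_prod_def)

lemma row_mat_carrier: "row_mat n f \<in> carrier_mat 1 n"
  by (simp add: row_mat_def)

lemma row_mat_mult_vec: "row_mat n f *\<^sub>v vec n g = vec 1 (\<lambda>_. \<Sum>i<n. f i * g i)"
  by (intro eq_vecI) (auto simp: row_mat_def scalar_prod_def atLeast0LessThan)

lemma one_row_mult_vec:
  assumes "K0 \<in> carrier_mat 1 n"
  shows "K0 *\<^sub>v vec n g = vec 1 (\<lambda>_. \<Sum>i<n. K0 $$ (0, i) * g i :: real)"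
  using assms by (intro eq_vecI) (auto simp: scalar_prod_def atLeast0LessThan)

context
  fixes N0 N :: nat and xs :: real and L0 K0 :: "real mat"
  assumes L0: "L0 \<in> carrier_mat (N0 + 1) 1" and K0: "K0 \<in> carrier_mat 1 (N0 + 2)" and N: "N0 \<le> N"
begin

lemma L0_mult_vec: "L0 *\<^sub>v vec 1 (\<lambda>_. s) = vec (N0 + 1) (\<lambda>n. obs_gain N0 L0 n * s)"
  using mult_singleton_vec[OF L0, of s] by (auto simp: obs_gain_def intro!: eq_vecI)

lemma L0t_mult_vec:
  "L0t L0 *\<^sub>v vec 1 (\<lambda>_. s) = vec (N0 + 2) (case_nat 0 (\<lambda>n. obs_gain N0 L0 n * s))"
  unfolding L0t_eq[OF L0] col_mat_mult_vec
  by (intro eq_vecI) (auto simp: obs_gain_def split: nat.split)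

lemma K0_mult_vec: "K0 *\<^sub>v vec (N0 + 2) (case_nat u a) = vec 1 (\<lambda>_. feedback N0 K0 u a)"
  using one_row_mult_vec[OF K0] by (simp add: feedback_def)

lemma L0t_carrier: "L0t L0 \<in> carrier_mat (N0 + 2) 1"
  unfolding L0t_eq[OF L0] by (rule col_mat_carrier)

lemma controller_block_mult_vec:
  "(A0t N0 - B0t N0 * K0) *\<^sub>v vec (N0 + 2) (case_nat u a) = vec (N0 + 2)
    (case_nat (- mu * u - feedback N0 K0 u a) (\<lambda>n. - lam n * a n - bcoef n * feedback N0 K0 u a))"
proof -
  let ?k = "feedback N0 K0 u a" and ?xa = "vec (N0 + 2) (case_nat u a)"
  have B0c: "B0t N0 \<in> carrier_mat (N0 + 2) 1" unfolding B0t_eq by (rule col_mat_carrier)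
  have A0tc: "A0t N0 \<in> carrier_mat (N0 + 2) (N0 + 2)" unfolding A0t_eq by simp
  have "(A0t N0 - B0t N0 * K0) *\<^sub>v ?xa = A0t N0 *\<^sub>v ?xa - B0t N0 *\<^sub>v (K0 *\<^sub>v ?xa)"
    using minus_mult_distrib_mat_vec[OF A0tc mult_carrier_mat[OF B0c K0], of ?xa]
      assoc_mult_mat_vec[OF B0c K0, of ?xa] by simp
  also have "\<dots> = vec (N0 + 2) (\<lambda>i. case_nat (- mu) (\<lambda>n. - lam n) i * case_nat u a i - case_nat 1 bcoef i * ?k)"
    unfolding A0t_eq B0t_eq mat_diag_mult_vec K0_mult_vec col_mat_mult_vec vec_minus_vec ..
  also have "\<dots> = vec (N0 + 2) (case_nat (- mu * u - ?k) (\<lambda>n. - lam n * a n - bcoef n * ?k))"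
    by (intro eq_vecI) (auto split: nat.split)
  finally show ?thesis .
qed

lemma observer_block_mult_vec:
  "(A0 N0 - L0 * C0 N0 xs) *\<^sub>v vec (N0 + 1) e
    = vec (N0 + 1) (\<lambda>n. - lam n * e n - obs_gain N0 L0 n * (\<Sum>i<N0 + 1. ccoef xs i * e i))"
proof -
  have C0c: "C0 N0 xs \<in> carrier_mat 1 (N0 + 1)" unfolding C0_def by (rule row_mat_carrier)
  have A0c: "A0 N0 \<in> carrier_mat (N0 + 1) (N0 + 1)" unfolding A0_def by simp
  show ?thesis
    unfolding minus_mult_distrib_mat_vec[OF A0c mult_carrier_mat[OF L0 C0c] vec_carrier]
      assoc_mult_mat_vec[OF L0 C0c vec_carrier]
    by (simp only: C0_def row_mat_mult_vec L0_mult_vec vec_minus_vec A0_def mat_diag_mult_vec)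
qed

text \<open>One formula serves all modes because the gain \<open>l\<^sub>n\<close> is zero beyond \<open>N\<^sub>0\<close>.\<close>

lemma FX_mult_state:
  defines "S \<equiv> \<lambda>e. \<Sum>n\<le>N. ccoef xs n * e n"
  shows "FX N0 N xs L0 K0 *\<^sub>v state_vec N0 N u a e = state_vec N0 N (- mu * u - feedback N0 K0 u a)
    (\<lambda>n. - lam n * a n - bcoef n * feedback N0 K0 u a + obs_gain N0 L0 n * S e)
    (\<lambda>n. - lam n * e n - obs_gain N0 L0 n * S e)"
proof -
  let ?k = "feedback N0 K0 u a"
  let ?xa = "vec (N0 + 2) (case_nat u a)" and ?xe = "vec (N0 + 1) e"
  let ?xb = "vec (N - N0) (\<lambda>i. a (N0 + 1 + i))" and ?xf = "vec (N - N0) (\<lambda>i. e (N0 + 1 + i))"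
  define S0 S1 where "S0 = (\<Sum>i<N0 + 1. ccoef xs i * e i)"
    and "S1 = (\<Sum>i<N - N0. ccoef xs (N0 + 1 + i) * e (N0 + 1 + i))"
  have S: "S e = S0 + S1"
    using sum_split_modes[OF N, of "\<lambda>n. ccoef xs n * e n"] by (simp add: S_def S0_def S1_def)
  have C0: "C0 N0 xs *\<^sub>v ?xe = vec 1 (\<lambda>_. S0)" and C0c: "C0 N0 xs \<in> carrier_mat 1 (N0 + 1)"
    unfolding C0_def S0_def by (rule row_mat_mult_vec, rule row_mat_carrier)
  have C1: "C1 N0 N xs *\<^sub>v ?xf = vec 1 (\<lambda>_. S1)" and C1c: "C1 N0 N xs \<in> carrier_mat 1 (N - N0)"
    unfolding C1_def S1_def by (rule row_mat_mult_vec, rule row_mat_carrier)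
  have B0c: "B0t N0 \<in> carrier_mat (N0 + 2) 1" and B1c: "B1 N0 N \<in> carrier_mat (N - N0) 1"
    unfolding B0t_eq B1_def by (rule col_mat_carrier)+
  have A1c: "A1 N0 N \<in> carrier_mat (N - N0) (N - N0)"
    unfolding A1_def by simp
  note r1 = controller_block_mult_vec[of u a]
  have LC: "(M * C0 N0 xs) *\<^sub>v ?xe = M *\<^sub>v vec 1 (\<lambda>_. S0)" "(M * C1 N0 N xs) *\<^sub>v ?xf = M *\<^sub>v vec 1 (\<lambda>_. S1)"
    if "M \<in> carrier_mat m 1" for M and m :: nat
    by (simp_all only: assoc_mult_mat_vec[OF that C0c vec_carrier] assoc_mult_mat_vec[OF that C1c vec_carrier] C0 C1)
  note r2 = observer_block_mult_vec[of e, folded S0_def]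
  have r2': "(- (L0 * C1 N0 N xs)) *\<^sub>v ?xf = vec (N0 + 1) (\<lambda>n. - (obs_gain N0 L0 n * S1))"
  proof -
    have "(- (L0 * C1 N0 N xs)) *\<^sub>v ?xf = - ((L0 * C1 N0 N xs) *\<^sub>v ?xf)"
      using C1c by (intro uminus_mult_mat_vec) simp
    then show ?thesis by (simp only: LC(2)[OF L0] L0_mult_vec uminus_vec)
  qed
  have r3: "(- (B1 N0 N * K0)) *\<^sub>v ?xa = vec (N - N0) (\<lambda>i. - (bcoef (N0 + 1 + i) * ?k))"
  proof -
    have "(- (B1 N0 N * K0)) *\<^sub>v ?xa = - (B1 N0 N *\<^sub>v (K0 *\<^sub>v ?xa))"
      unfolding assoc_mult_mat_vec[OF B1c K0 vec_carrier, symmetric]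
      using K0 by (intro uminus_mult_mat_vec) simp
    then show ?thesis by (simp only: K0_mult_vec B1_def col_mat_mult_vec uminus_vec)
  qed
  note carr = minus_carrier_mat[OF mult_carrier_mat[OF B0c K0], of "A0t N0"]
    mult_carrier_mat[OF L0t_carrier C0c] mult_carrier_mat[OF L0t_carrier C1c]
    minus_carrier_mat[OF mult_carrier_mat[OF L0 C0c], of "A0 N0"]
    uminus_carrier_iff_mat[THEN iffD2, OF mult_carrier_mat[OF L0 C1c]]
    uminus_carrier_iff_mat[THEN iffD2, OF mult_carrier_mat[OF B1c K0]] A1c
    zero_carrier_mat
  let ?x = "?xa @\<^sub>v ?xe @\<^sub>v ?xb @\<^sub>v ?xf"
  have x: "?x \<in> carrier_vec ((N0 + 2) + ((N0 + 1) + ((N - N0) + (N - N0))))"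
    by (intro append_carrier_vec) auto
  have "FX N0 N xs L0 K0 *\<^sub>v ?x =
    ((A0t N0 - B0t N0 * K0) *\<^sub>v ?xa + ((L0t L0 * C0 N0 xs) *\<^sub>v ?xe + (0\<^sub>m (N0 + 2) (N - N0) *\<^sub>v ?xb + (L0t L0 * C1 N0 N xs) *\<^sub>v ?xf)))
    @\<^sub>v (0\<^sub>m (N0 + 1) (N0 + 2) *\<^sub>v ?xa + ((A0 N0 - L0 * C0 N0 xs) *\<^sub>v ?xe + (0\<^sub>m (N0 + 1) (N - N0) *\<^sub>v ?xb + (- (L0 * C1 N0 N xs)) *\<^sub>v ?xf)))
    @\<^sub>v ((- (B1 N0 N * K0)) *\<^sub>v ?xa + (0\<^sub>m (N - N0) (N0 + 1) *\<^sub>v ?xe + (A1 N0 N *\<^sub>v ?xb + 0\<^sub>m (N - N0) (N - N0) *\<^sub>v ?xf)))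
    @\<^sub>v (0\<^sub>m (N - N0) (N0 + 2) *\<^sub>v ?xa + (0\<^sub>m (N - N0) (N0 + 1) *\<^sub>v ?xe + (0\<^sub>m (N - N0) (N - N0) *\<^sub>v ?xb + A1 N0 N *\<^sub>v ?xf)))"
    unfolding FX_def block_mat_def list.map
    by (subst vcat4_mult_vec[OF _ _ _ _ x], (rule hcat4_carrier; rule carr)+)
      ((subst hcat4_mult_vec, (rule carr | rule vec_carrier)+)+, rule refl)
  also have "\<dots> = state_vec N0 N (- mu * u - ?k) (\<lambda>n. - lam n * a n - bcoef n * ?k + obs_gain N0 L0 n * S e)
    (\<lambda>n. - lam n * e n - obs_gain N0 L0 n * S e)"
  proof -
    have b1: "(A0t N0 - B0t N0 * K0) *\<^sub>v ?xa + ((L0t L0 * C0 N0 xs) *\<^sub>v ?xe + (0\<^sub>m (N0 + 2) (N - N0) *\<^sub>v ?xb + (L0t L0 * C1 N0 N xs) *\<^sub>v ?xf))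
        = vec (N0 + 2) (case_nat (- mu * u - ?k) (\<lambda>n. - lam n * a n - bcoef n * ?k + obs_gain N0 L0 n * S e))"
      unfolding r1 LC[OF L0t_carrier] L0t_mult_vec zero_mat_mult_vec vec_plus_vec S
      by (intro eq_vecI) (auto simp: algebra_simps split: nat.split)
    have b2: "0\<^sub>m (N0 + 1) (N0 + 2) *\<^sub>v ?xa + ((A0 N0 - L0 * C0 N0 xs) *\<^sub>v ?xe + (0\<^sub>m (N0 + 1) (N - N0) *\<^sub>v ?xb + (- (L0 * C1 N0 N xs)) *\<^sub>v ?xf))
        = vec (N0 + 1) (\<lambda>n. - lam n * e n - obs_gain N0 L0 n * S e)"
      unfolding r2 r2' zero_mat_mult_vec vec_plus_vec S
      by (intro eq_vecI) (auto simp: algebra_simps)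
    have z: "obs_gain N0 L0 (N0 + 1 + i) = 0" for i by (simp add: obs_gain_def)
    have b3: "(- (B1 N0 N * K0)) *\<^sub>v ?xa + (0\<^sub>m (N - N0) (N0 + 1) *\<^sub>v ?xe + (A1 N0 N *\<^sub>v ?xb + 0\<^sub>m (N - N0) (N - N0) *\<^sub>v ?xf))
        = vec (N - N0) (\<lambda>i. - lam (N0 + 1 + i) * a (N0 + 1 + i) - bcoef (N0 + 1 + i) * ?k + obs_gain N0 L0 (N0 + 1 + i) * S e)"
      unfolding r3 zero_mat_mult_vec A1_def mat_diag_mult_vec vec_plus_vec z
      by (intro eq_vecI) auto
    have b4: "0\<^sub>m (N - N0) (N0 + 2) *\<^sub>v ?xa + (0\<^sub>m (N - N0) (N0 + 1) *\<^sub>v ?xe + (0\<^sub>m (N - N0) (N - N0) *\<^sub>v ?xb + A1 N0 N *\<^sub>v ?xf))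
        = vec (N - N0) (\<lambda>i. - lam (N0 + 1 + i) * e (N0 + 1 + i) - obs_gain N0 L0 (N0 + 1 + i) * S e)"
      unfolding zero_mat_mult_vec A1_def mat_diag_mult_vec vec_plus_vec z
      by (intro eq_vecI) auto
    show ?thesis unfolding b1 b2 b3 b4 state_vec_def ..
  qed
  finally show ?thesis unfolding state_vec_def .
qed

lemma Lzeta_mult_vec:
  "Lzeta N0 N L0 *\<^sub>v vec 1 (\<lambda>_. s)
    = state_vec N0 N 0 (\<lambda>n. obs_gain N0 L0 n * s) (\<lambda>n. - (obs_gain N0 L0 n * s))"
proof -
  have "Lzeta N0 N L0 *\<^sub>v vec 1 (\<lambda>_. s) = L0t L0 *\<^sub>v vec 1 (\<lambda>_. s) @\<^sub>v (- L0) *\<^sub>v vec 1 (\<lambda>_. s)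
      @\<^sub>v 0\<^sub>m (N - N0) 1 *\<^sub>v vec 1 (\<lambda>_. s) @\<^sub>v 0\<^sub>m (N - N0) 1 *\<^sub>v vec 1 (\<lambda>_. s)"
    unfolding Lzeta_def using L0
    by (intro vcat4_mult_vec[OF L0t_carrier]) auto
  also have "(- L0) *\<^sub>v vec 1 (\<lambda>_. s) = vec (N0 + 1) (\<lambda>n. - (obs_gain N0 L0 n * s))"
  proof -
    have "(- L0) *\<^sub>v vec 1 (\<lambda>_. s) = - (L0 *\<^sub>v vec 1 (\<lambda>_. s))"
      using L0 by (intro uminus_mult_mat_vec) simp
    then show ?thesis by (simp only: L0_mult_vec uminus_vec)
  qed
  finally show ?thesis
    unfolding L0t_mult_vec zero_mat_mult_vec state_vec_def by (simp add: obs_gain_def)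
qed

lemma KX_mult_state: "KX N0 N K0 *\<^sub>v state_vec N0 N u a e = vec 1 (\<lambda>_. feedback N0 K0 u a)"
proof -
  have "KX N0 N K0 *\<^sub>v state_vec N0 N u a e = K0 *\<^sub>v vec (N0 + 2) (case_nat u a)
      + (0\<^sub>m 1 (N0 + 1) *\<^sub>v vec (N0 + 1) e + (0\<^sub>m 1 (N - N0) *\<^sub>v vec (N - N0) (\<lambda>i. a (N0 + 1 + i))
        + 0\<^sub>m 1 (N - N0) *\<^sub>v vec (N - N0) (\<lambda>i. e (N0 + 1 + i))))"
    unfolding KX_def state_vec_def using K0 by (intro hcat4_mult_vec[OF K0]) auto
  then show ?thesis
    unfolding zero_mat_mult_vec K0_mult_vec vec_plus_vec by simp
qed

end

lemma XiX_mult_state: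
  "XiX N0 N *\<^sub>v state_vec N0 N u a e = state_vec N0 N (2 / pi\<^sup>2 * u) a (\<lambda>_. 0)"
proof -
  let ?xe = "vec (N0 + 1) e"
  let ?xb = "vec (N - N0) (\<lambda>i. a (N0 + 1 + i))" and ?xf = "vec (N - N0) (\<lambda>i. e (N0 + 1 + i))"
  have split: "vec (N0 + 2) (case_nat v b) = vec 1 (\<lambda>_. v) @\<^sub>v vec (N0 + 1) b" for v b
    by (intro eq_vecI) (auto split: nat.split)
  have d1: "diag_block_mat [0\<^sub>m (N - N0) (N - N0)] \<in> carrier_mat (N - N0) (N - N0)"
    by (simp only: diag_block_mat_singleton one_carrier_mat zero_carrier_mat)
  note d2 = diag_block_carrier[OF one_carrier_mat d1]
  note d3 = diag_block_carrier[OF zero_carrier_mat d2]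
  note d4 = diag_block_carrier[OF one_carrier_mat d3]
  have "XiX N0 N *\<^sub>v (vec 1 (\<lambda>_. u) @\<^sub>v vec (N0 + 1) a @\<^sub>v ?xe @\<^sub>v ?xb @\<^sub>v ?xf)
      = mat_diag 1 (\<lambda>_. 2 / pi\<^sup>2) *\<^sub>v vec 1 (\<lambda>_. u) @\<^sub>v 1\<^sub>m (N0 + 1) *\<^sub>v vec (N0 + 1) a
        @\<^sub>v 0\<^sub>m (N0 + 1) (N0 + 1) *\<^sub>v ?xe @\<^sub>v 1\<^sub>m (N - N0) *\<^sub>v ?xb @\<^sub>v 0\<^sub>m (N - N0) (N - N0) *\<^sub>v ?xf"
    unfolding XiX_def
    by (simp only: diag_block_mult_vec[OF mat_diag_dim d4] diag_block_mult_vec[OF one_carrier_mat d3]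
      diag_block_mult_vec[OF zero_carrier_mat d2] diag_block_mult_vec[OF one_carrier_mat d1]
      diag_block_mat_singleton vec_carrier append_carrier_vec)
  then show ?thesis
    unfolding state_vec_def split mat_diag_mult_vec zero_mat_mult_vec append_vec_assoc by simp
qed

lemma XiE_mult_state:
  "XiE N0 N *\<^sub>v state_vec N0 N u a e = state_vec N0 N 0 (\<lambda>_. 0) e"
proof -
  let ?xa = "vec (N0 + 2) (case_nat u a)" and ?xe = "vec (N0 + 1) e"
  let ?xb = "vec (N - N0) (\<lambda>i. a (N0 + 1 + i))" and ?xf = "vec (N - N0) (\<lambda>i. e (N0 + 1 + i))"
  have d1: "diag_block_mat [1\<^sub>m (N - N0)] \<in> carrier_mat (N - N0) (N - N0)"
    by (simp only: diag_block_mat_singleton one_carrier_mat zero_carrier_mat)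
  note d2 = diag_block_carrier[OF zero_carrier_mat d1]
  note d3 = diag_block_carrier[OF one_carrier_mat d2]
  have z: "vec (N0 + 2) (\<lambda>_. 0) = vec (N0 + 2) (case_nat 0 (\<lambda>_. 0 :: real))"
    by (intro eq_vecI) (auto split: nat.split)
  have "XiE N0 N *\<^sub>v (?xa @\<^sub>v ?xe @\<^sub>v ?xb @\<^sub>v ?xf) = 0\<^sub>m (N0 + 2) (N0 + 2) *\<^sub>v ?xa
      @\<^sub>v 1\<^sub>m (N0 + 1) *\<^sub>v ?xe @\<^sub>v 0\<^sub>m (N - N0) (N - N0) *\<^sub>v ?xb @\<^sub>v 1\<^sub>m (N - N0) *\<^sub>v ?xf"
    unfolding XiE_def
    by (simp only: diag_block_mult_vec[OF zero_carrier_mat d3] diag_block_mult_vec[OF one_carrier_mat d2]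
      diag_block_mult_vec[OF zero_carrier_mat d1]
      diag_block_mat_singleton vec_carrier append_carrier_vec)
  then show ?thesis
    unfolding state_vec_def zero_mat_mult_vec z by simp
qed

section \<open>The quadratic form of \<open>\<Psi>\<^sub>0\<close>\<close>

lemma smult_mat_mult_vec:
  fixes A :: "real mat"
  assumes "A \<in> carrier_mat n m" "x \<in> carrier_vec m"
  shows "(c \<cdot>\<^sub>m A) *\<^sub>v x = c \<cdot>\<^sub>v (A *\<^sub>v x)"
  using assms by (intro eq_vecI) (auto simp: scalar_prod_def sum_distrib_left mult.assoc)

lemma scalar_prod_transpose:
  fixes A :: "real mat"
  assumes "A \<in> carrier_mat n m" "x \<in> carrier_vec m" "y \<in> carrier_vec n"
  shows "x \<bullet> (A\<^sup>T *\<^sub>v y) = y \<bullet> (A *\<^sub>v x)"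
proof -
  have "x \<bullet> (A\<^sup>T *\<^sub>v y) = (A\<^sup>T *\<^sub>v y) \<bullet> x"
    using assms by (intro comm_scalar_prod[of _ m]) auto
  then show ?thesis using transpose_vec_mult_scalar[OF assms] by simp
qed

context
  fixes N0 N :: nat and xs \<delta> \<sigma> \<Gamma> \<alpha>1 \<alpha>2 \<alpha>3 :: real and L0 K0 PX :: "real mat"
  assumes L0: "L0 \<in> carrier_mat (N0 + 1) 1" and K0: "K0 \<in> carrier_mat 1 (N0 + 2)" and N: "N0 \<le> N"
    and PX: "PX \<in> carrier_mat (2 * N + 3) (2 * N + 3)" "PX\<^sup>T = PX"
begin

abbreviation (input) "dimX \<equiv> 2 * N + 3"
abbreviation (input) "F_mat \<equiv> FX N0 N xs L0 K0"
abbreviation (input) "K_mat \<equiv> KX N0 N K0"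
abbreviation (input) "psi_mat \<equiv> psi0 \<delta> \<sigma> xs N0 N L0 K0 PX \<alpha>1 \<alpha>2 \<alpha>3"
abbreviation (input) "Psi_mat \<equiv> Psi0 \<delta> \<sigma> \<Gamma> xs N0 N L0 K0 PX \<alpha>1 \<alpha>2 \<alpha>3"

lemmas carr = block_carriers[OF L0 K0 N]

lemma psi0_carrier: "psi_mat \<in> carrier_mat dimX dimX"
  unfolding psi0_def using carr PX by auto

lemma psi0_bilinear:
  assumes x: "x \<in> carrier_vec dimX" and y: "y \<in> carrier_vec dimX"
  shows "x \<bullet> (psi_mat *\<^sub>v y) = x \<bullet> (PX *\<^sub>v (F_mat *\<^sub>v y)) + y \<bullet> (PX *\<^sub>v (F_mat *\<^sub>v x)) + 2 * \<delta> * (x \<bullet> (PX *\<^sub>v y))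
    + 2 * \<alpha>3 * xi N / pi\<^sup>2 * ((K_mat *\<^sub>v x) \<bullet> (K_mat *\<^sub>v y))
    + 2 * \<alpha>1 * \<sigma>\<^sup>2 * (x \<bullet> (XiX N0 N *\<^sub>v y)) + \<alpha>2 * \<sigma>\<^sup>2 * (x \<bullet> (XiE N0 N *\<^sub>v y))"
proof -
  have Fc: "F_mat \<in> carrier_mat dimX dimX" and Kc: "K_mat \<in> carrier_mat 1 dimX"
    and Xc: "XiX N0 N \<in> carrier_mat dimX dimX" and Ec: "XiE N0 N \<in> carrier_mat dimX dimX"
    by (rule carr)+
  have c1: "PX * F_mat \<in> carrier_mat dimX dimX" and c2: "F_mat\<^sup>T * PX \<in> carrier_mat dimX dimX"
    and c3: "K_mat\<^sup>T * K_mat \<in> carrier_mat dimX dimX"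
    using Fc Kc PX by auto
  have add: "x \<bullet> ((A + B) *\<^sub>v y) = x \<bullet> (A *\<^sub>v y) + x \<bullet> (B *\<^sub>v y)"
    if "A \<in> carrier_mat dimX dimX" "B \<in> carrier_mat dimX dimX" for A B
    unfolding add_mult_distrib_mat_vec[OF that y] using that x y
    by (intro scalar_prod_add_distrib[of _ dimX]) auto
  have sm: "x \<bullet> ((c \<cdot>\<^sub>m A) *\<^sub>v y) = c * (x \<bullet> (A *\<^sub>v y))" if "A \<in> carrier_mat dimX dimX" for c A
    unfolding smult_mat_mult_vec[OF that y] using that x y
    by (intro scalar_prod_smult_distrib[of _ dimX]) auto
  have "x \<bullet> ((PX * F_mat) *\<^sub>v y) = x \<bullet> (PX *\<^sub>v (F_mat *\<^sub>v y))"
    by (simp only: assoc_mult_mat_vec[OF PX(1) Fc y])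
  moreover have "x \<bullet> ((F_mat\<^sup>T * PX) *\<^sub>v y) = y \<bullet> (PX *\<^sub>v (F_mat *\<^sub>v x))"
  proof -
    have "x \<bullet> ((F_mat\<^sup>T * PX) *\<^sub>v y) = x \<bullet> (F_mat\<^sup>T *\<^sub>v (PX *\<^sub>v y))"
      using assoc_mult_mat_vec[of "F_mat\<^sup>T" dimX dimX PX dimX y] Fc PX(1) y by simp
    also have "\<dots> = (PX *\<^sub>v y) \<bullet> (F_mat *\<^sub>v x)"
      using PX y by (intro scalar_prod_transpose[OF Fc x]) auto
    also have "\<dots> = (F_mat *\<^sub>v x) \<bullet> (PX *\<^sub>v y)"
      using PX Fc x y by (intro comm_scalar_prod[of _ dimX]) auto
    also have "\<dots> = y \<bullet> (PX *\<^sub>v (F_mat *\<^sub>v x))"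
      using Fc x by (intro symmetric_scalar_prod[OF PX _ y]) auto
    finally show ?thesis .
  qed
  moreover have "x \<bullet> ((K_mat\<^sup>T * K_mat) *\<^sub>v y) = (K_mat *\<^sub>v x) \<bullet> (K_mat *\<^sub>v y)"
  proof -
    have "x \<bullet> ((K_mat\<^sup>T * K_mat) *\<^sub>v y) = x \<bullet> (K_mat\<^sup>T *\<^sub>v (K_mat *\<^sub>v y))"
      using assoc_mult_mat_vec[of "K_mat\<^sup>T" dimX 1 K_mat dimX y] Kc y by simp
    also have "\<dots> = (K_mat *\<^sub>v y) \<bullet> (K_mat *\<^sub>v x)"
      using Kc y by (intro scalar_prod_transpose[OF Kc x]) auto
    also have "\<dots> = (K_mat *\<^sub>v x) \<bullet> (K_mat *\<^sub>v y)"
      using Kc x y by (intro comm_scalar_prod[of _ 1]) auto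
    finally show ?thesis .
  qed
  ultimately show ?thesis
    unfolding psi0_def
    by (simp only: add sm add_carrier_mat smult_carrier_mat c1 c2 c3 Xc Ec PX(1))
qed

text \<open>The bilinear form is computed, rather than the quadratic one, because \<open>neg_def\<close> includes the symmetry
  of \<open>\<Psi>\<^sub>0\<close>, which can be read off from it.\<close>

lemma Psi0_bilinear:
  fixes r r' :: real
  assumes x: "x \<in> carrier_vec dimX" and y: "y \<in> carrier_vec dimX" and z: "z \<in> carrier_vec dimX"
    and x': "x' \<in> carrier_vec dimX" and y': "y' \<in> carrier_vec dimX" and z': "z' \<in> carrier_vec dimX"
  shows "(x @\<^sub>v vec 1 (\<lambda>_. r) @\<^sub>v y @\<^sub>v z) \<bullet> (Psi_mat *\<^sub>v (x' @\<^sub>v vec 1 (\<lambda>_. r') @\<^sub>v y' @\<^sub>v z'))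
    = x \<bullet> (psi_mat *\<^sub>v x')
      + (x \<bullet> (PX *\<^sub>v (Lzeta N0 N L0 *\<^sub>v vec 1 (\<lambda>_. r'))) + x' \<bullet> (PX *\<^sub>v (Lzeta N0 N L0 *\<^sub>v vec 1 (\<lambda>_. r))))
      + (x \<bullet> (PX *\<^sub>v y') + x' \<bullet> (PX *\<^sub>v y)) + (x \<bullet> (PX *\<^sub>v z') + x' \<bullet> (PX *\<^sub>v z))
      + 2 * rho \<delta> \<sigma> \<Gamma> \<alpha>1 \<alpha>2 \<alpha>3 N * (r * r') - \<alpha>1 * (y \<bullet> y') - \<alpha>2 * (z \<bullet> z')"
proof -
  let ?s = "vec 1 (\<lambda>_. r)" and ?s' = "vec 1 (\<lambda>_. r')" and ?m = dimX
  let ?PL = "PX * Lzeta N0 N L0" and ?R = "mat_diag 1 (\<lambda>_. 2 * rho \<delta> \<sigma> \<Gamma> \<alpha>1 \<alpha>2 \<alpha>3 N)"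
  let ?I1 = "(- \<alpha>1) \<cdot>\<^sub>m 1\<^sub>m ?m" and ?I2 = "(- \<alpha>2) \<cdot>\<^sub>m 1\<^sub>m ?m"
  have Lc: "Lzeta N0 N L0 \<in> carrier_mat ?m 1" by (rule carr)
  have PLc: "?PL \<in> carrier_mat ?m 1" using PX Lc by auto
  have PLt: "?PL\<^sup>T \<in> carrier_mat 1 ?m" using PLc by (rule transpose_carrier_mat[THEN iffD2])
  have I: "?I1 \<in> carrier_mat ?m ?m" "?I2 \<in> carrier_mat ?m ?m" by auto
  have sc: "vec 1 (\<lambda>_. t) \<in> carrier_vec 1" for t :: real by simp
  note c = psi0_carrier PLc PLt PX(1) mat_diag_dim[of 1] I zero_carrier_mat
  have X: "x' @\<^sub>v ?s' @\<^sub>v y' @\<^sub>v z' \<in> carrier_vec (?m + (1 + (?m + ?m)))"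
    using x' y' z' by (intro append_carrier_vec) auto
  have "Psi_mat *\<^sub>v (x' @\<^sub>v ?s' @\<^sub>v y' @\<^sub>v z') =
    (psi_mat *\<^sub>v x' + (?PL *\<^sub>v ?s' + (PX *\<^sub>v y' + PX *\<^sub>v z')))
    @\<^sub>v (?PL\<^sup>T *\<^sub>v x' + (?R *\<^sub>v ?s' + (0\<^sub>m 1 ?m *\<^sub>v y' + 0\<^sub>m 1 ?m *\<^sub>v z')))
    @\<^sub>v (PX *\<^sub>v x' + (0\<^sub>m ?m 1 *\<^sub>v ?s' + (?I1 *\<^sub>v y' + 0\<^sub>m ?m ?m *\<^sub>v z')))
    @\<^sub>v (PX *\<^sub>v x' + (0\<^sub>m ?m 1 *\<^sub>v ?s' + (0\<^sub>m ?m ?m *\<^sub>v y' + ?I2 *\<^sub>v z')))"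
    unfolding Psi0_def Let_def block_mat_def list.map PX(2)
    by (subst vcat4_mult_vec[OF _ _ _ _ X], (rule hcat4_carrier; rule c)+)
      ((subst hcat4_mult_vec, (rule c | rule x' y' z' sc)+)+, rule refl)
  also have "\<dots> = (psi_mat *\<^sub>v x' + (?PL *\<^sub>v ?s' + (PX *\<^sub>v y' + PX *\<^sub>v z')))
    @\<^sub>v (?PL\<^sup>T *\<^sub>v x' + ?R *\<^sub>v ?s') @\<^sub>v (PX *\<^sub>v x' + (- \<alpha>1) \<cdot>\<^sub>v y') @\<^sub>v (PX *\<^sub>v x' + (- \<alpha>2) \<cdot>\<^sub>v z')"
  proof -
    have zero: "0\<^sub>m k ?m *\<^sub>v v = 0\<^sub>v k" if "v \<in> carrier_vec ?m" for v :: "real vec" and k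
      using that by (intro eq_vecI) auto
    have zero1: "0\<^sub>m ?m 1 *\<^sub>v ?s' = 0\<^sub>v ?m"
      by (intro eq_vecI) auto
    have one: "?I1 *\<^sub>v y' = (- \<alpha>1) \<cdot>\<^sub>v y'" "?I2 *\<^sub>v z' = (- \<alpha>2) \<cdot>\<^sub>v z'"
      using y' z' by (simp_all add: smult_mat_mult_vec[OF one_carrier_mat])
    have b: "?R *\<^sub>v ?s' + (0\<^sub>v 1 + 0\<^sub>v 1) = ?R *\<^sub>v ?s'"
      by (intro eq_vecI) auto
    have b1: "0\<^sub>v ?m + ((- \<alpha>1) \<cdot>\<^sub>v y' + 0\<^sub>v ?m) = (- \<alpha>1) \<cdot>\<^sub>v y'"
      "0\<^sub>v ?m + (0\<^sub>v ?m + (- \<alpha>2) \<cdot>\<^sub>v z') = (- \<alpha>2) \<cdot>\<^sub>v z'"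
      using y' z' by auto
    show ?thesis unfolding zero[OF y'] zero[OF z'] zero1 one b b1 ..
  qed
  finally have e: "Psi_mat *\<^sub>v (x' @\<^sub>v ?s' @\<^sub>v y' @\<^sub>v z') = \<dots>" .
  have add: "v \<bullet> (a + b) = v \<bullet> a + v \<bullet> b"
    if "v \<in> carrier_vec k" "a \<in> carrier_vec k" "b \<in> carrier_vec k" for v a b :: "real vec" and k
    using that by (rule scalar_prod_add_distrib)
  have ap: "(a @\<^sub>v b) \<bullet> (a' @\<^sub>v b') = a \<bullet> a' + b \<bullet> b'"
    if "a \<in> carrier_vec k" "a' \<in> carrier_vec k" "b \<in> carrier_vec l" "b' \<in> carrier_vec l"
    for a b a' b' :: "real vec" and k l
    by (rule scalar_prod_append[OF that(1,3,2,4)])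
  have mc: "psi_mat *\<^sub>v x' \<in> carrier_vec ?m" "?PL *\<^sub>v ?s' \<in> carrier_vec ?m" "PX *\<^sub>v x' \<in> carrier_vec ?m"
    "PX *\<^sub>v y' \<in> carrier_vec ?m" "PX *\<^sub>v z' \<in> carrier_vec ?m" "?PL\<^sup>T *\<^sub>v x' \<in> carrier_vec 1"
    "?R *\<^sub>v ?s' \<in> carrier_vec 1" "(- \<alpha>1) \<cdot>\<^sub>v y' \<in> carrier_vec ?m" "(- \<alpha>2) \<cdot>\<^sub>v z' \<in> carrier_vec ?m"
    by (rule mult_mat_vec_carrier[OF psi0_carrier x'], rule mult_mat_vec_carrier[OF PLc sc],
        rule mult_mat_vec_carrier[OF PX(1) x'], rule mult_mat_vec_carrier[OF PX(1) y'],
        rule mult_mat_vec_carrier[OF PX(1) z'], rule mult_mat_vec_carrier[OF PLt x'],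
        rule mult_mat_vec_carrier[OF mat_diag_dim sc]) (use y' z' in simp_all)
  have "(x @\<^sub>v ?s @\<^sub>v y @\<^sub>v z) \<bullet> (Psi_mat *\<^sub>v (x' @\<^sub>v ?s' @\<^sub>v y' @\<^sub>v z'))
    = x \<bullet> (psi_mat *\<^sub>v x') + (x \<bullet> (?PL *\<^sub>v ?s') + (x \<bullet> (PX *\<^sub>v y') + x \<bullet> (PX *\<^sub>v z')))
      + ((?s \<bullet> (?PL\<^sup>T *\<^sub>v x') + ?s \<bullet> (?R *\<^sub>v ?s'))
      + ((y \<bullet> (PX *\<^sub>v x') + y \<bullet> ((- \<alpha>1) \<cdot>\<^sub>v y')) + (z \<bullet> (PX *\<^sub>v x') + z \<bullet> ((- \<alpha>2) \<cdot>\<^sub>v z'))))"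
  proof -
    note ac = add_carrier_vec
    show ?thesis unfolding e
      by (simp only: ap[OF x ac[OF mc(1) ac[OF mc(2) ac[OF mc(4,5)]]]
            append_carrier_vec[OF sc append_carrier_vec[OF y z]]
            append_carrier_vec[OF ac[OF mc(6,7)] append_carrier_vec[OF ac[OF mc(3,8)] ac[OF mc(3,9)]]]]
          ap[OF sc ac[OF mc(6,7)] append_carrier_vec[OF y z] append_carrier_vec[OF ac[OF mc(3,8)] ac[OF mc(3,9)]]]
          ap[OF y ac[OF mc(3,8)] z ac[OF mc(3,9)]]
          add[OF x mc(1) ac[OF mc(2) ac[OF mc(4,5)]]] add[OF x mc(2) ac[OF mc(4,5)]] add[OF x mc(4,5)]
          add[OF sc mc(6,7)] add[OF y mc(3,8)] add[OF z mc(3,9)])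
  qed
  moreover have "?PL *\<^sub>v vec 1 (\<lambda>_. t) = PX *\<^sub>v (Lzeta N0 N L0 *\<^sub>v vec 1 (\<lambda>_. t))" for t
    by (rule assoc_mult_mat_vec[OF PX(1) Lc sc])
  moreover have "?s \<bullet> (?PL\<^sup>T *\<^sub>v x') = x' \<bullet> (?PL *\<^sub>v ?s)"
    by (rule scalar_prod_transpose[OF PLc sc x'])
  moreover have "?s \<bullet> (?R *\<^sub>v ?s') = 2 * rho \<delta> \<sigma> \<Gamma> \<alpha>1 \<alpha>2 \<alpha>3 N * (r * r')"
    unfolding mat_diag_mult_vec scalar_prod_vec by simp
  moreover have "y \<bullet> ((- \<alpha>1) \<cdot>\<^sub>v y') = - \<alpha>1 * (y \<bullet> y')" "z \<bullet> ((- \<alpha>2) \<cdot>\<^sub>v z') = - \<alpha>2 * (z \<bullet> z')"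
    using scalar_prod_smult_distrib[OF y y', of "- \<alpha>1"] scalar_prod_smult_distrib[OF z z', of "- \<alpha>2"] by simp_all
  moreover have "y \<bullet> (PX *\<^sub>v x') = x' \<bullet> (PX *\<^sub>v y)" "z \<bullet> (PX *\<^sub>v x') = x' \<bullet> (PX *\<^sub>v z)"
    using symmetric_scalar_prod[OF PX y x'] symmetric_scalar_prod[OF PX z x'] by simp_all
  ultimately show ?thesis by simp
qed

lemma Psi0_vec_split:
  assumes "v \<in> carrier_vec (6 * N + 10)"
  obtains x r y z where "x \<in> carrier_vec dimX" "y \<in> carrier_vec dimX" "z \<in> carrier_vec dimX"
    "v = x @\<^sub>v vec 1 (\<lambda>_. r) @\<^sub>v y @\<^sub>v z"
proof -
  have v: "v \<in> carrier_vec (dimX + (1 + (dimX + dimX)))" using assms by (simp add: algebra_simps)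
  have w: "vec_last v (1 + (dimX + dimX)) \<in> carrier_vec (1 + (dimX + dimX))" by (rule vec_last_carrier)
  let ?w = "vec_last v (1 + (dimX + dimX))"
  have w': "vec_last ?w (dimX + dimX) \<in> carrier_vec (dimX + dimX)" by (rule vec_last_carrier)
  have s: "vec_first ?w 1 = vec 1 (\<lambda>_. vec_first ?w 1 $ 0)"
    by (intro eq_vecI) auto
  show ?thesis
  proof (rule that)
    show "v = vec_first v dimX @\<^sub>v vec 1 (\<lambda>_. vec_first ?w 1 $ 0)
        @\<^sub>v vec_first (vec_last ?w (dimX + dimX)) dimX @\<^sub>v vec_last (vec_last ?w (dimX + dimX)) dimX"
      unfolding s[symmetric] vec_first_last_append[OF w'] vec_first_last_append[OF w]
        vec_first_last_append[OF v] ..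
  qed (rule vec_first_carrier vec_last_carrier)+
qed

lemma XiX_form: "x \<in> carrier_vec dimX \<Longrightarrow> y \<in> carrier_vec dimX \<Longrightarrow> x \<bullet> (XiX N0 N *\<^sub>v y) = y \<bullet> (XiX N0 N *\<^sub>v x)"
  by (elim state_vec_surj[OF N]) (simp add: XiX_mult_state state_vec_inner[OF N] mult_ac)

lemma XiE_form: "x \<in> carrier_vec dimX \<Longrightarrow> y \<in> carrier_vec dimX \<Longrightarrow> x \<bullet> (XiE N0 N *\<^sub>v y) = y \<bullet> (XiE N0 N *\<^sub>v x)"
  by (elim state_vec_surj[OF N]) (simp add: XiE_mult_state state_vec_inner[OF N] mult_ac)

lemma Psi0_symmetric: "Psi_mat\<^sup>T = Psi_mat"
proof (rule symmetric_matI[OF Psi0_carrier[OF L0 K0 N PX(1)]])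
  fix v v' :: "real vec"
  assume "v \<in> carrier_vec (6 * N + 10)" "v' \<in> carrier_vec (6 * N + 10)"
  from this(1) obtain x r y z where v: "x \<in> carrier_vec dimX" "y \<in> carrier_vec dimX" "z \<in> carrier_vec dimX"
    "v = x @\<^sub>v vec 1 (\<lambda>_. r) @\<^sub>v y @\<^sub>v z" by (rule Psi0_vec_split)
  from \<open>v' \<in> _\<close> obtain x' r' y' z' where v': "x' \<in> carrier_vec dimX" "y' \<in> carrier_vec dimX" "z' \<in> carrier_vec dimX"
    "v' = x' @\<^sub>v vec 1 (\<lambda>_. r') @\<^sub>v y' @\<^sub>v z'" by (rule Psi0_vec_split)
  have Kc: "K_mat *\<^sub>v w \<in> carrier_vec 1" for w by (rule carrier_vecI) (use carr(3) in auto)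
  have "x \<bullet> (psi_mat *\<^sub>v x') = x' \<bullet> (psi_mat *\<^sub>v x)"
    unfolding psi0_bilinear[OF v(1) v'(1)] psi0_bilinear[OF v'(1) v(1)]
    using comm_scalar_prod[OF Kc Kc, of x x'] symmetric_scalar_prod[OF PX v(1) v'(1)]
      XiX_form[OF v(1) v'(1)] XiE_form[OF v(1) v'(1)] by simp
  then show "v \<bullet> (Psi_mat *\<^sub>v v') = v' \<bullet> (Psi_mat *\<^sub>v v)"
    unfolding v(4) v'(4) Psi0_bilinear[OF v(1-3) v'(1-3)] Psi0_bilinear[OF v'(1-3) v(1-3)]
    using comm_scalar_prod[OF v(2) v'(2)] comm_scalar_prod[OF v(3) v'(3)] by (simp add: mult_ac)
qed

text \<open>With the modes of the nonlinear terms for \<open>y\<close> and \<open>z\<close>, the first summand is the derivative of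
  \<open>x \<bullet> P\<^sub>X x\<close> along the closed loop; the others are the quadratic constraints with their multipliers.\<close>

lemma Psi0_quadratic:
  fixes u r :: real and a e :: "nat \<Rightarrow> real"
  assumes y: "y \<in> carrier_vec dimX" and z: "z \<in> carrier_vec dimX"
  defines "x \<equiv> state_vec N0 N u a e"
  shows "(x @\<^sub>v vec 1 (\<lambda>_. r) @\<^sub>v y @\<^sub>v z) \<bullet> (Psi_mat *\<^sub>v (x @\<^sub>v vec 1 (\<lambda>_. r) @\<^sub>v y @\<^sub>v z))
    = 2 * (x \<bullet> (PX *\<^sub>v (F_mat *\<^sub>v x + (Lzeta N0 N L0 *\<^sub>v vec 1 (\<lambda>_. r) + (y + z))))) + 2 * \<delta> * (x \<bullet> (PX *\<^sub>v x))
      + 2 * \<alpha>3 * xi N / pi\<^sup>2 * (feedback N0 K0 u a)\<^sup>2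
      + 2 * \<alpha>1 * \<sigma>\<^sup>2 * (2 / pi\<^sup>2 * u\<^sup>2 + (\<Sum>n\<le>N. (a n)\<^sup>2)) + \<alpha>2 * \<sigma>\<^sup>2 * (\<Sum>n\<le>N. (e n)\<^sup>2)
      + 2 * rho \<delta> \<sigma> \<Gamma> \<alpha>1 \<alpha>2 \<alpha>3 N * r\<^sup>2 - \<alpha>1 * (y \<bullet> y) - \<alpha>2 * (z \<bullet> z)"
proof -
  have x: "x \<in> carrier_vec dimX" unfolding x_def by (rule state_vec_carrier[OF N])
  have Fx: "F_mat *\<^sub>v x \<in> carrier_vec dimX" by (rule mult_mat_vec_carrier[OF carr(1) x])
  have Lr: "Lzeta N0 N L0 *\<^sub>v vec 1 (\<lambda>_. r) \<in> carrier_vec dimX"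
    by (rule mult_mat_vec_carrier[OF carr(2) vec_carrier])
  have add: "x \<bullet> (PX *\<^sub>v (v + w)) = x \<bullet> (PX *\<^sub>v v) + x \<bullet> (PX *\<^sub>v w)"
    if "v \<in> carrier_vec dimX" "w \<in> carrier_vec dimX" for v w
    unfolding mult_add_distrib_mat_vec[OF PX(1) that] using PX x that
    by (intro scalar_prod_add_distrib[of _ dimX]) auto
  have "x \<bullet> (PX *\<^sub>v (F_mat *\<^sub>v x + (Lzeta N0 N L0 *\<^sub>v vec 1 (\<lambda>_. r) + (y + z))))
      = x \<bullet> (PX *\<^sub>v (F_mat *\<^sub>v x)) + (x \<bullet> (PX *\<^sub>v (Lzeta N0 N L0 *\<^sub>v vec 1 (\<lambda>_. r)))
        + (x \<bullet> (PX *\<^sub>v y) + x \<bullet> (PX *\<^sub>v z)))"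
    by (simp only: add Fx Lr y z add_carrier_vec)
  moreover have "(K_mat *\<^sub>v x) \<bullet> (K_mat *\<^sub>v x) = (feedback N0 K0 u a)\<^sup>2"
    unfolding x_def KX_mult_state[OF L0 K0 N] scalar_prod_vec by (simp add: power2_eq_square)
  moreover have "x \<bullet> (XiX N0 N *\<^sub>v x) = 2 / pi\<^sup>2 * u\<^sup>2 + (\<Sum>n\<le>N. (a n)\<^sup>2)"
    unfolding x_def XiX_mult_state state_vec_inner[OF N] by (simp add: power2_eq_square mult_ac)
  moreover have "x \<bullet> (XiE N0 N *\<^sub>v x) = (\<Sum>n\<le>N. (e n)\<^sup>2)"
    unfolding x_def XiE_mult_state state_vec_inner[OF N] by (simp add: power2_eq_square mult_ac)
  ultimately show ?thesis
    unfolding Psi0_bilinear[OF x y z x y z] psi0_bilinear[OF x x]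
    by (simp add: power2_eq_square)
qed

end

section \<open>The pointwise Lyapunov inequality\<close>

lemma locally_lipschitz_continuous:
  assumes "locally_lipschitz f"
  shows "continuous_on UNIV f"
  unfolding continuous_on_eq_continuous_at[OF open_UNIV]
proof
  fix p
  obtain r C where r: "r > 0" "C-lipschitz_on (cball p r) f"
    using assms unfolding locally_lipschitz_def by blast
  have "continuous_on (ball p r) f"
    by (rule continuous_on_subset[OF lipschitz_on_continuous_on[OF r(2)]]) auto
  then show "isCont f p"
    using r(1) by (simp add: continuous_on_eq_continuous_at)
qed

lemma nonlinearity_continuous:
  assumes g: "locally_lipschitz (\<lambda>(t, x, z). g t x z)" and f: "continuous_on S f"
  shows "continuous_on S (\<lambda>x. g t x (f x) :: real)"
proof -
  have "continuous_on S (\<lambda>x. (\<lambda>(t, x, z). g t x z) (t, x, f x))"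
    by (rule continuous_on_compose2[OF locally_lipschitz_continuous[OF g]])
      (auto intro!: continuous_intros f)
  then show ?thesis by simp
qed

lemma l2_inner_scale_self: "l2_inner (\<lambda>x. c * q x) (\<lambda>x. c * q x) = c\<^sup>2 * l2_inner q q"
proof -
  have "l2_inner (\<lambda>x. c * q x) (\<lambda>x. c * q x) = c * (c * l2_inner q q)"
    by (metis l2_inner_commute l2_inner_scale_left)
  then show ?thesis by (simp add: power2_eq_square)
qed

lemma Young:
  fixes a b c :: real
  assumes "c > 0"
  shows "2 * a * b \<le> a\<^sup>2 / c + c * b\<^sup>2"
proof -
  have "0 \<le> (a - c * b)\<^sup>2" by simp
  then have "c * (2 * a * b) \<le> a\<^sup>2 + c * (c * b\<^sup>2)"
    by (simp add: power2_diff power_mult_distrib power2_eq_square algebra_simps)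
  then show ?thesis using assms by (simp add: field_simps)
qed

text \<open>The left-hand side is the factor of \<open>w\<^sub>n\<^sup>2\<close> that remains in the derivative of the tail.  Divided by \<open>\<lambda>\<^sub>n\<close>
  it decreases in \<open>n\<close>, since \<open>\<rho> < 0\<close> forces its leading coefficient to be negative, and \<open>\<kappa>\<^sub>n / \<lambda>\<^sub>n\<close> decreases
  as well; so the value at \<open>n = N + 1\<close>, which defines \<open>\<rho>\<close>, controls all later modes.\<close>

lemma rho_bounds_tail_factor:
  assumes pos: "\<alpha>1 > 0" "\<alpha>2 > 0" "\<alpha>3 > 0" "\<Gamma> > 0" "\<delta> > 0"
    and neg: "rho \<delta> \<sigma> \<Gamma> \<alpha>1 \<alpha>2 \<alpha>3 N < 0" and n: "N < n"
  shows "- 2 * (lam n)\<^sup>2 + 2 * \<delta> * lam n + lam n / \<alpha>3 + (lam n)\<^sup>2 / \<alpha>1 + (lam n)\<^sup>2 / \<alpha>2 + \<alpha>2 * \<sigma>\<^sup>2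
    \<le> 2 * rho \<delta> \<sigma> \<Gamma> \<alpha>1 \<alpha>2 \<alpha>3 N * (1 + \<Gamma> + inverse \<Gamma> * lam n)"
proof -
  define l L where "l = lam (N + 1)" and "L = lam n"
  define A B C where "A = 1 - 1 / (2 * \<alpha>1) - 1 / (2 * \<alpha>2)" and "B = \<delta> + 1 / (2 * \<alpha>3)"
    and "C = \<alpha>2 * \<sigma>\<^sup>2 / 2"
  define q where "q x = - A * x\<^sup>2 + B * x + C" for x
  define k where "k x = 1 + \<Gamma> + inverse \<Gamma> * x" for x
  have l: "l > 0" unfolding l_def lam_def by simp
  have lL: "l \<le> L" unfolding l_def L_def by (rule lam_mono) (use n in simp)
  have BC: "B \<ge> 0" "C \<ge> 0" using pos by (auto simp: B_def C_def)
  have k: "k x > 0" if "x > 0" for x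
    using that pos unfolding k_def by (intro add_pos_pos mult_pos_pos) auto
  have rho: "rho \<delta> \<sigma> \<Gamma> \<alpha>1 \<alpha>2 \<alpha>3 N = q l / k l"
  proof -
    have eq: "- l\<^sup>2 + \<delta> * l + l / (2 * \<alpha>3) + l\<^sup>2 / (2 * \<alpha>1) + l\<^sup>2 / (2 * \<alpha>2) + \<alpha>2 * \<sigma>\<^sup>2 / 2 = q l"
      unfolding q_def A_def B_def C_def by (simp add: left_diff_distrib distrib_right)
    show ?thesis
      unfolding rho_def kappa_def l_def[symmetric] eq k_def divide_inverse[of "q l"] by (rule mult.commute)
  qed
  then have ql: "q l < 0" using neg k[OF l] by (simp add: divide_less_0_iff)
  have "0 \<le> B * l" using BC l by simp
  then have "A * l\<^sup>2 > 0" using ql BC(2) unfolding q_def by linarith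
  then have A: "A > 0" by (simp add: zero_less_mult_iff)
  have "l * q L \<le> L * q l"
  proof -
    have "L * q l - l * q L = (L - l) * (A * l * L + C)"
      unfolding q_def by (simp add: power2_eq_square algebra_simps)
    also have "\<dots> \<ge> 0" using A BC l lL by (intro mult_nonneg_nonneg add_nonneg_nonneg) auto
    finally show ?thesis by simp
  qed
  then have 1: "q L \<le> q l * (L / l)" using l by (simp add: field_simps)
  have "l * k L \<le> L * k l"
  proof -
    have "L * k l - l * k L = (L - l) * (1 + \<Gamma>)" unfolding k_def by (simp add: algebra_simps)
    also have "\<dots> \<ge> 0" using l lL pos by (intro mult_nonneg_nonneg) auto
    finally show ?thesis by simp
  qed
  then have "k L / k l \<le> L / l" using l k[OF l] by (simp add: field_simps)
  then have "q l * (L / l) \<le> q l * (k L / k l)" using ql by (intro mult_left_mono_neg) auto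
  with 1 have "2 * q L \<le> 2 * (q l / k l) * k L" by simp
  moreover have "2 * q L = - 2 * L\<^sup>2 + 2 * \<delta> * L + L / \<alpha>3 + L\<^sup>2 / \<alpha>1 + L\<^sup>2 / \<alpha>2 + \<alpha>2 * \<sigma>\<^sup>2"
    unfolding q_def A_def B_def C_def by (simp add: algebra_simps)
  ultimately show ?thesis unfolding rho by (simp add: k_def L_def)
qed

lemma neg_def_nonpos:
  assumes "neg_def n P" "v \<in> carrier_vec n"
  shows "v \<bullet> (P *\<^sub>v v) \<le> 0" "v \<noteq> 0\<^sub>v n \<Longrightarrow> v \<bullet> (P *\<^sub>v v) < 0"
proof -
  have P: "P \<in> carrier_mat n n" using assms(1) by (simp add: neg_def_def pos_def_def)
  have m: "v \<bullet> ((- P) *\<^sub>v v) = - (v \<bullet> (P *\<^sub>v v))"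
    using P assms(2) by simp
  show s: "v \<bullet> (P *\<^sub>v v) < 0" if "v \<noteq> 0\<^sub>v n"
    using assms that m unfolding neg_def_def pos_def_def by force
  show "v \<bullet> (P *\<^sub>v v) \<le> 0"
    using s P by (cases "v = 0\<^sub>v n") auto
qed

context
  fixes N0 N :: nat and xs \<delta> \<sigma> \<Gamma> \<alpha>1 \<alpha>2 \<alpha>3 :: real and L0 K0 PX :: "real mat"
  assumes L0: "L0 \<in> carrier_mat (N0 + 1) 1" and K0: "K0 \<in> carrier_mat 1 (N0 + 2)" and N: "N0 \<le> N" "N \<ge> 1"
    and PX: "PX \<in> carrier_mat (2 * N + 3) (2 * N + 3)" "PX\<^sup>T = PX"
    and pos: "\<alpha>1 > 0" "\<alpha>2 > 0" "\<alpha>3 > 0" "\<Gamma> > 0" "\<delta> > 0" "\<sigma> > 0"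
    and xs: "xs \<in> {0..1}"
    and neg: "neg_def (6 * N + 10) (Psi0 \<delta> \<sigma> \<Gamma> xs N0 N L0 K0 PX \<alpha>1 \<alpha>2 \<alpha>3)"
begin

abbreviation (input) "rhoN \<equiv> rho \<delta> \<sigma> \<Gamma> \<alpha>1 \<alpha>2 \<alpha>3 N"

lemma Psi0_vec_dim:
  assumes "x \<in> carrier_vec (2 * N + 3)" "y \<in> carrier_vec (2 * N + 3)" "z \<in> carrier_vec (2 * N + 3)"
  shows "x @\<^sub>v vec 1 (\<lambda>_. r) @\<^sub>v y @\<^sub>v z \<in> carrier_vec (6 * N + 10)"
proof -
  have "(2 * N + 3) + (1 + ((2 * N + 3) + (2 * N + 3))) = 6 * N + 10" by simp
  then show ?thesis using assms by (metis append_carrier_vec vec_carrier)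
qed

text \<open>\<open>2 \<rho>\<close> is a diagonal entry of \<open>\<Psi>\<^sub>0\<close>.\<close>

lemma rho_neg: "rhoN < 0"
proof -
  let ?o = "0\<^sub>v (2 * N + 3) :: real vec"
  have o: "?o \<in> carrier_vec (2 * N + 3)" by simp
  let ?v = "?o @\<^sub>v vec 1 (\<lambda>_. 1) @\<^sub>v ?o @\<^sub>v ?o"
  have c: "?v \<in> carrier_vec (6 * N + 10)" by (rule Psi0_vec_dim[OF o o o])
  have "?v \<noteq> 0\<^sub>v (6 * N + 10)"
  proof
    assume "?v = 0\<^sub>v (6 * N + 10)"
    then have "?v $ (2 * N + 3) = 0\<^sub>v (6 * N + 10) $ (2 * N + 3)" by (rule arg_cong)
    then show False by simp
  qed
  moreover have "?o \<bullet> (psi0 \<delta> \<sigma> xs N0 N L0 K0 PX \<alpha>1 \<alpha>2 \<alpha>3 *\<^sub>v ?o) = 0"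
    by (rule scalar_prod_left_zero[OF mult_mat_vec_carrier[OF psi0_carrier[OF L0 K0 N(1) PX] o]])
  ultimately show ?thesis
    using neg_def_nonpos(2)[OF neg c]
    unfolding Psi0_bilinear[OF L0 K0 N(1) PX o o o o o o]
    using PX block_carriers(2)[OF L0 K0 N(1)] by simp
qed

text \<open>Here \<open>f\<close> stands for \<open>w(\<cdot>,t)\<close>, \<open>a\<close> for the observer modes, \<open>gw\<close> and \<open>gh\<close> for the nonlinear terms of the plant and
  of the observer, and \<open>X'\<close> for the derivative of the state.  The form of \<open>\<Psi>\<^sub>0\<close> at \<open>(X, \<zeta>, \<langle>gh, \<phi>\<^sub>n\<rangle>, \<langle>gw - gh, \<phi>\<^sub>n\<rangle>)\<close>
  is nonpositive.  Its terms with \<open>\<alpha>\<^sub>1\<close> and \<open>\<alpha>\<^sub>2\<close> are paid for by Bessel's inequality and the Lipschitz bound,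
  which leave over a part that Young's inequality in the tail modes can use; the term with \<open>\<alpha>\<^sub>3\<close> pays for the
  control in these modes, and \<open>\<rho> \<zeta>\<^sup>2\<close> for the measurement error, by the pointwise bound on the tail.  All sums
  stop at \<open>M\<close>: the right-hand side consists of the parts of \<open>\<parallel>f\<parallel>\<^sup>2\<close> and \<open>\<parallel>f'\<parallel>\<^sup>2\<close> that lie beyond \<open>M\<close>, and it vanishes
  in the limit.\<close>

lemma lyapunov_pointwise:
  fixes a :: "nat \<Rightarrow> real" and u :: real and f f' f'' gw gh :: "real \<Rightarrow> real" and M :: nat
  assumes f: "neumann f f' f''" and gw: "gw \<in> L2" and gh: "gh \<in> L2"
    and hat_bound: "\<And>x. x \<in> {0..1} \<Longrightarrow> \<bar>gh x\<bar> \<le> \<sigma> * \<bar>(\<Sum>n\<le>N. a n * phi n x) + psi x * u\<bar>"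
    and diff_bound: "\<And>x. x \<in> {0..1} \<Longrightarrow> \<bar>gw x - gh x\<bar> \<le> \<sigma> * \<bar>f x - (\<Sum>n\<le>N. a n * phi n x)\<bar>"
    and M: "N \<le> M"
  defines "k \<equiv> feedback N0 K0 u a" and "m \<equiv> mode f"
    and "X \<equiv> state_vec N0 N u a (\<lambda>n. mode f n - a n)"
    and "\<zeta> \<equiv> f xs - (\<Sum>n\<le>N. mode f n * phi n xs)"
  defines "X' \<equiv> FX N0 N xs L0 K0 *\<^sub>v X + (Lzeta N0 N L0 *\<^sub>v vec 1 (\<lambda>_. \<zeta>)
      + (state_vec N0 N 0 (mode gh) (\<lambda>_. 0) + state_vec N0 N 0 (\<lambda>_. 0) (\<lambda>n. mode gw n - mode gh n)))"
  shows "2 * (X \<bullet> (PX *\<^sub>v X')) + (\<Sum>n\<in>{N<..M}. 2 * lam n * m n * (- lam n * m n + mode gw n - bcoef n * k))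
      + 2 * \<delta> * (X \<bullet> (PX *\<^sub>v X) + (\<Sum>n\<in>{N<..M}. lam n * (m n)\<^sup>2))
    \<le> \<alpha>2 * \<sigma>\<^sup>2 * (l2_inner f f - (\<Sum>n\<le>M. (m n)\<^sup>2))
      - 2 * rhoN * ((1 + \<Gamma>) * (l2_inner f f - (\<Sum>n\<le>M. (m n)\<^sup>2))
        + inverse \<Gamma> * (l2_inner f' f' - (\<Sum>n\<le>M. lam n * (m n)\<^sup>2)))"
proof -
  define h where "h n = mode gw n - mode gh n" for n
  define e where "e n = m n - a n" for n
  let ?what = "\<lambda>x. \<Sum>n\<le>N. a n * phi n x"
  let ?T = "{N<..M}"
  note L = neumann_L2[OF f]
  have wL: "?what \<in> L2" by (rule orthonormal_comb_L2[OF phi_orthonormal])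
  have split: "(\<Sum>n\<le>M. c n) = (\<Sum>n\<le>N. c n) + (\<Sum>n\<in>?T. c n)" for c :: "nat \<Rightarrow> real"
  proof -
    have "{..M} = {..N} \<union> ?T" using M by auto
    then show ?thesis by (simp add: sum.union_disjoint ivl_disj_int)
  qed
  \<comment> \<open>the matrix inequality at the actual state\<close>
  have G: "state_vec N0 N 0 (mode gh) (\<lambda>_. 0) \<in> carrier_vec (2 * N + 3)"
    and H: "state_vec N0 N 0 (\<lambda>_. 0) h \<in> carrier_vec (2 * N + 3)"
    and Xc: "X \<in> carrier_vec (2 * N + 3)"
    unfolding X_def by (rule state_vec_carrier[OF N(1)])+
  have "(X @\<^sub>v vec 1 (\<lambda>_. \<zeta>) @\<^sub>v state_vec N0 N 0 (mode gh) (\<lambda>_. 0) @\<^sub>v state_vec N0 N 0 (\<lambda>_. 0) h)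
      \<bullet> (Psi0 \<delta> \<sigma> \<Gamma> xs N0 N L0 K0 PX \<alpha>1 \<alpha>2 \<alpha>3 *\<^sub>v
        (X @\<^sub>v vec 1 (\<lambda>_. \<zeta>) @\<^sub>v state_vec N0 N 0 (mode gh) (\<lambda>_. 0) @\<^sub>v state_vec N0 N 0 (\<lambda>_. 0) h)) \<le> 0"
    by (rule neg_def_nonpos(1)[OF neg Psi0_vec_dim[OF Xc G H]])
  then have psi: "2 * (X \<bullet> (PX *\<^sub>v X')) + 2 * \<delta> * (X \<bullet> (PX *\<^sub>v X)) + 2 * \<alpha>3 * xi N / pi\<^sup>2 * k\<^sup>2
      + 2 * \<alpha>1 * \<sigma>\<^sup>2 * (2 / pi\<^sup>2 * u\<^sup>2 + (\<Sum>n\<le>N. (a n)\<^sup>2)) + \<alpha>2 * \<sigma>\<^sup>2 * (\<Sum>n\<le>N. (e n)\<^sup>2)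
      + 2 * rhoN * \<zeta>\<^sup>2 - \<alpha>1 * (\<Sum>n\<le>N. (mode gh n)\<^sup>2) - \<alpha>2 * (\<Sum>n\<le>N. (h n)\<^sup>2) \<le> 0"
    unfolding X_def X'_def k_def Psi0_quadratic[OF L0 K0 N(1) PX G H] h_def[abs_def, symmetric]
      state_vec_inner[OF N(1)] e_def m_def
    by (simp add: power2_eq_square)
  \<comment> \<open>the quadratic constraints to which the multipliers \<open>\<alpha>\<^sub>1\<close> and \<open>\<alpha>\<^sub>2\<close> belong\<close>
  have hatsum: "(\<Sum>n\<le>M. (mode gh n)\<^sup>2) \<le> \<sigma>\<^sup>2 * (2 * (\<Sum>n\<le>N. (a n)\<^sup>2) + 2 * (2 / pi\<^sup>2 * u\<^sup>2))"
  proof -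
    have pu: "(\<lambda>x. psi x * u) \<in> L2" using L2_scale[OF psi_L2, of u] by (simp add: mult.commute)
    have pu2: "l2_inner (\<lambda>x. psi x * u) (\<lambda>x. psi x * u) = 2 / pi\<^sup>2 * u\<^sup>2"
      using l2_inner_scale_self[of u psi] by (simp add: psi_norm mult.commute)
    have "(\<Sum>n\<le>M. (mode gh n)\<^sup>2) \<le> l2_inner gh gh"
      by (rule Bessel_inequality[OF phi_orthonormal gh])
    also have "\<dots> \<le> l2_inner (\<lambda>x. \<sigma> * (?what x + psi x * u)) (\<lambda>x. \<sigma> * (?what x + psi x * u))"
      using hat_bound pos by (intro l2_inner_mono gh L2_scale L2_add wL pu) (auto simp: abs_mult)
    also have "\<dots> = \<sigma>\<^sup>2 * l2_inner (\<lambda>x. ?what x + psi x * u) (\<lambda>x. ?what x + psi x * u)"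
      by (rule l2_inner_scale_self)
    also have "\<dots> \<le> \<sigma>\<^sup>2 * (2 * (\<Sum>n\<le>N. (a n)\<^sup>2) + 2 * (2 / pi\<^sup>2 * u\<^sup>2))"
      using l2_inner_self_add_le[OF wL pu] unfolding pu2 orthonormal_comb_norm[OF phi_orthonormal]
      by (intro mult_left_mono) auto
    finally show ?thesis .
  qed
  have hsum: "(\<Sum>n\<le>M. (h n)\<^sup>2) \<le> \<sigma>\<^sup>2 * (l2_inner f f - (\<Sum>n\<le>N. (m n)\<^sup>2) + (\<Sum>n\<le>N. (e n)\<^sup>2))"
  proof -
    have "(\<Sum>n\<le>M. (h n)\<^sup>2) = (\<Sum>n\<le>M. (mode (\<lambda>x. gw x - gh x) n)\<^sup>2)"
      by (simp add: h_def l2_inner_diff_left gw gh)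
    also have "\<dots> \<le> l2_inner (\<lambda>x. gw x - gh x) (\<lambda>x. gw x - gh x)"
      by (intro Bessel_inequality[OF phi_orthonormal] L2_diff gw gh)
    also have "\<dots> \<le> l2_inner (\<lambda>x. \<sigma> * (f x - ?what x)) (\<lambda>x. \<sigma> * (f x - ?what x))"
      using diff_bound pos by (intro l2_inner_mono L2_scale L2_diff gw gh L wL) (auto simp: abs_mult)
    also have "\<dots> = \<sigma>\<^sup>2 * (l2_inner f f - (\<Sum>n\<le>N. (m n)\<^sup>2) + (\<Sum>n\<le>N. (e n)\<^sup>2))"
      unfolding l2_inner_scale_self orthonormal_distance[OF phi_orthonormal L(1)]
      by (simp add: e_def m_def power2_commute)
    finally show ?thesis .
  qed
  \<comment> \<open>the modes beyond the observer\<close>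
  have mode_bound: "2 * lam n * m n * (- lam n * m n + mode gw n - bcoef n * k) + 2 * \<delta> * (lam n * (m n)\<^sup>2)
      \<le> 2 * rhoN * ((1 + \<Gamma>) * (m n)\<^sup>2 + inverse \<Gamma> * (lam n * (m n)\<^sup>2)) - \<alpha>2 * \<sigma>\<^sup>2 * (m n)\<^sup>2
        + \<alpha>1 * (mode gh n)\<^sup>2 + \<alpha>2 * (h n)\<^sup>2 + \<alpha>3 * k\<^sup>2 * (lam n * (bcoef n)\<^sup>2)" if n: "n \<in> ?T" for n
  proof -
    define l where "l = lam n"
    have l: "0 \<le> l" by (simp add: l_def lam_nonneg)
    have 1: "2 * (l * m n) * mode gh n \<le> (l * m n)\<^sup>2 / \<alpha>1 + \<alpha>1 * (mode gh n)\<^sup>2"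
      by (rule Young[OF pos(1)])
    have 2: "2 * (l * m n) * h n \<le> (l * m n)\<^sup>2 / \<alpha>2 + \<alpha>2 * (h n)\<^sup>2"
      by (rule Young[OF pos(2)])
    have "l * (2 * m n * (- bcoef n * k)) \<le> l * ((m n)\<^sup>2 / \<alpha>3 + \<alpha>3 * (- bcoef n * k)\<^sup>2)"
      using l by (intro mult_left_mono Young[OF pos(3)])
    then have 3: "- (2 * l * m n * (bcoef n * k)) \<le> l / \<alpha>3 * (m n)\<^sup>2 + \<alpha>3 * k\<^sup>2 * (l * (bcoef n)\<^sup>2)"
      by (simp add: power_mult_distrib algebra_simps)
    have "(- 2 * l\<^sup>2 + 2 * \<delta> * l + l / \<alpha>3 + l\<^sup>2 / \<alpha>1 + l\<^sup>2 / \<alpha>2 + \<alpha>2 * \<sigma>\<^sup>2) * (m n)\<^sup>2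
        \<le> (2 * rhoN * (1 + \<Gamma> + inverse \<Gamma> * l)) * (m n)\<^sup>2"
      unfolding l_def using n
      by (intro mult_right_mono rho_bounds_tail_factor[OF pos(1-5) rho_neg]) auto
    then have 4: "- 2 * (l * m n)\<^sup>2 + 2 * \<delta> * (l * (m n)\<^sup>2) + l / \<alpha>3 * (m n)\<^sup>2 + (l * m n)\<^sup>2 / \<alpha>1
        + (l * m n)\<^sup>2 / \<alpha>2 + \<alpha>2 * \<sigma>\<^sup>2 * (m n)\<^sup>2
        \<le> 2 * rhoN * ((1 + \<Gamma>) * (m n)\<^sup>2 + inverse \<Gamma> * (l * (m n)\<^sup>2))"
      by (simp add: power_mult_distrib algebra_simps)
    have "2 * l * m n * (- l * m n + mode gw n - bcoef n * k)
        = - 2 * (l * m n)\<^sup>2 + 2 * (l * m n) * mode gh n + 2 * (l * m n) * h n - 2 * l * m n * (bcoef n * k)"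
      by (simp add: h_def power2_eq_square algebra_simps)
    with 1 2 3 4 show ?thesis unfolding l_def[symmetric] by linarith
  qed
  define m0 m1 l0 l1 where "m0 = (\<Sum>n\<le>N. (m n)\<^sup>2)" and "m1 = (\<Sum>n\<in>?T. (m n)\<^sup>2)"
    and "l0 = (\<Sum>n\<le>N. lam n * (m n)\<^sup>2)" and "l1 = (\<Sum>n\<in>?T. lam n * (m n)\<^sup>2)"
  define G0 G1 H0 H1 where "G0 = (\<Sum>n\<le>N. (mode gh n)\<^sup>2)" and "G1 = (\<Sum>n\<in>?T. (mode gh n)\<^sup>2)"
    and "H0 = (\<Sum>n\<le>N. (h n)\<^sup>2)" and "H1 = (\<Sum>n\<in>?T. (h n)\<^sup>2)"
  define SA SE B where "SA = (\<Sum>n\<le>N. (a n)\<^sup>2)" and "SE = (\<Sum>n\<le>N. (e n)\<^sup>2)"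
    and "B = (\<Sum>n\<in>?T. lam n * (bcoef n)\<^sup>2)"
  define T where "T = (\<Sum>n\<in>?T. 2 * lam n * m n * (- lam n * m n + mode gw n - bcoef n * k))"
  have "(\<Sum>n\<in>?T. 2 * lam n * m n * (- lam n * m n + mode gw n - bcoef n * k) + 2 * \<delta> * (lam n * (m n)\<^sup>2))
      \<le> (\<Sum>n\<in>?T. 2 * rhoN * ((1 + \<Gamma>) * (m n)\<^sup>2 + inverse \<Gamma> * (lam n * (m n)\<^sup>2)) - \<alpha>2 * \<sigma>\<^sup>2 * (m n)\<^sup>2
        + \<alpha>1 * (mode gh n)\<^sup>2 + \<alpha>2 * (h n)\<^sup>2 + \<alpha>3 * k\<^sup>2 * (lam n * (bcoef n)\<^sup>2))"
    by (intro sum_mono mode_bound)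
  then have tail: "T + 2 * \<delta> * l1 \<le> 2 * rhoN * ((1 + \<Gamma>) * m1 + inverse \<Gamma> * l1) - \<alpha>2 * \<sigma>\<^sup>2 * m1
        + \<alpha>1 * G1 + \<alpha>2 * H1 + \<alpha>3 * k\<^sup>2 * B"
    unfolding T_def l1_def m1_def G1_def H1_def B_def
    by (simp only: sum.distrib sum_subtractf sum_distrib_left[symmetric])
  have B: "\<alpha>3 * k\<^sup>2 * B \<le> 2 * \<alpha>3 * xi N / pi\<^sup>2 * k\<^sup>2"
    using mult_left_mono[OF sum_lam_bcoef_tail[OF N(2), of M], of "\<alpha>3 * k\<^sup>2"] pos
    by (simp add: B_def mult_ac)
  have G: "\<alpha>1 * (G0 + G1) \<le> \<alpha>1 * (\<sigma>\<^sup>2 * (2 * SA + 2 * (2 / pi\<^sup>2 * u\<^sup>2)))"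
    using mult_left_mono[OF hatsum, of \<alpha>1] pos unfolding split G0_def G1_def SA_def by simp
  have H: "\<alpha>2 * (H0 + H1) \<le> \<alpha>2 * (\<sigma>\<^sup>2 * (l2_inner f f - m0 + SE))"
    using mult_left_mono[OF hsum, of \<alpha>2] pos unfolding split H0_def H1_def m0_def SE_def by simp
  have Z: "- 2 * rhoN * \<zeta>\<^sup>2 \<le> - 2 * rhoN * ((1 + \<Gamma>) * (l2_inner f f - m0) + inverse \<Gamma> * (l2_inner f' f' - l0))"
    using mult_left_mono[OF neumann_tail_value[OF f xs pos(4), of N], of "- 2 * rhoN"] rho_neg
    unfolding \<zeta>_def m0_def l0_def m_def by simp
  have "2 * (X \<bullet> (PX *\<^sub>v X')) + 2 * \<delta> * (X \<bullet> (PX *\<^sub>v X)) + 2 * \<alpha>3 * xi N / pi\<^sup>2 * k\<^sup>2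
      + 2 * \<alpha>1 * \<sigma>\<^sup>2 * (2 / pi\<^sup>2 * u\<^sup>2 + SA) + \<alpha>2 * \<sigma>\<^sup>2 * SE + 2 * rhoN * \<zeta>\<^sup>2 - \<alpha>1 * G0 - \<alpha>2 * H0 \<le> 0"
    using psi unfolding SA_def SE_def G0_def H0_def .
  moreover have "2 * rhoN * ((1 + \<Gamma>) * (p - q) + i * (r - s)) = 2 * rhoN * ((1 + \<Gamma>) * p + i * r)
      - 2 * rhoN * ((1 + \<Gamma>) * q + i * s)" for p q r s i
    by (simp add: algebra_simps)
  note ex = this
  ultimately have "2 * (X \<bullet> (PX *\<^sub>v X')) + T + 2 * \<delta> * (X \<bullet> (PX *\<^sub>v X) + l1)
    \<le> \<alpha>2 * \<sigma>\<^sup>2 * (l2_inner f f - (m0 + m1))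
      - 2 * rhoN * ((1 + \<Gamma>) * (l2_inner f f - (m0 + m1)) + inverse \<Gamma> * (l2_inner f' f' - (l0 + l1)))"
    using tail B G H Z by (simp add: algebra_simps)
  then show ?thesis unfolding T_def l0_def l1_def m0_def m1_def split .
qed

end

section \<open>Modes of solutions\<close>

lemma eventually_within: "\<forall>\<^sub>F s in at t within S. s \<in> S"
  by (simp add: eventually_at_filter)

lemma l2_continuous_inner:
  assumes w: "l2_continuous_on S w" and h: "h \<in> L2"
  shows "continuous_on S (\<lambda>t. l2_inner (w t) h)"
  unfolding continuous_on_def
proof
  fix t assume t: "t \<in> S"
  have lim: "((\<lambda>s. l2_norm (\<lambda>x. w s x - w t x) * l2_norm h) \<longlongrightarrow> 0) (at t within S)"
    using w t unfolding l2_continuous_on_def by (intro tendsto_mult_left_zero) blast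
  have "((\<lambda>s. l2_inner (w s) h - l2_inner (w t) h) \<longlongrightarrow> 0) (at t within S)"
  proof (rule Lim_null_comparison[OF _ lim])
    show "\<forall>\<^sub>F s in at t within S. norm (l2_inner (w s) h - l2_inner (w t) h) \<le> l2_norm (\<lambda>x. w s x - w t x) * l2_norm h"
      using eventually_within
    proof eventually_elim
      case (elim s)
      then have L: "w s \<in> L2" "w t \<in> L2" using w t unfolding l2_continuous_on_def by blast+
      then show ?case
        using l2_Cauchy_Schwarz[OF L2_diff[OF L] h] by (simp add: l2_inner_diff_left h)
    qed
  qed
  then show "((\<lambda>s. l2_inner (w s) h) \<longlongrightarrow> l2_inner (w t) h) (at t within S)"
    by (rule LIM_zero_cancel)
qed

lemma l2_continuous_norm:
  assumes w: "l2_continuous_on S w"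
  shows "continuous_on S (\<lambda>t. l2_norm (w t))"
  unfolding continuous_on_def
proof
  fix t assume t: "t \<in> S"
  have lim: "((\<lambda>s. l2_norm (\<lambda>x. w s x - w t x)) \<longlongrightarrow> 0) (at t within S)"
    using w t unfolding l2_continuous_on_def by blast
  have "((\<lambda>s. l2_norm (w s) - l2_norm (w t)) \<longlongrightarrow> 0) (at t within S)"
  proof (rule Lim_null_comparison[OF _ lim])
    show "\<forall>\<^sub>F s in at t within S. norm (l2_norm (w s) - l2_norm (w t)) \<le> l2_norm (\<lambda>x. w s x - w t x)"
      using eventually_within
    proof eventually_elim
      case (elim s)
      then have "w s \<in> L2" "w t \<in> L2" using w t unfolding l2_continuous_on_def by blast+
      then show ?case using l2_norm_diff_triangle by simp
    qed
  qed
  then show "((\<lambda>s. l2_norm (w s)) \<longlongrightarrow> l2_norm (w t)) (at t within S)"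
    by (rule LIM_zero_cancel)
qed

lemma l2_derivative_inner:
  assumes d: "l2_has_derivative w w' t" and w': "w' \<in> L2" and h: "h \<in> L2"
    and S: "open S" "t \<in> S" and w: "\<And>s. s \<in> S \<Longrightarrow> w s \<in> L2"
  shows "((\<lambda>s. l2_inner (w s) h) has_real_derivative l2_inner w' h) (at t)"
proof -
  let ?q = "\<lambda>s x. (w s x - w t x) / (s - t) - w' x"
  have lim: "((\<lambda>s. l2_norm (?q s) * l2_norm h) \<longlongrightarrow> 0) (at t)"
    using d unfolding l2_has_derivative_def by (intro tendsto_mult_left_zero)
  have "((\<lambda>s. (l2_inner (w s) h - l2_inner (w t) h) / (s - t) - l2_inner w' h) \<longlongrightarrow> 0) (at t)"
  proof (rule Lim_null_comparison[OF _ lim])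
    have "\<forall>\<^sub>F s in at t. s \<in> S" using S by (intro eventually_at_in_open') auto
    then show "\<forall>\<^sub>F s in at t. norm ((l2_inner (w s) h - l2_inner (w t) h) / (s - t) - l2_inner w' h)
        \<le> l2_norm (?q s) * l2_norm h"
    proof eventually_elim
      case (elim s)
      note L = w[OF elim] w[OF S(2)]
      have dL: "(\<lambda>x. (1 / (s - t)) * (w s x - w t x)) \<in> L2" by (intro L2_scale L2_diff L)
      have eq: "?q s = (\<lambda>x. (1 / (s - t)) * (w s x - w t x) - w' x)" by (simp add: fun_eq_iff)
      have "l2_inner (?q s) h = (l2_inner (w s) h - l2_inner (w t) h) / (s - t) - l2_inner w' h"
        unfolding eq l2_inner_diff_left[OF dL w' h] l2_inner_scale_left l2_inner_diff_left[OF L h]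
        by simp
      moreover have "?q s \<in> L2" unfolding eq by (intro L2_diff dL w')
      ultimately show ?case using l2_Cauchy_Schwarz[of "?q s" h] h by simp
    qed
  qed
  then have "((\<lambda>s. (l2_inner (w s) h - l2_inner (w t) h) / (s - t)) \<longlongrightarrow> l2_inner w' h) (at t)"
    by (rule LIM_zero_cancel)
  then show ?thesis by (simp add: has_field_derivative_iff)
qed

text \<open>Continuity and differentiability of the state are checked component by component, and every
  component is \<open>u\<close>, an observer mode or an error.\<close>

lemma state_vec_component:
  assumes "N0 \<le> N" "i < 2 * N + 3"
  obtains "\<And>u a e. state_vec N0 N u a e $ i = u"
  | n where "n \<le> N" "\<And>u a e. state_vec N0 N u a e $ i = a n"
  | n where "n \<le> N" "\<And>u a e. state_vec N0 N u a e $ i = e n"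
proof -
  consider "i = 0" | "0 < i" "i < N0 + 2" | "N0 + 2 \<le> i" "i < 2 * N0 + 3"
    | "2 * N0 + 3 \<le> i" "i < N0 + N + 3" | "N0 + N + 3 \<le> i" by linarith
  then show ?thesis
  proof cases
    case 1
    then show ?thesis by (intro that(1)) (simp add: state_vec_def)
  next
    case 2
    then obtain j where j: "i = Suc j" by (cases i) auto
    show ?thesis
      by (rule that(2)[of j]) (use 2 j assms in \<open>auto simp: state_vec_def\<close>)
  next
    case 3
    then obtain j where j: "i = N0 + 2 + j" using le_Suc_ex by blast
    show ?thesis
      by (rule that(3)[of j]) (use 3 j assms in \<open>auto simp: state_vec_def\<close>)
  next
    case 4
    then obtain j where j: "i = 2 * N0 + 3 + j" using le_Suc_ex by blast
    show ?thesis
      by (rule that(2)[of "N0 + 1 + j"]) (use 4 j assms in \<open>auto simp: state_vec_def\<close>)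
  next
    case 5
    then obtain j where j: "i = N0 + N + 3 + j" using le_Suc_ex by blast
    show ?thesis
      by (rule that(3)[of "N0 + 1 + j"]) (use 5 j assms in \<open>auto simp: state_vec_def\<close>)
  qed
qed

lemma quadratic_form_sum:
  fixes P :: "real mat"
  assumes "P \<in> carrier_mat n n" "x \<in> carrier_vec n" "y \<in> carrier_vec n"
  shows "x \<bullet> (P *\<^sub>v y) = (\<Sum>i<n. \<Sum>j<n. x $ i * (P $$ (i, j) * y $ j))"
  using assms by (simp add: scalar_prod_def sum_distrib_left atLeast0LessThan)

lemma DERIV_quadratic_form:
  fixes P :: "real mat"
  assumes P: "P \<in> carrier_mat n n" "P\<^sup>T = P"
    and x: "\<And>s. x s \<in> carrier_vec n" and x': "x' \<in> carrier_vec n"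
    and d: "\<And>i. i < n \<Longrightarrow> ((\<lambda>s. x s $ i) has_real_derivative x' $ i) (at t)"
  shows "((\<lambda>s. x s \<bullet> (P *\<^sub>v x s)) has_real_derivative 2 * (x t \<bullet> (P *\<^sub>v x'))) (at t)"
proof -
  have "((\<lambda>s. \<Sum>i<n. \<Sum>j<n. x s $ i * (P $$ (i, j) * x s $ j)) has_real_derivative
      (\<Sum>i<n. \<Sum>j<n. x' $ i * (P $$ (i, j) * x t $ j) + (P $$ (i, j) * x' $ j) * x t $ i)) (at t)"
    by (intro DERIV_sum DERIV_mult' DERIV_cmult d DERIV_mult) auto
  also have "(\<Sum>i<n. \<Sum>j<n. x' $ i * (P $$ (i, j) * x t $ j) + (P $$ (i, j) * x' $ j) * x t $ i)
      = x' \<bullet> (P *\<^sub>v x t) + x t \<bullet> (P *\<^sub>v x')"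
    unfolding quadratic_form_sum[OF P(1) x' x] quadratic_form_sum[OF P(1) x x']
    by (simp add: sum.distrib mult_ac)
  also have "\<dots> = 2 * (x t \<bullet> (P *\<^sub>v x'))"
    using symmetric_scalar_prod[OF P x' x] by simp
  finally show ?thesis unfolding quadratic_form_sum[OF P(1) x x] .
qed

lemma control_eq:
  assumes "K0 \<in> carrier_mat 1 (N0 + 2)"
  shows "control N0 K0 u wh t = - feedback N0 K0 (u t) (\<lambda>n. wh n t)"
proof -
  have "vcat [col_mat 1 (\<lambda>_. u t), col_mat (N0 + 1) (\<lambda>n. wh n t)] = col_mat (N0 + 2) (case_nat (u t) (\<lambda>n. wh n t))"
    by (rule eq_matI) (auto simp: col_mat_def Let_def split: nat.split)
  moreover have "(K0 * col_mat (N0 + 2) f) $$ (0, 0) = (\<Sum>i<N0 + 2. K0 $$ (0, i) * f i)" for f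
    using assms by (simp add: col_mat_def scalar_prod_def atLeast0LessThan)
  ultimately show ?thesis unfolding control_def feedback_def by simp
qed

lemma C1_deriv:
  fixes f :: "real \<Rightarrow> real"
  assumes "f C1_differentiable_on {0<..}"
  shows "continuous_on {0<..} (deriv f)" "\<forall>t>0. (f has_real_derivative deriv f t) (at t)"
proof -
  obtain D where D: "\<And>t. t \<in> {0<..} \<Longrightarrow> (f has_real_derivative D t) (at t)" "continuous_on {0<..} D"
    using assms unfolding C1_differentiable_on_def has_real_derivative_iff_has_vector_derivative by blast
  have eq: "deriv f t = D t" if "t \<in> {0<..}" for t
    using D(1)[OF that] by (rule DERIV_imp_deriv)
  show "continuous_on {0<..} (deriv f)"
    using D(2) by (rule continuous_on_eq) (simp add: eq)
  show "\<forall>t>0. (f has_real_derivative deriv f t) (at t)" using D(1) eq by simp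
qed

locale closed_loop =
  fixes g :: "real \<Rightarrow> real \<Rightarrow> real \<Rightarrow> real" and N0 N :: nat and xs :: real and L0 K0 :: "real mat"
    and w0 u :: "real \<Rightarrow> real" and w :: "real \<Rightarrow> real \<Rightarrow> real" and wh :: "nat \<Rightarrow> real \<Rightarrow> real"
  assumes L0: "L0 \<in> carrier_mat (N0 + 1) 1" and K0: "K0 \<in> carrier_mat 1 (N0 + 2)" and N: "N0 \<le> N"
    and g_lip: "locally_lipschitz (\<lambda>(t, x, z). g t x z)"
    and sol: "closed_loop_solution g xs N0 N L0 K0 w0 u w wh"
begin

text \<open>\<open>fb\<close> is the control with the opposite sign, and \<open>zeta\<close> the part of the measurement that is carried by
  the modes beyond the observer.\<close>

definition "fb t = feedback N0 K0 (u t) (\<lambda>n. wh n t)"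
definition "gtrue t x = g t x (w t x + psi x * u t)"
definition "ghat t x = g t x (observer N wh t x + psi x * u t)"
definition "err n t = mode (w t) n - wh n t"
definition "zeta t = w t xs - (\<Sum>n\<le>N. mode (w t) n * phi n xs)"

lemma solution_initial: "u 0 = 0" "n \<le> N \<Longrightarrow> wh n 0 = 0" "x \<in> {0..1} \<Longrightarrow> w 0 x = w0 x"
  using sol unfolding closed_loop_solution_def Let_def by blast+

lemma solution_continuous: "continuous_on {0..} u" "n \<le> N \<Longrightarrow> continuous_on {0..} (wh n)"
    "l2_continuous_on {0..} w"
  using sol unfolding closed_loop_solution_def Let_def by blast+

lemma solution_neumann:
  assumes "t > 0"
  obtains f' f'' where "neumann (w t) f' f''"
  using sol assms unfolding closed_loop_solution_def Let_def neumann_def by blast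

lemma continuous_on_w: "t > 0 \<Longrightarrow> continuous_on {0..1} (w t)"
  using solution_neumann H1_continuous unfolding neumann_def by metis

lemma gtrue_L2: "t > 0 \<Longrightarrow> gtrue t \<in> L2"
  unfolding gtrue_def [abs_def]
  by (intro L2_continuous nonlinearity_continuous[OF g_lip] continuous_intros continuous_on_w continuous_on_psi)

lemma ghat_L2: "ghat t \<in> L2"
  unfolding ghat_def [abs_def] observer_def
  by (intro L2_continuous nonlinearity_continuous[OF g_lip] continuous_intros continuous_on_phi continuous_on_psi)

lemma u_dynamics:
  "continuous_on {0<..} (deriv u)"
  "t > 0 \<Longrightarrow> (u has_real_derivative deriv u t) (at t)"
  "t > 0 \<Longrightarrow> deriv u t = - mu * u t - fb t"
proof -
  have "u C1_differentiable_on {0<..}"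
    using sol unfolding closed_loop_solution_def Let_def by blast
  note C1_deriv[OF this]
  then show "continuous_on {0<..} (deriv u)" "t > 0 \<Longrightarrow> (u has_real_derivative deriv u t) (at t)"
    by blast+
  have "(u has_real_derivative - mu * u t + control N0 K0 u wh t) (at t)" if "t > 0"
    using sol that unfolding closed_loop_solution_def Let_def by blast
  then show "t > 0 \<Longrightarrow> deriv u t = - mu * u t - fb t"
    using DERIV_imp_deriv unfolding control_eq[OF K0] fb_def by fastforce
qed

lemma observer_dynamics:
  assumes n: "n \<le> N"
  shows "continuous_on {0<..} (deriv (wh n))"
    and "t > 0 \<Longrightarrow> (wh n has_real_derivative deriv (wh n) t) (at t)"
    and "t > 0 \<Longrightarrow> deriv (wh n) t = - lam n * wh n t - bcoef n * fb t
      + obs_gain N0 L0 n * (\<Sum>j\<le>N. ccoef xs j * err j t) + obs_gain N0 L0 n * zeta t + mode (ghat t) n"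
proof -
  have "wh n C1_differentiable_on {0<..}"
    using sol n unfolding closed_loop_solution_def Let_def by blast
  note C1_deriv[OF this]
  then show "continuous_on {0<..} (deriv (wh n))" "t > 0 \<Longrightarrow> (wh n has_real_derivative deriv (wh n) t) (at t)"
    by blast+
  assume t: "t > 0"
  have *: "(wh n has_real_derivative - lam n * wh n t
      + l2_inner (\<lambda>x. g t x (observer N wh t x + psi x * u t)) (phi n) + bcoef n * control N0 K0 u wh t
      - obs_gain N0 L0 n * (observer N wh t xs + psi xs * u t - measurement xs u w t)) (at t)"
    using sol t n unfolding closed_loop_solution_def Let_def by blast
  \<comment> \<open>\<open>\<psi>(x\<^sub>*) u\<close> cancels in the output error\<close>
  have meas: "observer N wh t xs + psi xs * u t - measurement xs u w t
      = - ((\<Sum>j\<le>N. ccoef xs j * err j t) + zeta t)"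
    by (simp add: measurement_def observer_def zeta_def err_def ccoef_def algebra_simps sum_subtractf)
  show "deriv (wh n) t = - lam n * wh n t - bcoef n * fb t
      + obs_gain N0 L0 n * (\<Sum>j\<le>N. ccoef xs j * err j t) + obs_gain N0 L0 n * zeta t + mode (ghat t) n"
    using DERIV_imp_deriv[OF *] unfolding meas control_eq[OF K0] fb_def ghat_def [abs_def]
    by (simp add: algebra_simps)
qed

lemma mode_continuous: "continuous_on {0..} (\<lambda>t. mode (w t) n)"
  by (rule l2_continuous_inner[OF solution_continuous(3) phi_L2])

text \<open>The equation is paired with \<open>\<phi>\<^sub>n\<close>: by the Neumann conditions \<open>w\<^sub>x\<^sub>x\<close> contributes \<open>- \<lambda>\<^sub>n w\<^sub>n\<close>, and \<open>- \<psi> v\<close> contributes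
  \<open>b\<^sub>n v\<close>.\<close>

lemma mode_dynamics:
  "continuous_on {0<..} (deriv (\<lambda>t. mode (w t) n))"
  "t > 0 \<Longrightarrow> ((\<lambda>t. mode (w t) n) has_real_derivative deriv (\<lambda>t. mode (w t) n) t) (at t)"
  "t > 0 \<Longrightarrow> deriv (\<lambda>t. mode (w t) n) t = - lam n * mode (w t) n + mode (gtrue t) n - bcoef n * fb t"
proof -
  have "\<exists>wt. l2_continuous_on {0<..} wt \<and>
         (\<forall>t>0. l2_has_derivative w (wt t) t \<and>
            (\<exists>wx wxx. has_H1_deriv (w t) wx \<and> has_H1_deriv wx wxx \<and> wx 0 = 0 \<and> wx 1 = 0 \<and>
               (AE x in lborel. x \<in> {0<..<1} \<longrightarrow>
                  wt t x = wxx x + g t x (w t x + psi x * u t) - psi x * control N0 K0 u wh t)))"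
    using sol unfolding closed_loop_solution_def Let_def by blast
  then obtain wt where wt1: "l2_continuous_on {0<..} wt"
    and wt2: "\<forall>t>0. l2_has_derivative w (wt t) t \<and>
            (\<exists>wx wxx. has_H1_deriv (w t) wx \<and> has_H1_deriv wx wxx \<and> wx 0 = 0 \<and> wx 1 = 0 \<and>
               (AE x in lborel. x \<in> {0<..<1} \<longrightarrow>
                  wt t x = wxx x + g t x (w t x + psi x * u t) - psi x * control N0 K0 u wh t))"
    by (elim exE conjE) (rule that)
  note wt = wt1 wt2[rule_format, THEN conjunct1]
  have pde: "\<exists>wx wxx. neumann (w t) wx wxx \<and>
               (AE x in lborel. x \<in> {0<..<1} \<longrightarrow> wt t x = wxx x + gtrue t x - psi x * control N0 K0 u wh t)" if "t > 0" for t
    using wt2[rule_format, OF that, THEN conjunct2] unfolding neumann_def gtrue_def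
    by (elim exE conjE) (intro exI conjI)
  have wtL: "wt t \<in> L2" if "t > 0" for t
    using wt(1) that unfolding l2_continuous_on_def by auto
  have wL: "w t \<in> L2" if "t \<ge> 0" for t
    using solution_continuous(3) that unfolding l2_continuous_on_def by auto
  have der: "((\<lambda>t. mode (w t) n) has_real_derivative mode (wt t) n) (at t)" if "t > 0" for t
    by (rule l2_derivative_inner[OF wt(2)[OF that] wtL[OF that] phi_L2, of "{0<..}"])
      (use that wL in auto)
  then have eq: "deriv (\<lambda>t. mode (w t) n) t = mode (wt t) n" if "t > 0" for t
    using that by (intro DERIV_imp_deriv)
  have "continuous_on {0<..} (\<lambda>t. mode (wt t) n)"
    by (rule l2_continuous_inner[OF wt(1) phi_L2])
  then show "continuous_on {0<..} (deriv (\<lambda>t. mode (w t) n))"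
    by (rule continuous_on_eq) (simp add: eq)
  show "t > 0 \<Longrightarrow> ((\<lambda>t. mode (w t) n) has_real_derivative deriv (\<lambda>t. mode (w t) n) t) (at t)"
    using der eq by simp
  show "deriv (\<lambda>t. mode (w t) n) t = - lam n * mode (w t) n + mode (gtrue t) n - bcoef n * fb t"
    if t: "t > 0"
  proof -
    obtain wx wxx where n: "neumann (w t) wx wxx"
      and ae: "AE x in lborel. x \<in> {0<..<1} \<longrightarrow> wt t x = wxx x + gtrue t x - psi x * control N0 K0 u wh t"
      using pde[OF t] by blast
    note L = neumann_L2(3)[OF n] gtrue_L2[OF t]
    have pL: "(\<lambda>x. psi x * control N0 K0 u wh t) \<in> L2"
      using L2_scale[OF psi_L2, of "control N0 K0 u wh t"] by (simp add: mult.commute)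
    have "mode (wt t) n = mode (\<lambda>x. wxx x + gtrue t x - psi x * control N0 K0 u wh t) n"
      by (intro l2_inner_cong_AE AE_unit_meas[OF ae] wtL[OF t] L2_diff L2_add L pL phi_L2)
    also have "\<dots> = mode wxx n + mode (gtrue t) n - mode (\<lambda>x. psi x * control N0 K0 u wh t) n"
      unfolding l2_inner_diff_left[OF L2_add[OF L] pL phi_L2] l2_inner_add_left[OF L phi_L2] ..
    also have "mode (\<lambda>x. psi x * control N0 K0 u wh t) n = control N0 K0 u wh t * mode psi n"
      using l2_inner_scale_left[of "control N0 K0 u wh t" psi] by (simp add: mult.commute)
    finally show ?thesis
      unfolding eq[OF t] neumann_mode[OF n] mode_psi control_eq[OF K0] fb_def by (simp add: mult.commute)
  qed
qed

end

section \<open>Exponential decay\<close>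

lemma neumann_phi_comb:
  "neumann (\<lambda>x. \<Sum>n\<le>N. a n * phi n x) (\<lambda>x. \<Sum>n\<le>N. a n * dphi n x) (\<lambda>x. \<Sum>n\<le>N. a n * (- lam n * phi n x))"
  unfolding neumann_def
  by (intro conjI has_H1_deriv_sum has_H1_deriv_phi has_H1_deriv_dphi) (simp_all add: dphi_ends)

lemma h1_norm_sq: "has_H1_deriv f f' \<Longrightarrow> (h1_norm f)\<^sup>2 = l2_inner f f + l2_inner f' f'"
  by (simp add: h1_norm_eq l2_norm_sq l2_inner_self_nonneg)

lemma phi_comb_h1_norm: "(h1_norm (\<lambda>x. \<Sum>n\<le>N. a n * phi n x))\<^sup>2 = (\<Sum>n\<le>N. (1 + lam n) * (a n)\<^sup>2)"
proof -
  let ?f = "\<lambda>x. \<Sum>n\<le>N. a n * phi n x" and ?f' = "\<lambda>x. \<Sum>n\<le>N. a n * dphi n x"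
  note n = neumann_phi_comb[where N = N and a = a]
  have d: "has_H1_deriv ?f ?f'" using n unfolding neumann_def by blast
  have "l2_inner ?f' ?f' = - l2_inner (\<lambda>x. \<Sum>n\<le>N. a n * (- lam n * phi n x)) ?f"
    using neumann_by_parts[OF n d] by simp
  also have "(\<lambda>x. \<Sum>n\<le>N. a n * (- lam n * phi n x)) = (\<lambda>x. \<Sum>n\<le>N. (- lam n * a n) * phi n x)"
    by (simp add: mult_ac)
  also have "- l2_inner (\<lambda>x. \<Sum>n\<le>N. (- lam n * a n) * phi n x) ?f = (\<Sum>n\<le>N. lam n * (a n)\<^sup>2)"
    unfolding orthonormal_inner_comb[OF phi_orthonormal orthonormal_comb_L2[OF phi_orthonormal]]
      orthonormal_comb_inner[OF phi_orthonormal]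
    by (simp add: sum_negf power2_eq_square mult_ac)
  finally have "l2_inner ?f' ?f' = (\<Sum>n\<le>N. lam n * (a n)\<^sup>2)" .
  then show ?thesis
    unfolding h1_norm_sq[OF d] orthonormal_comb_norm[OF phi_orthonormal]
    by (simp add: distrib_right sum.distrib)
qed

context closed_loop
begin

lemma fb_continuous: "continuous_on {0..} fb"
proof -
  have "continuous_on {0..} (\<lambda>t. case_nat (u t) (\<lambda>n. wh n t) i)" if "i < N0 + 2" for i
    using that N solution_continuous(1,2) by (cases i) auto
  then have "continuous_on {0..} (\<lambda>t. \<Sum>i<N0 + 2. K0 $$ (0, i) * case_nat (u t) (\<lambda>n. wh n t) i)"
    by (intro continuous_on_sum continuous_on_mult continuous_on_const) auto
  then show ?thesis unfolding fb_def [abs_def] feedback_def .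
qed

lemma mode_initial: "mode (w 0) n = mode w0 n"
  by (rule l2_inner_cong) (auto simp: solution_initial)

definition "state t = state_vec N0 N (u t) (\<lambda>n. wh n t) (\<lambda>n. err n t)"

lemma state_carrier: "state t \<in> carrier_vec (2 * N + 3)"
  unfolding state_def by (rule state_vec_carrier[OF N])

lemma state_continuous:
  assumes "i < 2 * N + 3"
  shows "continuous_on {0..} (\<lambda>t. state t $ i)"
  using state_vec_component[OF N assms]
  by cases (auto simp: state_def err_def intro!: continuous_on_diff mode_continuous solution_continuous)

definition "mode_deriv n = deriv (\<lambda>t. mode (w t) n)"

definition "state_deriv t =
  state_vec N0 N (deriv u t) (\<lambda>n. deriv (wh n) t) (\<lambda>n. mode_deriv n t - deriv (wh n) t)"

lemma state_deriv_carrier: "state_deriv t \<in> carrier_vec (2 * N + 3)"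
  unfolding state_deriv_def by (rule state_vec_carrier[OF N])

lemma state_deriv_continuous:
  assumes "i < 2 * N + 3"
  shows "continuous_on {0<..} (\<lambda>t. state_deriv t $ i)"
  using state_vec_component[OF N assms]
  by cases (auto simp: state_deriv_def mode_deriv_def
      intro!: continuous_on_diff u_dynamics(1) observer_dynamics(1) mode_dynamics(1))

lemma DERIV_state:
  assumes "i < 2 * N + 3" "t > 0"
  shows "((\<lambda>t. state t $ i) has_real_derivative state_deriv t $ i) (at t)"
  using state_vec_component[OF N assms(1)]
  by cases (auto simp: state_deriv_def state_def err_def mode_deriv_def assms(2)
      intro!: DERIV_diff u_dynamics(2) observer_dynamics(2) mode_dynamics(2))

text \<open>The matrices \<open>F\<^sub>X\<close> and \<open>L\<^sub>\<zeta>\<close> are made for this equation.  The nonlinearity enters through two vectors, one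
  in the observer modes and one in the errors; they are the arguments of the last two block columns of \<open>\<Psi>\<^sub>0\<close>.\<close>

lemma state_dynamics:
  assumes t: "t > 0"
  shows "state_deriv t = FX N0 N xs L0 K0 *\<^sub>v state t + (Lzeta N0 N L0 *\<^sub>v vec 1 (\<lambda>_. zeta t)
      + (state_vec N0 N 0 (mode (ghat t)) (\<lambda>_. 0)
        + state_vec N0 N 0 (\<lambda>_. 0) (\<lambda>n. mode (gtrue t) n - mode (ghat t) n)))"
  unfolding state_def state_deriv_def FX_mult_state[OF L0 K0 N] Lzeta_mult_vec[OF L0 K0 N]
    state_vec_add fb_def[symmetric]
proof (rule state_vec_cong[OF N])
  fix n assume n: "n \<le> N"
  show "mode_deriv n t - deriv (wh n) t = - lam n * err n t
      - obs_gain N0 L0 n * (\<Sum>j\<le>N. ccoef xs j * err j t)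
      + (- (obs_gain N0 L0 n * zeta t) + (0 + (mode (gtrue t) n - mode (ghat t) n)))"
    unfolding mode_deriv_def mode_dynamics(3)[OF t] observer_dynamics(3)[OF n t]
    by (simp add: err_def algebra_simps)
qed (simp_all add: u_dynamics(3)[OF t] observer_dynamics(3)[OF _ t])

end

locale lyapunov_loop = closed_loop +
  fixes \<delta> \<sigma> \<Gamma> \<alpha>1 \<alpha>2 \<alpha>3 :: real and PX :: "real mat"
  assumes N1: "N \<ge> 1"
    and PX: "PX \<in> carrier_mat (2 * N + 3) (2 * N + 3)" "PX\<^sup>T = PX"
    and pos: "\<alpha>1 > 0" "\<alpha>2 > 0" "\<alpha>3 > 0" "\<Gamma> > 0" "\<delta> > 0" "\<sigma> > 0"
    and xs: "xs \<in> {0..1}"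
    and neg: "neg_def (6 * N + 10) (Psi0 \<delta> \<sigma> \<Gamma> xs N0 N L0 K0 PX \<alpha>1 \<alpha>2 \<alpha>3)"
    and g0: "\<And>t x. g t x 0 = 0"
    and gl: "\<And>t x z z'. \<bar>g t x z - g t x z'\<bar> \<le> \<sigma> * \<bar>z - z'\<bar>"
begin

lemma gtrue_bound:
  assumes t: "t > 0"
  shows "l2_inner (gtrue t) (gtrue t) \<le> \<sigma>\<^sup>2 * (2 * (l2_norm (w t))\<^sup>2 + 2 * ((u t)\<^sup>2 * (2 / pi\<^sup>2)))"
proof -
  have wL: "w t \<in> L2" using continuous_on_w[OF t] by (rule L2_continuous)
  have pL: "(\<lambda>x. u t * psi x) \<in> L2" by (intro L2_scale psi_L2)
  have "\<bar>gtrue t x\<bar> \<le> \<bar>\<sigma> * (w t x + u t * psi x)\<bar>" for x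
    using gl[of t x "w t x + psi x * u t" 0] pos(6) by (simp add: gtrue_def g0 abs_mult mult.commute)
  then have "l2_inner (gtrue t) (gtrue t) \<le> l2_inner (\<lambda>x. \<sigma> * (w t x + u t * psi x)) (\<lambda>x. \<sigma> * (w t x + u t * psi x))"
    by (intro l2_inner_mono gtrue_L2 t L2_scale[OF L2_add] wL pL)
  also have "\<dots> = \<sigma>\<^sup>2 * l2_inner (\<lambda>x. w t x + u t * psi x) (\<lambda>x. w t x + u t * psi x)"
    by (rule l2_inner_scale_self)
  also have "\<dots> \<le> \<sigma>\<^sup>2 * (2 * (l2_norm (w t))\<^sup>2 + 2 * ((u t)\<^sup>2 * (2 / pi\<^sup>2)))"
    using l2_inner_self_add_le[OF wL pL] unfolding l2_inner_scale_self psi_norm l2_norm_sq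
    by (intro mult_left_mono) auto
  finally show ?thesis .
qed

text \<open>By \<open>-2 \<lambda>\<^sup>2 w\<^sup>2 + 2 \<lambda> w f \<le> f\<^sup>2/2\<close> in every mode, the partial sums of \<open>\<Sum> \<lambda>\<^sub>n w\<^sub>n\<^sup>2\<close> grow at most at half the rate of the
  forcing, which is bounded.  They start from \<open>w(\<cdot>,0)\<close> in \<open>H\<^sup>1\<close>, so the bound is uniform down to the initial
  time, where the solution is only known to be continuous in the mean.\<close>

lemma energy_bounded:
  assumes w0: "has_H1_deriv w0 w0'" and T: "T > 0"
  obtains C where "\<And>t f' f''. t \<in> {0<..<T} \<Longrightarrow> neumann (w t) f' f'' \<Longrightarrow> l2_inner f' f' \<le> C"
proof -
  define B where "B t = \<sigma>\<^sup>2 * (2 * (l2_norm (w t))\<^sup>2 + 2 * ((u t)\<^sup>2 * (2 / pi\<^sup>2))) + (fb t)\<^sup>2 * (2 / pi\<^sup>2)" for t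
  have cB: "continuous_on {0..T} B"
    unfolding B_def using solution_continuous fb_continuous l2_continuous_norm
    by (intro continuous_intros continuous_on_subset[of "{0..}" _ "{0..T}"]) auto
  obtain s0 where "\<forall>t\<in>{0..T}. B t \<le> B s0"
    using continuous_attains_sup[OF compact_Icc _ cB] T by auto
  then obtain C where C: "\<And>t. t \<in> {0..T} \<Longrightarrow> B t \<le> C" by blast
  note Dm = mode_dynamics(2,3)[folded mode_deriv_def]
  have finite: "(\<Sum>n\<le>M. lam n * (mode (w t) n)\<^sup>2) \<le> l2_inner w0' w0' + C * T" if t: "t \<in> {0<..<T}" for t M
  proof -
    let ?h = "\<lambda>s. (\<Sum>n\<le>M. lam n * (mode (w s) n)\<^sup>2) - C * s"
    have "?h 0 \<ge> ?h t"
    proof (rule DERIV_nonpos_imp_decreasing_open[where f = ?h])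
      fix s assume "0 < s" "s < t"
      then have s: "s > 0" "s \<in> {0..T}" using t by auto
      define f where "f x = gtrue s x + fb s * psi x" for x
      have pL: "(\<lambda>x. fb s * psi x) \<in> L2" by (intro L2_scale psi_L2)
      have fL: "f \<in> L2" unfolding f_def [abs_def] by (intro L2_add gtrue_L2 s pL)
      have m: "mode f n = mode (gtrue s) n - bcoef n * fb s" for n
        unfolding f_def [abs_def] l2_inner_add_left[OF gtrue_L2[OF s(1)] pL phi_L2] l2_inner_scale_left mode_psi
        by simp
      have "(\<Sum>n\<le>M. (mode f n)\<^sup>2) \<le> l2_inner f f"
        by (rule Bessel_inequality[OF phi_orthonormal fL])
      also have "\<dots> \<le> 2 * l2_inner (gtrue s) (gtrue s) + 2 * ((fb s)\<^sup>2 * (2 / pi\<^sup>2))"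
        using l2_inner_self_add_le[OF gtrue_L2[OF s(1)] pL]
        unfolding l2_inner_scale_self psi_norm f_def [abs_def] .
      also have "\<dots> \<le> 2 * C"
        using gtrue_bound[OF s(1)] C[OF s(2)] unfolding B_def by linarith
      finally have fC: "(\<Sum>n\<le>M. (mode f n)\<^sup>2) \<le> 2 * C" .
      have "lam n * (2 * mode (w s) n * mode_deriv n s) \<le> (mode f n)\<^sup>2 / 2" for n
      proof -
        have "0 \<le> (2 * (lam n * mode (w s) n) - mode f n)\<^sup>2" by simp
        moreover have "lam n * (2 * mode (w s) n * mode_deriv n s) = 2 * (lam n * mode (w s) n) * mode f n - 2 * (lam n * mode (w s) n)\<^sup>2"
          unfolding Dm(2)[OF s(1)] m by (simp add: power2_eq_square algebra_simps)
        ultimately show ?thesis by (simp add: power2_eq_square algebra_simps)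
      qed
      then have "(\<Sum>n\<le>M. lam n * (2 * mode (w s) n * mode_deriv n s)) \<le> (\<Sum>n\<le>M. (mode f n)\<^sup>2 / 2)"
        by (intro sum_mono)
      then have "(\<Sum>n\<le>M. lam n * (2 * mode (w s) n * mode_deriv n s)) - C \<le> 0"
        using fC by (simp add: sum_divide_distrib[symmetric])
      moreover have d: "((\<lambda>s. lam n * (mode (w s) n)\<^sup>2) has_real_derivative lam n * (2 * mode (w s) n * mode_deriv n s)) (at s)" for n
        using Dm(1)[OF s(1), of n] by (auto intro!: derivative_eq_intros)
      then have "(?h has_real_derivative (\<Sum>n\<le>M. lam n * (2 * mode (w s) n * mode_deriv n s)) - C * 1) (at s)"
        by (intro DERIV_diff DERIV_sum d DERIV_cmult[OF DERIV_ident])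
      ultimately show "\<exists>y. (?h has_real_derivative y) (at s) \<and> y \<le> 0" by auto
    next
      show "continuous_on {0..t} ?h"
        using mode_continuous by (intro continuous_intros continuous_on_subset[of "{0..}" _ "{0..t}"]) auto
    qed (use t in auto)
    moreover have "(\<Sum>n\<le>M. lam n * (mode (w 0) n)\<^sup>2) \<le> l2_inner w0' w0'"
      unfolding mode_initial by (rule H1_Bessel[OF w0])
    moreover have "C * t \<le> C * T"
    proof (rule mult_left_mono)
      have "0 \<le> B 0" unfolding B_def by simp
      then show "0 \<le> C" using C[of 0] T by simp
    qed (use t in auto)
    ultimately show ?thesis by simp
  qed
  show ?thesis
  proof (rule that)
    fix t f' f'' assume t: "t \<in> {0<..<T}" and n: "neumann (w t) f' f''"
    show "l2_inner f' f' \<le> l2_inner w0' w0' + C * T"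
      by (rule LIMSEQ_le_const2[OF neumann_Parseval_deriv[OF n]]) (use finite[OF t] in auto)
  qed
qed

definition "V M t = state t \<bullet> (PX *\<^sub>v state t) + (\<Sum>n\<in>{N<..M}. lam n * (mode (w t) n)\<^sup>2)"

text \<open>A truncated functional consists of finitely many modes, hence it is continuous from the initial time
  on and continuously differentiable for positive times, whereas no regularity in time of \<open>\<parallel>w\<^sub>x\<parallel>\<close> is known.
  Truncation costs an excess in the differential inequality; it vanishes as the cutoff grows, at each
  time by Parseval's identity, and with a bound by \<open>energy_bounded\<close>.\<close>

lemma truncated_decay:
  assumes w0: "has_H1_deriv w0 w0'" and T: "T > 0" and e: "e > 0"
  shows "\<forall>\<^sub>F M in sequentially. exp (2 * \<delta> * T) * V (N + M) T \<le> V (N + M) 0 + e"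
proof -
  \<comment> \<open>one version of \<open>w\<^sub>x\<close> for each time, so that the excess is a function of \<open>t\<close>\<close>
  define wx where "wx t = (SOME f'. \<exists>f''. neumann (w t) f' f'')" for t
  have wx: "\<exists>f''. neumann (w t) (wx t) f''" if t: "t > 0" for t
  proof -
    obtain f' f'' where "neumann (w t) f' f''" by (rule solution_neumann[OF t])
    then have "\<exists>f' f''. neumann (w t) f' f''" by blast
    then show ?thesis unfolding wx_def by (rule someI_ex)
  qed
  let ?rho = "rho \<delta> \<sigma> \<Gamma> \<alpha>1 \<alpha>2 \<alpha>3 N"
  define a where "a M t = l2_inner (w t) (w t) - (\<Sum>n\<le>M. (mode (w t) n)\<^sup>2)" for M t
  define b where "b M t = l2_inner (wx t) (wx t) - (\<Sum>n\<le>M. lam n * (mode (w t) n)\<^sup>2)" for M t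
  define R where "R M t = \<alpha>2 * \<sigma>\<^sup>2 * a M t - 2 * ?rho * ((1 + \<Gamma>) * a M t + inverse \<Gamma> * b M t)" for M t
  define V' where "V' M t = 2 * (state t \<bullet> (PX *\<^sub>v state_deriv t)) + (\<Sum>n\<in>{N<..M}. lam n * (2 * mode (w t) n * mode_deriv n t))" for M t
  have rho: "?rho < 0" by (rule rho_neg[OF L0 K0 N N1 PX pos xs neg])
  have ineq: "V' M t + 2 * \<delta> * V M t \<le> R M t" if t: "t > 0" and M: "N \<le> M" for M t
  proof -
    obtain f'' where n: "neumann (w t) (wx t) f''" using wx[OF t] by blast
    have hb: "\<bar>ghat t x\<bar> \<le> \<sigma> * \<bar>(\<Sum>n\<le>N. wh n t * phi n x) + psi x * u t\<bar>" for x
      using gl[of t x "observer N wh t x + psi x * u t" 0] by (simp add: ghat_def g0 observer_def)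
    have db: "\<bar>gtrue t x - ghat t x\<bar> \<le> \<sigma> * \<bar>w t x - (\<Sum>n\<le>N. wh n t * phi n x)\<bar>" for x
      using gl[of t x "w t x + psi x * u t" "observer N wh t x + psi x * u t"]
      by (simp add: ghat_def gtrue_def observer_def)
    have "V' M t + 2 * \<delta> * V M t = 2 * (state t \<bullet> (PX *\<^sub>v state_deriv t))
      + (\<Sum>n\<in>{N<..M}. 2 * lam n * mode (w t) n * (- lam n * mode (w t) n + mode (gtrue t) n - bcoef n * fb t))
      + 2 * \<delta> * (state t \<bullet> (PX *\<^sub>v state t) + (\<Sum>n\<in>{N<..M}. lam n * (mode (w t) n)\<^sup>2))"
      unfolding V'_def V_def mode_deriv_def mode_dynamics(3)[OF t] by (simp add: mult_ac)
    also have "\<dots> \<le> R M t"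
      using lyapunov_pointwise[OF L0 K0 N N1 PX pos xs neg n gtrue_L2[OF t] ghat_L2 hb db M]
      unfolding R_def a_def b_def state_dynamics[OF t] state_def err_def fb_def zeta_def by simp
    finally show ?thesis .
  qed
  have dV: "(V M has_real_derivative V' M t) (at t)" if t: "t > 0" for M t
  proof -
    have "((\<lambda>s. lam n * (mode (w s) n)\<^sup>2) has_real_derivative lam n * (2 * mode (w t) n * mode_deriv n t)) (at t)" for n
      using mode_dynamics(2)[OF t, of n, folded mode_deriv_def] by (auto intro!: derivative_eq_intros)
    then show ?thesis
      unfolding V_def [abs_def] V'_def
      by (intro DERIV_add DERIV_sum DERIV_quadratic_form[OF PX state_carrier state_deriv_carrier] DERIV_state t)
  qed
  have cV: "continuous_on {0..} (V M)" for M
    unfolding V_def [abs_def] quadratic_form_sum[OF PX(1) state_carrier state_carrier]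
    by (intro continuous_intros mode_continuous state_continuous) auto
  have cV': "continuous_on {0<..} (V' M)" for M
  proof -
    have "continuous_on {0<..} (\<lambda>t. state t $ i)" if "i < 2 * N + 3" for i
      by (rule continuous_on_subset[OF state_continuous[OF that]]) auto
    moreover have "continuous_on {0<..} (\<lambda>t. mode (w t) n)" for n
      by (rule continuous_on_subset[OF mode_continuous]) auto
    ultimately show ?thesis
      unfolding V'_def [abs_def] quadratic_form_sum[OF PX(1) state_carrier state_deriv_carrier]
      by (intro continuous_intros state_deriv_continuous mode_dynamics(1)[folded mode_deriv_def]) auto
  qed
  have a_lim: "(\<lambda>M. a (N + M) t) \<longlonglongrightarrow> 0" and b_lim: "(\<lambda>M. b (N + M) t) \<longlonglongrightarrow> 0" if t: "t > 0" for t
  proof -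
    obtain f'' where n: "neumann (w t) (wx t) f''" using wx[OF t] by blast
    have "(\<lambda>M. a M t) \<longlonglongrightarrow> l2_inner (w t) (w t) - l2_inner (w t) (w t)"
      unfolding a_def by (intro tendsto_diff tendsto_const Parseval continuous_on_w t)
    then have "(\<lambda>M. a M t) \<longlonglongrightarrow> 0" by simp
    then show "(\<lambda>M. a (N + M) t) \<longlonglongrightarrow> 0"
      using LIMSEQ_ignore_initial_segment[of _ _ N] by (simp add: add.commute)
    have "(\<lambda>M. b M t) \<longlonglongrightarrow> l2_inner (wx t) (wx t) - l2_inner (wx t) (wx t)"
      unfolding b_def by (intro tendsto_diff tendsto_const neumann_Parseval_deriv[OF n])
    then have "(\<lambda>M. b M t) \<longlonglongrightarrow> 0" by simp
    then show "(\<lambda>M. b (N + M) t) \<longlonglongrightarrow> 0"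
      using LIMSEQ_ignore_initial_segment[of _ _ N] by (simp add: add.commute)
  qed
  obtain C where C: "\<And>t f' f''. t \<in> {0<..<T} \<Longrightarrow> neumann (w t) f' f'' \<Longrightarrow> l2_inner f' f' \<le> C"
  proof (rule energy_bounded[OF w0 T])
    fix C assume "\<And>t f' f''. t \<in> {0<..<T} \<Longrightarrow> neumann (w t) f' f'' \<Longrightarrow> l2_inner f' f' \<le> C"
    then show thesis by (rule that)
  qed
  have cw: "continuous_on {0..T} (\<lambda>t. (l2_norm (w t))\<^sup>2)"
    using l2_continuous_norm[OF solution_continuous(3)]
    by (intro continuous_intros continuous_on_subset[of "{0..}" _ "{0..T}"]) auto
  obtain s0 where "\<forall>t\<in>{0..T}. (l2_norm (w t))\<^sup>2 \<le> (l2_norm (w s0))\<^sup>2"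
    using continuous_attains_sup[OF compact_Icc _ cw] T by auto
  then obtain Cw where Cw: "\<And>t. t \<in> {0..T} \<Longrightarrow> (l2_norm (w t))\<^sup>2 \<le> Cw" by blast
  \<comment> \<open>the maximum with \<open>0\<close> makes the bound \<open>exp (2 * \<delta> * s) * Rmax\<close> increase with \<open>s\<close>\<close>
  define Rmax where "Rmax = max 0 (\<alpha>2 * \<sigma>\<^sup>2 * Cw - 2 * ?rho * ((1 + \<Gamma>) * Cw + inverse \<Gamma> * C))"
  have Rmax: "R M t \<le> Rmax" if t: "t \<in> {0<..<T}" for M t
  proof -
    obtain f'' where n: "neumann (w t) (wx t) f''" using wx[of t] t by auto
    have "0 \<le> (\<Sum>n\<le>M. (mode (w t) n)\<^sup>2)" "0 \<le> (\<Sum>n\<le>M. lam n * (mode (w t) n)\<^sup>2)"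
      by (intro sum_nonneg mult_nonneg_nonneg lam_nonneg zero_le_power2)+
    then have ab: "a M t \<le> Cw" "b M t \<le> C"
      using C[OF t n] Cw[of t] t unfolding a_def b_def l2_norm_sq by auto
    have "(1 + \<Gamma>) * a M t + inverse \<Gamma> * b M t \<le> (1 + \<Gamma>) * Cw + inverse \<Gamma> * C"
      using ab pos by (intro add_mono mult_left_mono) auto
    then have "- 2 * ?rho * ((1 + \<Gamma>) * a M t + inverse \<Gamma> * b M t) \<le> - 2 * ?rho * ((1 + \<Gamma>) * Cw + inverse \<Gamma> * C)"
      using rho by (intro mult_left_mono) auto
    moreover have "\<alpha>2 * \<sigma>\<^sup>2 * a M t \<le> \<alpha>2 * \<sigma>\<^sup>2 * Cw" using ab pos by (intro mult_left_mono) auto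
    ultimately show ?thesis unfolding R_def Rmax_def by simp
  qed
  have "\<forall>\<^sub>F M in sequentially. exp (2 * \<delta> * T) * V (N + M) T \<le> exp (2 * \<delta> * 0) * V (N + M) 0 + e"
  proof (rule vanishing_excess_comparison[where h = "\<lambda>M t. exp (2 * \<delta> * t) * V (N + M) t"
        and h' = "\<lambda>M t. exp (2 * \<delta> * t) * (V' (N + M) t + 2 * \<delta> * V (N + M) t)"
        and R = "\<lambda>M t. exp (2 * \<delta> * t) * R (N + M) t" and K = "exp (2 * \<delta> * T) * Rmax"])
    show "continuous_on {0..T} (\<lambda>t. exp (2 * \<delta> * t) * V (N + M) t)" for M
      using continuous_on_subset[OF cV] by (intro continuous_intros) auto
    show "((\<lambda>t. exp (2 * \<delta> * t) * V (N + M) t) has_real_derivative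
        exp (2 * \<delta> * s) * (V' (N + M) s + 2 * \<delta> * V (N + M) s)) (at s)" if "s \<in> {0<..<T}" for M s
      using that dV[of s "N + M"] by (auto intro!: derivative_eq_intros simp: algebra_simps)
    show "continuous_on {0<..<T} (\<lambda>t. exp (2 * \<delta> * t) * (V' (N + M) t + 2 * \<delta> * V (N + M) t))" for M
      by (intro continuous_intros continuous_on_subset[OF cV] continuous_on_subset[OF cV']) auto
    show "exp (2 * \<delta> * s) * (V' (N + M) s + 2 * \<delta> * V (N + M) s) \<le> exp (2 * \<delta> * s) * R (N + M) s"
      if "s \<in> {0<..<T}" for M s
      using ineq[of s "N + M"] that by (intro mult_left_mono) auto
    show "exp (2 * \<delta> * s) * R (N + M) s \<le> exp (2 * \<delta> * T) * Rmax" if s: "s \<in> {0<..<T}" for M s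
    proof -
      have "exp (2 * \<delta> * s) * R (N + M) s \<le> exp (2 * \<delta> * s) * Rmax"
        using Rmax[OF s] by (intro mult_left_mono) auto
      also have "\<dots> \<le> exp (2 * \<delta> * T) * Rmax"
        using s pos(5) by (intro mult_right_mono) (auto simp: Rmax_def)
      finally show ?thesis .
    qed
    show "(\<lambda>M. exp (2 * \<delta> * s) * R (N + M) s) \<longlonglongrightarrow> 0" if "s \<in> {0<..<T}" for s
    proof -
      have "(\<lambda>M. exp (2 * \<delta> * s) * R (N + M) s) \<longlonglongrightarrow> exp (2 * \<delta> * s)
          * (\<alpha>2 * \<sigma>\<^sup>2 * 0 - 2 * ?rho * ((1 + \<Gamma>) * 0 + inverse \<Gamma> * 0))"
        unfolding R_def using that by (intro tendsto_intros a_lim b_lim) auto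
      then show ?thesis by simp
    qed
  qed (use T e in auto)
  then show ?thesis by simp
qed

text \<open>The cutoff tends to infinity in \<open>truncated_decay\<close>.  At positive times the modes up to \<open>N\<close> are bounded by the
  state: if \<open>a\<close> and \<open>e\<close> are an observer mode and its error, then \<open>(a + e)\<^sup>2 + a\<^sup>2 \<le> 3 (a\<^sup>2 + e\<^sup>2)\<close>, which together with
  \<open>1 + \<lambda>\<^sub>n \<le> 1 + \<lambda>\<^sub>N\<close> gives the constant.  Beyond \<open>N\<close> the energy dominates the mean square.  The initial value of the
  functional is bounded by the \<open>H\<^sup>1\<close> norm, by Bessel's inequality for cosines and sines.  The initial time is a case of
  its own because Neumann conditions are imposed for positive times.\<close>

lemma exponential_decay:
  assumes w0: "has_H1_deriv w0 w0'"
    and c: "c > 0" "\<And>x. x \<in> carrier_vec (2 * N + 3) \<Longrightarrow> c * (x \<bullet> x) \<le> x \<bullet> (PX *\<^sub>v x)"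
    and C: "C \<ge> 0" "\<And>x. x \<in> carrier_vec (2 * N + 3) \<Longrightarrow> x \<bullet> (PX *\<^sub>v x) \<le> C * (x \<bullet> x)"
    and t: "t \<ge> 0"
  shows "(u t)\<^sup>2 + (h1_norm (w t))\<^sup>2 + (h1_norm (observer N wh t))\<^sup>2
    \<le> max 1 ((3 * (1 + lam N) / c + 2) * (C + 1)) * exp (- 2 * \<delta> * t) * (h1_norm w0)\<^sup>2"
proof -
  have obs: "(h1_norm (observer N wh t))\<^sup>2 = (\<Sum>n\<le>N. (1 + lam n) * (wh n t)\<^sup>2)" for t
    using phi_comb_h1_norm[where N = N and a = "\<lambda>n. wh n t"] unfolding observer_def [abs_def] .
  note h1 = h1_norm_sq
  let ?K = "(3 * (1 + lam N) / c + 2) * (C + 1)"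
  show ?thesis
  proof (cases "t = 0")
    case True
    have d: "has_H1_deriv (w 0) w0'"
      unfolding has_H1_deriv_def
    proof (intro conjI ballI)
      show "w0' \<in> L2" by (rule has_H1_derivD(1)[OF w0])
      fix x :: real assume x: "x \<in> {0..1}"
      then show "w 0 x = w 0 0 + (LINT y:{0..x}|lborel. w0' y)"
        using has_H1_derivD(2)[OF w0 x] solution_initial(3)[of x] solution_initial(3)[of 0] by simp
    qed
    have "l2_inner (w 0) (w 0) = l2_inner w0 w0"
      by (rule l2_inner_cong) (auto simp: solution_initial)
    then have "(h1_norm (w 0))\<^sup>2 = (h1_norm w0)\<^sup>2" using h1[OF d] h1[OF w0] by simp
    moreover have "(h1_norm w0)\<^sup>2 \<le> max 1 ?K * (h1_norm w0)\<^sup>2"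
      using mult_right_mono[of 1 "max 1 ?K" "(h1_norm w0)\<^sup>2"] by simp
    ultimately show ?thesis using True by (simp add: obs solution_initial)
  next
    case False
    then have t: "t > 0" using t by simp
    obtain f' f'' where n: "neumann (w t) f' f''" by (rule solution_neumann[OF t])
    then have d: "has_H1_deriv (w t) f'" unfolding neumann_def by blast
    let ?m = "mode (w t)"
    define tail where "tail = l2_inner f' f' - (\<Sum>k\<le>N. lam k * (?m k)\<^sup>2)"
    have split: "(\<Sum>k\<le>N + M. q k) - (\<Sum>k\<le>N. q k) = (\<Sum>k\<in>{N<..N + M}. q k)" for q :: "nat \<Rightarrow> real" and M
    proof -
      have "{..N + M} = {..N} \<union> {N<..N + M}" by auto
      then show ?thesis by (simp add: sum.union_disjoint ivl_disj_int)
    qed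
    have tail_lim: "(\<lambda>M. \<Sum>k\<in>{N<..N + M}. lam k * (?m k)\<^sup>2) \<longlonglongrightarrow> tail"
      unfolding split[symmetric] tail_def
      using LIMSEQ_ignore_initial_segment[OF neumann_Parseval_deriv[OF n], of N]
      by (intro tendsto_diff tendsto_const) (simp add: add.commute)
    have a_lim: "(\<lambda>M. \<Sum>k\<in>{N<..N + M}. (?m k)\<^sup>2) \<longlonglongrightarrow> l2_inner (w t) (w t) - (\<Sum>k\<le>N. (?m k)\<^sup>2)"
      unfolding split[symmetric]
      using LIMSEQ_ignore_initial_segment[OF Parseval[OF continuous_on_w[OF t]], of N]
      by (intro tendsto_diff tendsto_const) (simp add: add.commute)
    have a_le: "l2_inner (w t) (w t) - (\<Sum>k\<le>N. (?m k)\<^sup>2) \<le> tail"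
    proof (rule LIMSEQ_le[OF a_lim tail_lim], intro exI allI impI sum_mono)
      fix M k assume "k \<in> {N<..N + M}"
      then have "1 \<le> real k" using N1 by simp
      then have "1 \<le> lam k" using lam_ge[of k] by linarith
      then show "(?m k)\<^sup>2 \<le> lam k * (?m k)\<^sup>2"
        using mult_right_mono[of 1 "lam k" "(?m k)\<^sup>2"] by simp
    qed
    have tail0: "0 \<le> tail"
      by (rule LIMSEQ_le_const[OF tail_lim]) (auto intro!: sum_nonneg mult_nonneg_nonneg lam_nonneg)
    have V0: "V (N + M) 0 \<le> (C + 1) * (h1_norm w0)\<^sup>2" for M
    proof -
      have w0L: "w0 \<in> L2" by (rule H1_L2(1)[OF w0])
      have "state 0 \<bullet> state 0 = (\<Sum>k\<le>N. (mode w0 k)\<^sup>2)"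
        unfolding state_def state_vec_inner[OF N] err_def mode_initial
        by (simp add: solution_initial power2_eq_square)
      also have "\<dots> \<le> l2_inner w0 w0" by (rule Bessel_inequality[OF phi_orthonormal w0L])
      finally have "C * (state 0 \<bullet> state 0) \<le> C * (h1_norm w0)\<^sup>2"
        using C(1) unfolding h1[OF w0] by (intro mult_left_mono) (auto intro: add_increasing2 l2_inner_self_nonneg)
      moreover have "(\<Sum>k\<in>{N<..N + M}. lam k * (mode (w 0) k)\<^sup>2) \<le> (\<Sum>k\<le>N + M. lam k * (mode w0 k)\<^sup>2)"
        unfolding mode_initial by (intro sum_mono2) (auto intro: mult_nonneg_nonneg lam_nonneg)
      moreover have "\<dots> \<le> (h1_norm w0)\<^sup>2"
        using H1_Bessel[OF w0, of "N + M"] l2_inner_self_nonneg[of w0] unfolding h1[OF w0] by simp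
      ultimately show ?thesis
        using C(2)[OF state_carrier, of 0] unfolding V_def by (simp add: distrib_right)
    qed
    have main: "exp (2 * \<delta> * t) * (state t \<bullet> (PX *\<^sub>v state t) + tail) \<le> (C + 1) * (h1_norm w0)\<^sup>2"
    proof (rule field_le_epsilon)
      fix e :: real assume e: "e > 0"
      have l: "(\<lambda>M. exp (2 * \<delta> * t) * V (N + M) t) \<longlonglongrightarrow> exp (2 * \<delta> * t) * (state t \<bullet> (PX *\<^sub>v state t) + tail)"
        unfolding V_def by (intro tendsto_intros tail_lim)
      have "\<forall>\<^sub>F M in sequentially. exp (2 * \<delta> * t) * V (N + M) t \<le> (C + 1) * (h1_norm w0)\<^sup>2 + e"
        using truncated_decay[OF w0 t e] by eventually_elim (use V0 in \<open>force intro: order_trans\<close>)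
      then show "exp (2 * \<delta> * t) * (state t \<bullet> (PX *\<^sub>v state t) + tail) \<le> (C + 1) * (h1_norm w0)\<^sup>2 + e"
        by (rule tendsto_upperbound[OF l]) simp
    qed
    define X where "X = state t \<bullet> state t"
    have X: "X = (u t)\<^sup>2 + (\<Sum>k\<le>N. (wh k t)\<^sup>2) + (\<Sum>k\<le>N. (err k t)\<^sup>2)"
      unfolding X_def state_def state_vec_inner[OF N] by (simp add: power2_eq_square)
    have l: "0 \<le> lam N" by (rule lam_nonneg)
    have "(1 + lam k) * (?m k)\<^sup>2 + (1 + lam k) * (wh k t)\<^sup>2 \<le> 3 * (1 + lam N) * ((wh k t)\<^sup>2 + (err k t)\<^sup>2)"
      if "k \<le> N" for k
    proof -
      have "(?m k)\<^sup>2 \<le> 2 * (wh k t)\<^sup>2 + 2 * (err k t)\<^sup>2"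
        using sum_squares_bound[of "wh k t" "err k t"]
        by (simp add: err_def power2_eq_square algebra_simps)
      then have "(?m k)\<^sup>2 + (wh k t)\<^sup>2 \<le> 3 * ((wh k t)\<^sup>2 + (err k t)\<^sup>2)"
        using zero_le_power2[of "err k t"] unfolding distrib_left by (smt (verit))
      then have "(1 + lam k) * ((?m k)\<^sup>2 + (wh k t)\<^sup>2) \<le> (1 + lam N) * (3 * ((wh k t)\<^sup>2 + (err k t)\<^sup>2))"
        using lam_mono[OF that] lam_nonneg[of k] by (intro mult_mono) auto
      then show ?thesis by (simp add: algebra_simps)
    qed
    then have "(\<Sum>k\<le>N. (1 + lam k) * (?m k)\<^sup>2 + (1 + lam k) * (wh k t)\<^sup>2)
        \<le> (\<Sum>k\<le>N. 3 * (1 + lam N) * ((wh k t)\<^sup>2 + (err k t)\<^sup>2))"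
      by (intro sum_mono) auto
    also have "\<dots> = 3 * (1 + lam N) * ((\<Sum>k\<le>N. (wh k t)\<^sup>2) + (\<Sum>k\<le>N. (err k t)\<^sup>2))"
      by (simp only: sum_distrib_left[symmetric] sum.distrib)
    finally have modes: "(\<Sum>k\<le>N. (1 + lam k) * (?m k)\<^sup>2) + (\<Sum>k\<le>N. (1 + lam k) * (wh k t)\<^sup>2)
        \<le> 3 * (1 + lam N) * ((\<Sum>k\<le>N. (wh k t)\<^sup>2) + (\<Sum>k\<le>N. (err k t)\<^sup>2))"
      by (simp only: sum.distrib)
    have u: "(u t)\<^sup>2 \<le> 3 * (1 + lam N) * (u t)\<^sup>2"
      using mult_right_mono[of 1 "3 * (1 + lam N)" "(u t)\<^sup>2"] l by simp
    have sumsplit: "(\<Sum>k\<le>N. (1 + lam k) * (?m k)\<^sup>2) = (\<Sum>k\<le>N. (?m k)\<^sup>2) + (\<Sum>k\<le>N. lam k * (?m k)\<^sup>2)"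
      by (simp add: distrib_right sum.distrib)
    have ex: "3 * (1 + lam N) * X = 3 * (1 + lam N) * (u t)\<^sup>2
        + 3 * (1 + lam N) * ((\<Sum>k\<le>N. (wh k t)\<^sup>2) + (\<Sum>k\<le>N. (err k t)\<^sup>2))"
      unfolding X by (simp only: distrib_left add.assoc)
    have "(u t)\<^sup>2 + (h1_norm (w t))\<^sup>2 + (h1_norm (observer N wh t))\<^sup>2 \<le> 3 * (1 + lam N) * X + 2 * tail"
    proof -
      have "p + (nf + nf') + r \<le> p' + q + 2 * (nf' - l0)"
        if "s + r \<le> q" "p \<le> p'" "nf - m0 \<le> nf' - l0" "s = m0 + l0" for p p' q r s nf nf' m0 l0 :: real
        using that by (smt (verit))
      from this[OF modes u a_le[unfolded tail_def] sumsplit] show ?thesis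
        unfolding h1[OF d] obs ex tail_def .
    qed
    also have "\<dots> \<le> (3 * (1 + lam N) / c + 2) * (state t \<bullet> (PX *\<^sub>v state t) + tail)"
    proof -
      define P where "P = state t \<bullet> (PX *\<^sub>v state t)"
      have "c * X \<le> P" unfolding X_def P_def by (rule c(2)[OF state_carrier])
      then have XP: "X \<le> P / c" using c(1) by (simp add: field_simps)
      have "0 \<le> X" unfolding X_def by (rule scalar_prod_self_nonneg)
      then have "0 \<le> c * X" using c(1) by simp
      then have P: "0 \<le> P" using \<open>c * X \<le> P\<close> by linarith
      have "3 * (1 + lam N) * X \<le> 3 * (1 + lam N) * (P / c)"
        using XP l by (intro mult_left_mono) auto
      also have "\<dots> = 3 * (1 + lam N) / c * P" by simp
      finally have 1: "3 * (1 + lam N) * X \<le> 3 * (1 + lam N) / c * P" .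
      have 2: "0 \<le> 3 * (1 + lam N) / c * tail" using tail0 l c(1) by simp
      have "(3 * (1 + lam N) / c + 2) * (P + tail) = 3 * (1 + lam N) / c * P + 3 * (1 + lam N) / c * tail + 2 * P + 2 * tail"
        by (simp only: distrib_left distrib_right add.assoc)
      then show ?thesis unfolding P_def[symmetric] using 1 2 P by linarith
    qed
    also have "\<dots> \<le> (3 * (1 + lam N) / c + 2) * ((C + 1) * (h1_norm w0)\<^sup>2 * exp (- 2 * \<delta> * t))"
    proof (rule mult_left_mono)
      have "state t \<bullet> (PX *\<^sub>v state t) + tail
          = exp (- 2 * \<delta> * t) * (exp (2 * \<delta> * t) * (state t \<bullet> (PX *\<^sub>v state t) + tail))"
        by (simp add: mult.assoc[symmetric] exp_add[symmetric])
      also have "\<dots> \<le> exp (- 2 * \<delta> * t) * ((C + 1) * (h1_norm w0)\<^sup>2)"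
        using main by (intro mult_left_mono) auto
      finally show "state t \<bullet> (PX *\<^sub>v state t) + tail \<le> (C + 1) * (h1_norm w0)\<^sup>2 * exp (- 2 * \<delta> * t)"
        by (simp add: mult.commute)
    qed (use c(1) l in \<open>auto intro: add_nonneg_nonneg\<close>)
    also have "\<dots> = ?K * (exp (- 2 * \<delta> * t) * (h1_norm w0)\<^sup>2)" by (simp only: mult_ac)
    also have "\<dots> \<le> max 1 ?K * (exp (- 2 * \<delta> * t) * (h1_norm w0)\<^sup>2)"
      by (intro mult_right_mono) auto
    finally show ?thesis by (simp only: mult.assoc)
  qed
qed

end

section \<open>Feasibility of the matrix inequality\<close>

lemma vnorm_single: "vnorm (vec 1 (\<lambda>_. s)) = \<bar>s\<bar>"
  by (simp add: vnorm_def scalar_prod_def)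

lemma row_bounded:
  obtains C where "C \<ge> 0" "\<And>g. \<bar>\<Sum>i<n. f i * g i\<bar> \<le> C * vnorm (vec n g)"
proof -
  from mult_mat_vec_bounded[OF row_mat_carrier[of n f]] obtain C where C: "C \<ge> 0"
    "\<And>y. y \<in> carrier_vec n \<Longrightarrow> vnorm (row_mat n f *\<^sub>v y) \<le> C * vnorm y" by blast
  show ?thesis
    by (rule that[OF C(1)]) (metis C(2) row_mat_mult_vec vec_carrier vnorm_single)
qed

text \<open>In finite dimensions a strict matrix inequality holds with a uniform margin, because the difference of
  its sides is coercive.  The margins pay for the couplings between the blocks.\<close>

lemma lyapunov_margin:
  assumes P: "pos_def n P" and A: "A \<in> carrier_mat n n"
    and less: "mat_less n (P * A + A\<^sup>T * P) ((- 2 * \<delta>) \<cdot>\<^sub>m P)"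
  obtains \<epsilon> where "\<epsilon> > 0"
    "\<And>x. x \<in> carrier_vec n \<Longrightarrow> 2 * (x \<bullet> (P *\<^sub>v (A *\<^sub>v x))) + 2 * \<delta> * (x \<bullet> (P *\<^sub>v x)) \<le> - (\<epsilon> * (vnorm x)\<^sup>2)"
proof -
  let ?W = "- (P * A + A\<^sup>T * P - (- 2 * \<delta>) \<cdot>\<^sub>m P)"
  have Pc: "P \<in> carrier_mat n n" "P\<^sup>T = P" using P by (auto simp: pos_def_def)
  have W: "pos_def n ?W" using less by (simp add: mat_less_def neg_def_def)
  from pos_def_coercive[OF W] obtain \<epsilon>
    where e: "\<epsilon> > 0" "\<And>x. x \<in> carrier_vec n \<Longrightarrow> \<epsilon> * (x \<bullet> x) \<le> x \<bullet> (?W *\<^sub>v x)"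
    by blast
  show ?thesis
  proof (rule that[OF e(1)])
    fix x :: "real vec" assume x: "x \<in> carrier_vec n"
    have c: "P * A \<in> carrier_mat n n" "A\<^sup>T * P \<in> carrier_mat n n" "P * A + A\<^sup>T * P \<in> carrier_mat n n"
      "(- 2 * \<delta>) \<cdot>\<^sub>m P \<in> carrier_mat n n" "P * A + A\<^sup>T * P - (- 2 * \<delta>) \<cdot>\<^sub>m P \<in> carrier_mat n n"
      using Pc A by auto
    have v: "M *\<^sub>v x \<in> carrier_vec n" if "M \<in> carrier_mat n n" for M
      by (rule mult_mat_vec_carrier[OF that x])
    have Ax: "A *\<^sub>v x \<in> carrier_vec n" by (rule v[OF A])
    have "?W *\<^sub>v x = - ((P * A) *\<^sub>v x + (A\<^sup>T * P) *\<^sub>v x - (- 2 * \<delta>) \<cdot>\<^sub>v (P *\<^sub>v x))"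
    proof -
      have "?W *\<^sub>v x = - ((P * A + A\<^sup>T * P - (- 2 * \<delta>) \<cdot>\<^sub>m P) *\<^sub>v x)"
        using c(5) x by (intro uminus_mult_mat_vec) auto
      then show ?thesis
        unfolding minus_mult_distrib_mat_vec[OF c(3,4) x] add_mult_distrib_mat_vec[OF c(1,2) x]
          smult_mat_mult_vec[OF Pc(1) x] .
    qed
    also have "x \<bullet> \<dots> = - (x \<bullet> ((P * A) *\<^sub>v x) + x \<bullet> ((A\<^sup>T * P) *\<^sub>v x) - (- 2 * \<delta>) * (x \<bullet> (P *\<^sub>v x)))"
    proof -
      have "x \<bullet> (- (p + q - s \<cdot>\<^sub>v r)) = - (x \<bullet> p + x \<bullet> q - s * (x \<bullet> r))"
        if "p \<in> carrier_vec n" "q \<in> carrier_vec n" "r \<in> carrier_vec n" for p q r s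
        using x that
        by (simp add: scalar_prod_def sum.distrib sum_subtractf sum_negf sum_distrib_left algebra_simps)
      from this[OF v[OF c(1)] v[OF c(2)] v[OF Pc(1)]] show ?thesis .
    qed
    also have "x \<bullet> ((P * A) *\<^sub>v x) = x \<bullet> (P *\<^sub>v (A *\<^sub>v x))"
      by (simp only: assoc_mult_mat_vec[OF Pc(1) A x])
    also have "x \<bullet> ((A\<^sup>T * P) *\<^sub>v x) = x \<bullet> (P *\<^sub>v (A *\<^sub>v x))"
    proof -
      have "x \<bullet> ((A\<^sup>T * P) *\<^sub>v x) = x \<bullet> (A\<^sup>T *\<^sub>v (P *\<^sub>v x))"
        using assoc_mult_mat_vec[of "A\<^sup>T" n n P n x] A Pc(1) x by simp
      also have "\<dots> = (P *\<^sub>v x) \<bullet> (A *\<^sub>v x)"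
        by (rule scalar_prod_transpose[OF A x v[OF Pc(1)]])
      also have "\<dots> = (A *\<^sub>v x) \<bullet> (P *\<^sub>v x)"
        by (rule comm_scalar_prod[OF v[OF Pc(1)] Ax])
      also have "\<dots> = x \<bullet> (P *\<^sub>v (A *\<^sub>v x))"
        by (rule symmetric_scalar_prod[OF Pc Ax x])
      finally show ?thesis .
    qed
    finally have "x \<bullet> (?W *\<^sub>v x) = - (2 * (x \<bullet> (P *\<^sub>v (A *\<^sub>v x))) + 2 * \<delta> * (x \<bullet> (P *\<^sub>v x)))" by simp
    then show "2 * (x \<bullet> (P *\<^sub>v (A *\<^sub>v x))) + 2 * \<delta> * (x \<bullet> (P *\<^sub>v x)) \<le> - (\<epsilon> * (vnorm x)\<^sup>2)"
      using e(2)[OF x] by (simp add: vnorm_sq)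
  qed
qed

text \<open>\<open>A\<close>, \<open>E\<close>, \<open>B\<close>, \<open>G\<close> are the norms of \<open>u\<close> with the low observer modes, of the low errors, of the high observer
  modes and of the high errors, and \<open>z\<close> is \<open>\<bar>\<zeta>\<bar>\<close>; the \<open>m\<close> and \<open>s\<close> are the gains of the couplings.  The closed loop is
  a cascade: \<open>G\<close> drives \<open>E\<close>, both drive \<open>A\<close>, and \<open>A\<close> drives \<open>B\<close>.  So each coupling can be absorbed by a large weight
  on its source or a small weight on its target.  The gains \<open>s1\<close> and \<open>sb\<close> depend on the number of high modes, and
  with them \<open>p1\<close> and \<open>pb\<close>; but the factor of \<open>z\<^sup>2\<close> does not, and this is what allows \<open>\<rho>\<close> to outweigh it.\<close>

lemma cascade_inequality:
  fixes \<epsilon>c \<epsilon>o \<eta> m0 m1 m2 mk s1 sb pe pb p1 A E B G z xk :: real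
  assumes pos: "\<epsilon>c > 0" "\<epsilon>o > 0" "\<eta> > 0" and nn: "pe > 0"
  defines "pb \<equiv> \<eta> * \<epsilon>c / (8 * ((sb * mk)\<^sup>2 + 1))"
    and "p1 \<equiv> (8 * (m1 * s1)\<^sup>2 / \<epsilon>c + 4 * pe * (m2 * s1)\<^sup>2 / \<epsilon>o) / \<eta> + 1"
  assumes pe: "8 * (m1 * m0)\<^sup>2 / \<epsilon>c \<le> pe * \<epsilon>o / 4"
    and xk: "xk * mk\<^sup>2 \<le> \<epsilon>c / 8"
  shows "- \<epsilon>c * A\<^sup>2 + 2 * (m1 * A * (m0 * E + s1 * G + z)) - pe * \<epsilon>o * E\<^sup>2 + 2 * pe * (m2 * E * (s1 * G + z))
      - 2 * pb * \<eta> * B\<^sup>2 + 2 * pb * (sb * B * (mk * A)) - 2 * p1 * \<eta> * G\<^sup>2 + xk * (mk * A)\<^sup>2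
    \<le> - (3 * \<epsilon>c / 8) * A\<^sup>2 - (pe * \<epsilon>o / 4) * E\<^sup>2 - pb * \<eta> * B\<^sup>2 - p1 * \<eta> * G\<^sup>2
      + (8 * m1\<^sup>2 / \<epsilon>c + 4 * pe * m2\<^sup>2 / \<epsilon>o) * z\<^sup>2"
proof -
  have e8: "\<epsilon>c / 8 > 0" and eo: "pe * \<epsilon>o / 4 > 0" using pos nn by auto
  have Y: "2 * (A * (x * y)) \<le> \<epsilon>c / 8 * A\<^sup>2 + 8 * x\<^sup>2 / \<epsilon>c * y\<^sup>2" for x y
    using Young[OF e8, of "x * y" A] pos(1) by (simp add: power_mult_distrib mult_ac)
  have Z: "2 * (E * (x * y)) * pe \<le> pe * \<epsilon>o / 4 * E\<^sup>2 + 4 * pe * x\<^sup>2 / \<epsilon>o * y\<^sup>2" for x y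
  proof -
    have "2 * (pe * (x * y)) * E \<le> (pe * (x * y))\<^sup>2 / (pe * \<epsilon>o / 4) + pe * \<epsilon>o / 4 * E\<^sup>2" by (rule Young[OF eo])
    also have "(pe * (x * y))\<^sup>2 / (pe * \<epsilon>o / 4) = 4 * pe * x\<^sup>2 / \<epsilon>o * y\<^sup>2"
      using nn pos by (simp add: power_mult_distrib power2_eq_square field_simps)
    finally show ?thesis by (simp add: mult_ac)
  qed
  have pb: "pb > 0"
    unfolding pb_def using pos by (intro divide_pos_pos mult_pos_pos) (auto intro: add_nonneg_pos)
  have 1: "2 * (A * ((m1 * m0) * E)) \<le> \<epsilon>c / 8 * A\<^sup>2 + pe * \<epsilon>o / 4 * E\<^sup>2"
    using Y[of "m1 * m0" E] mult_right_mono[OF pe, of "E\<^sup>2"] by simp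
  have 2: "2 * (A * ((m1 * s1) * G)) \<le> \<epsilon>c / 8 * A\<^sup>2 + 8 * (m1 * s1)\<^sup>2 / \<epsilon>c * G\<^sup>2" by (rule Y)
  have 3: "2 * (A * (m1 * z)) \<le> \<epsilon>c / 8 * A\<^sup>2 + 8 * m1\<^sup>2 / \<epsilon>c * z\<^sup>2" by (rule Y)
  have 4: "2 * (E * ((m2 * s1) * G)) * pe \<le> pe * \<epsilon>o / 4 * E\<^sup>2 + 4 * pe * (m2 * s1)\<^sup>2 / \<epsilon>o * G\<^sup>2" by (rule Z)
  have 5: "2 * (E * (m2 * z)) * pe \<le> pe * \<epsilon>o / 4 * E\<^sup>2 + 4 * pe * m2\<^sup>2 / \<epsilon>o * z\<^sup>2" by (rule Z)
  have 6: "2 * pb * (sb * B * (mk * A)) \<le> pb * \<eta> * B\<^sup>2 + \<epsilon>c / 8 * A\<^sup>2"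
  proof -
    have "2 * (sb * mk * A) * B \<le> (sb * mk * A)\<^sup>2 / \<eta> + \<eta> * B\<^sup>2" by (rule Young[OF pos(3)])
    then have "pb * (2 * (sb * mk * A) * B) \<le> pb * ((sb * mk * A)\<^sup>2 / \<eta> + \<eta> * B\<^sup>2)"
      using pb by (intro mult_left_mono) auto
    moreover have "pb * ((sb * mk * A)\<^sup>2 / \<eta>) \<le> \<epsilon>c / 8 * A\<^sup>2"
    proof -
      let ?q = "(sb * mk)\<^sup>2"
      have "pb * ((sb * mk * A)\<^sup>2 / \<eta>) = \<epsilon>c / 8 * (?q / (?q + 1)) * A\<^sup>2"
        unfolding pb_def using pos(3) by (simp add: power_mult_distrib)
      also have "\<dots> \<le> \<epsilon>c / 8 * 1 * A\<^sup>2"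
      proof (intro mult_right_mono mult_left_mono)
        have "0 < ?q + 1" by (intro add_nonneg_pos) auto
        then show "?q / (?q + 1) \<le> 1" by simp
      qed (use e8 in auto)
      finally show ?thesis by simp
    qed
    moreover have "pb * (2 * (sb * mk * A) * B) = 2 * pb * (sb * B * (mk * A))"
      "pb * ((sb * mk * A)\<^sup>2 / \<eta> + \<eta> * B\<^sup>2) = pb * ((sb * mk * A)\<^sup>2 / \<eta>) + pb * \<eta> * B\<^sup>2"
      by (simp_all only: distrib_left mult_ac)
    ultimately show ?thesis by linarith
  qed
  have 7: "p1 * \<eta> * G\<^sup>2 = (8 * (m1 * s1)\<^sup>2 / \<epsilon>c) * G\<^sup>2 + (4 * pe * (m2 * s1)\<^sup>2 / \<epsilon>o) * G\<^sup>2 + \<eta> * G\<^sup>2"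
  proof -
    have "(x / \<eta> + 1) * \<eta> = x + \<eta>" for x using pos(3) by (simp add: distrib_right)
    then show ?thesis unfolding p1_def by (simp only: distrib_right)
  qed
  have 8: "xk * (mk * A)\<^sup>2 \<le> \<epsilon>c / 8 * A\<^sup>2"
    using mult_right_mono[OF xk, of "A\<^sup>2"] by (simp add: power_mult_distrib mult_ac)
  have 9: "0 \<le> \<eta> * G\<^sup>2" using pos by simp
  have e: "2 * (m1 * A * (m0 * E + s1 * G + z)) = 2 * (A * ((m1 * m0) * E)) + 2 * (A * ((m1 * s1) * G)) + 2 * (A * (m1 * z))"
    "2 * pe * (m2 * E * (s1 * G + z)) = 2 * (E * ((m2 * s1) * G)) * pe + 2 * (E * (m2 * z)) * pe"
    by (simp_all add: algebra_simps)
  have f: "(8 * m1\<^sup>2 / \<epsilon>c + 4 * pe * m2\<^sup>2 / \<epsilon>o) * z\<^sup>2 = 8 * m1\<^sup>2 / \<epsilon>c * z\<^sup>2 + 4 * pe * m2\<^sup>2 / \<epsilon>o * z\<^sup>2"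
    by (simp only: distrib_right)
  show ?thesis
  proof -
    have n: "\<epsilon>c / 8 * A\<^sup>2 = \<epsilon>c * A\<^sup>2 / 8" "- \<epsilon>c * A\<^sup>2 = - (\<epsilon>c * A\<^sup>2)"
      "- (3 * \<epsilon>c / 8) * A\<^sup>2 = - (3 * (\<epsilon>c * A\<^sup>2) / 8)" "pe * \<epsilon>o / 4 * E\<^sup>2 = pe * \<epsilon>o * E\<^sup>2 / 4"
      "2 * pb * \<eta> * B\<^sup>2 = 2 * (pb * \<eta> * B\<^sup>2)" "2 * p1 * \<eta> * G\<^sup>2 = 2 * (p1 * \<eta> * G\<^sup>2)"
      by simp_all
    show ?thesis
      using 1 2 3 4 5 6 7 8 9 unfolding e f n by linarith
  qed
qed

text \<open>For \<open>\<alpha> \<ge> 2\<close> half of the leading term \<open>- \<lambda>\<^sup>2\<close> of \<open>\<rho> \<kappa>\<close> survives, and it outgrows \<open>\<kappa>\<close>, which is linear in \<open>\<lambda>\<close>.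
  The term with \<open>\<sigma>\<close> is kept apart because \<open>\<alpha>\<close> and \<open>\<sigma>\<close> are chosen after \<open>N\<close>.\<close>

lemma rho_below_for_large_N:
  assumes pos: "\<Gamma> > 0" "\<delta> > 0" and N: "real N \<ge> 2 * \<delta> + 1 + (1 + \<Gamma> + inverse \<Gamma>) * R" and R: "R \<ge> 0"
    and \<alpha>: "\<alpha> \<ge> 2"
  shows "2 * rho \<delta> \<sigma> \<Gamma> \<alpha> \<alpha> 1 N \<le> - R + \<alpha> * \<sigma>\<^sup>2"
proof -
  define l where "l = lam (N + 1)"
  define k where "k = kappa \<Gamma> N"
  define q where "q = 1 + \<Gamma> + inverse \<Gamma>"
  have l: "real (N + 1) \<le> l" unfolding l_def by (rule lam_ge)
  then have l1: "1 \<le> l" by linarith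
  have q: "q > 0" using pos unfolding q_def by (intro add_pos_pos) auto
  have il: "0 \<le> inverse \<Gamma> * l" using l1 pos by (intro mult_nonneg_nonneg) auto
  have k1: "1 \<le> k" unfolding k_def kappa_def l_def[symmetric] using pos il by linarith
  have kq: "k \<le> q * l"
  proof -
    have "(1 + \<Gamma>) * 1 \<le> (1 + \<Gamma>) * l" using l1 pos by (intro mult_left_mono) auto
    then show ?thesis unfolding k_def kappa_def q_def l_def[symmetric] by (simp add: distrib_right)
  qed
  have la: "l\<^sup>2 / (2 * \<alpha>) + l\<^sup>2 / (2 * \<alpha>) \<le> l\<^sup>2 / 2"
  proof -
    have "l\<^sup>2 / (2 * \<alpha>) + l\<^sup>2 / (2 * \<alpha>) = l\<^sup>2 / \<alpha>" using \<alpha> by (simp add: field_simps)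
    also have "\<dots> \<le> l\<^sup>2 / 2" using \<alpha> by (intro divide_left_mono) auto
    finally show ?thesis .
  qed
  have "- l\<^sup>2 + \<delta> * l + l / (2 * 1) + l\<^sup>2 / (2 * \<alpha>) + l\<^sup>2 / (2 * \<alpha>) + \<alpha> * \<sigma>\<^sup>2 / 2
      \<le> l * (- l + 2 * \<delta> + 1) / 2 + \<alpha> * \<sigma>\<^sup>2 / 2"
  proof -
    have "l * (- l + 2 * \<delta> + 1) / 2 = - l\<^sup>2 / 2 + \<delta> * l + l / 2"
      by (simp add: power2_eq_square algebra_simps add_divide_distrib diff_divide_distrib)
    then show ?thesis using la by linarith
  qed
  also have "l * (- l + 2 * \<delta> + 1) \<le> l * (- (q * R))"
    using l N l1 unfolding q_def[symmetric] by (intro mult_left_mono) auto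
  also have "l * (- (q * R)) \<le> - (k * R)"
    using mult_right_mono[OF kq R] by (simp add: mult_ac)
  finally have b: "- l\<^sup>2 + \<delta> * l + l / (2 * 1) + l\<^sup>2 / (2 * \<alpha>) + l\<^sup>2 / (2 * \<alpha>) + \<alpha> * \<sigma>\<^sup>2 / 2
      \<le> - (k * R) / 2 + \<alpha> * \<sigma>\<^sup>2 / 2" by simp
  have "2 * rho \<delta> \<sigma> \<Gamma> \<alpha> \<alpha> 1 N \<le> 2 * (inverse k * (- (k * R) / 2 + \<alpha> * \<sigma>\<^sup>2 / 2))"
    unfolding rho_def k_def[symmetric] l_def[symmetric]
    using b k1 by (intro mult_left_mono) auto
  also have "\<dots> = - R + inverse k * (\<alpha> * \<sigma>\<^sup>2)"
    using k1 by (simp add: field_simps)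
  also have "inverse k * (\<alpha> * \<sigma>\<^sup>2) \<le> 1 * (\<alpha> * \<sigma>\<^sup>2)"
    using k1 \<alpha> by (intro mult_right_mono) (auto simp: field_simps)
  finally show ?thesis by simp
qed

text \<open>\<open>\<xi> \<le> 4 / N\<close> and \<open>8 \<le> \<pi>\<^sup>2\<close>.\<close>

lemma xi_bound:
  assumes "N \<ge> 1"
  shows "2 * xi N / pi\<^sup>2 \<le> 1 / real N"
proof -
  define q where "q = 4 * (real (N + 1))\<^sup>2 - 1"
  have "(real 2)\<^sup>2 \<le> (real (N + 1))\<^sup>2" using assms by (intro power_mono) auto
  then have q: "15 \<le> q" unfolding q_def by simp
  then have "1 + 1 / q \<le> 2" by simp
  then have "(1 + 1 / q)\<^sup>2 \<le> 2\<^sup>2" using q by (intro power_mono) auto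
  then have "xi N \<le> 4 * (1 / real N)" unfolding xi_def q_def[symmetric] by (intro mult_right_mono) auto
  then have "2 * xi N / pi\<^sup>2 \<le> 2 * (4 * (1 / real N)) / pi\<^sup>2" by (intro divide_right_mono) auto
  also have "\<dots> = 8 / pi\<^sup>2 * (1 / real N)" by simp
  also have "\<dots> \<le> 1 * (1 / real N)"
  proof (intro mult_right_mono)
    have "(3 :: real)\<^sup>2 \<le> pi\<^sup>2" using pi_gt3 by (intro power_mono) auto
    then show "8 / pi\<^sup>2 \<le> 1" by simp
  qed auto
  finally show ?thesis by simp
qed

lemma neg_defI:
  fixes P :: "real mat"
  assumes P: "P \<in> carrier_mat n n" "P\<^sup>T = P"
    and neg: "\<And>v. v \<in> carrier_vec n \<Longrightarrow> v \<noteq> 0\<^sub>v n \<Longrightarrow> v \<bullet> (P *\<^sub>v v) < 0"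
  shows "neg_def n P"
  unfolding neg_def_def pos_def_def
proof (intro conjI ballI impI)
  show "- P \<in> carrier_mat n n" using P by simp
  have "(- P)\<^sup>T = - (P\<^sup>T)" using P(1) by (intro eq_matI) auto
  then show "(- P)\<^sup>T = - P" using P(2) by simp
  fix v :: "real vec" assume v: "v \<in> carrier_vec n" "v \<noteq> 0\<^sub>v n"
  have "v \<bullet> ((- P) *\<^sub>v v) = - (v \<bullet> (P *\<^sub>v v))" using P v by simp
  then show "0 < v \<bullet> ((- P) *\<^sub>v v)" using neg[OF v] by simp
qed

lemma scalar_prod_mult_add_smult:
  fixes P :: "real mat"
  assumes "P \<in> carrier_mat n n" "x \<in> carrier_vec n" "y \<in> carrier_vec n" "z \<in> carrier_vec n"
  shows "x \<bullet> (P *\<^sub>v (y + s \<cdot>\<^sub>v z)) = x \<bullet> (P *\<^sub>v y) + s * (x \<bullet> (P *\<^sub>v z))"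
  using assms
  by (simp add: mult_add_distrib_mat_vec[of _ n n] mult_mat_vec[of _ n n] scalar_prod_add_distrib[of _ n])

text \<open>The blocks are in the order of \<open>state_vec\<close>, so the form is a weighted sum of four forms in separate
  variables.\<close>

definition blockP :: "nat \<Rightarrow> nat \<Rightarrow> real mat \<Rightarrow> real mat \<Rightarrow> real \<Rightarrow> real \<Rightarrow> real \<Rightarrow> real mat" where
  "blockP N0 N Pc Po pe pb p1 =
    diag_block_mat [Pc, pe \<cdot>\<^sub>m Po, pb \<cdot>\<^sub>m 1\<^sub>m (N - N0), p1 \<cdot>\<^sub>m 1\<^sub>m (N - N0)]"

context
  fixes N0 N :: nat and Pc Po :: "real mat" and pe pb p1 :: real
  assumes N: "N0 \<le> N" and Pc: "pos_def (N0 + 2) Pc" and Po: "pos_def (N0 + 1) Po"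
    and weights: "pe > 0" "pb > 0" "p1 > 0"
begin

lemma Pc_carrier: "Pc \<in> carrier_mat (N0 + 2) (N0 + 2)" and Pc_sym: "Pc\<^sup>T = Pc"
  and Po_carrier: "Po \<in> carrier_mat (N0 + 1) (N0 + 1)" and Po_sym: "Po\<^sup>T = Po"
  using Pc Po by (auto simp: pos_def_def)

lemma blockP_carrier: "blockP N0 N Pc Po pe pb p1 \<in> carrier_mat (2 * N + 3) (2 * N + 3)"
proof -
  have "diag_block_mat [p1 \<cdot>\<^sub>m 1\<^sub>m (N - N0)] \<in> carrier_mat (N - N0) (N - N0)"
    by (simp only: diag_block_mat_singleton smult_carrier_mat one_carrier_mat)
  then show ?thesis
    unfolding blockP_def block_dim[OF N, symmetric]
    by (intro diag_block_carrier Pc_carrier smult_carrier_mat Po_carrier one_carrier_mat)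
qed

lemma blockP_form:
  "state_vec N0 N u a e \<bullet> (blockP N0 N Pc Po pe pb p1 *\<^sub>v state_vec N0 N u' a' e')
    = vec (N0 + 2) (case_nat u a) \<bullet> (Pc *\<^sub>v vec (N0 + 2) (case_nat u' a'))
      + pe * (vec (N0 + 1) e \<bullet> (Po *\<^sub>v vec (N0 + 1) e'))
      + pb * (\<Sum>i<N - N0. a (N0 + 1 + i) * a' (N0 + 1 + i))
      + p1 * (\<Sum>i<N - N0. e (N0 + 1 + i) * e' (N0 + 1 + i))"
proof -
  let ?xa = "vec (N0 + 2) (case_nat u a)" and ?xe = "vec (N0 + 1) e"
  let ?xb = "vec (N - N0) (\<lambda>i. a (N0 + 1 + i))" and ?xf = "vec (N - N0) (\<lambda>i. e (N0 + 1 + i))"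
  let ?ya = "vec (N0 + 2) (case_nat u' a')" and ?ye = "vec (N0 + 1) e'"
  let ?yb = "vec (N - N0) (\<lambda>i. a' (N0 + 1 + i))" and ?yf = "vec (N - N0) (\<lambda>i. e' (N0 + 1 + i))"
  have d1: "diag_block_mat [p1 \<cdot>\<^sub>m 1\<^sub>m (N - N0)] \<in> carrier_mat (N - N0) (N - N0)"
    by (simp only: diag_block_mat_singleton smult_carrier_mat one_carrier_mat)
  have Ic: "c \<cdot>\<^sub>m 1\<^sub>m (N - N0) \<in> carrier_mat (N - N0) (N - N0)" for c :: real by simp
  have Pe: "pe \<cdot>\<^sub>m Po \<in> carrier_mat (N0 + 1) (N0 + 1)" using Po_carrier by simp
  note d2 = diag_block_carrier[OF Ic d1]
  note d3 = diag_block_carrier[OF Pe d2]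
  have act: "blockP N0 N Pc Po pe pb p1 *\<^sub>v state_vec N0 N u' a' e'
      = Pc *\<^sub>v ?ya @\<^sub>v (pe \<cdot>\<^sub>v (Po *\<^sub>v ?ye)) @\<^sub>v (pb \<cdot>\<^sub>v ?yb) @\<^sub>v (p1 \<cdot>\<^sub>v ?yf)"
  proof -
    have one: "(c \<cdot>\<^sub>m 1\<^sub>m (N - N0)) *\<^sub>v v = c \<cdot>\<^sub>v v" if "v \<in> carrier_vec (N - N0)" for c and v :: "real vec"
      using smult_mat_mult_vec[OF one_carrier_mat that, of c] that by simp
    show ?thesis
      unfolding blockP_def state_vec_def
      by (simp only: diag_block_mult_vec[OF Pc_carrier d3] diag_block_mult_vec[OF Pe d2]
          diag_block_mult_vec[OF Ic d1] diag_block_mat_singleton vec_carrier append_carrier_vec one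
          smult_mat_mult_vec[OF Po_carrier])
  qed
  have c: "Pc *\<^sub>v ?ya \<in> carrier_vec (N0 + 2)" "pe \<cdot>\<^sub>v (Po *\<^sub>v ?ye) \<in> carrier_vec (N0 + 1)"
    "pb \<cdot>\<^sub>v ?yb \<in> carrier_vec (N - N0)" "p1 \<cdot>\<^sub>v ?yf \<in> carrier_vec (N - N0)" "Po *\<^sub>v ?ye \<in> carrier_vec (N0 + 1)"
    using Pc_carrier Po_carrier by (auto intro!: mult_mat_vec_carrier)
  have "state_vec N0 N u a e \<bullet> (blockP N0 N Pc Po pe pb p1 *\<^sub>v state_vec N0 N u' a' e')
      = ?xa \<bullet> (Pc *\<^sub>v ?ya) + (?xe \<bullet> (pe \<cdot>\<^sub>v (Po *\<^sub>v ?ye)) + (?xb \<bullet> (pb \<cdot>\<^sub>v ?yb) + ?xf \<bullet> (p1 \<cdot>\<^sub>v ?yf)))"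
    unfolding act unfolding state_vec_def
    by (simp only: scalar_prod_append[of _ "N0 + 2" _ "(N0 + 1) + ((N - N0) + (N - N0))"]
      scalar_prod_append[of _ "N0 + 1" _ "(N - N0) + (N - N0)"] scalar_prod_append[of _ "N - N0" _ "N - N0"]
      append_carrier_vec vec_carrier c)
  then show ?thesis
    unfolding scalar_prod_smult_distrib[OF vec_carrier c(5)] scalar_prod_smult_distrib[OF vec_carrier vec_carrier]
      scalar_prod_vec by simp
qed

lemma blockP_sym: "(blockP N0 N Pc Po pe pb p1)\<^sup>T = blockP N0 N Pc Po pe pb p1"
proof (rule symmetric_matI[OF blockP_carrier])
  fix x y :: "real vec" assume "x \<in> carrier_vec (2 * N + 3)" "y \<in> carrier_vec (2 * N + 3)"
  then obtain u a e u' a' e' where "x = state_vec N0 N u a e" "y = state_vec N0 N u' a' e'"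
    by (elim state_vec_surj[OF N])
  then show "x \<bullet> (blockP N0 N Pc Po pe pb p1 *\<^sub>v y) = y \<bullet> (blockP N0 N Pc Po pe pb p1 *\<^sub>v x)"
    using symmetric_scalar_prod[OF Pc_carrier Pc_sym, of "vec (N0 + 2) (case_nat u a)" "vec (N0 + 2) (case_nat u' a')"]
      symmetric_scalar_prod[OF Po_carrier Po_sym, of "vec (N0 + 1) e" "vec (N0 + 1) e'"]
    by (simp only: blockP_form vec_carrier mult.commute)
qed

lemma state_vec_blocks_norm:
  "state_vec N0 N u a e \<bullet> state_vec N0 N u a e = (vnorm (vec (N0 + 2) (case_nat u a)))\<^sup>2 + (vnorm (vec (N0 + 1) e))\<^sup>2
    + (vnorm (vec (N - N0) (\<lambda>i. a (N0 + 1 + i))))\<^sup>2 + (vnorm (vec (N - N0) (\<lambda>i. e (N0 + 1 + i))))\<^sup>2"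
  unfolding state_vec_def vnorm_sq
  by (simp only: scalar_prod_append[of _ "N0 + 2" _ "(N0 + 1) + ((N - N0) + (N - N0))"]
      scalar_prod_append[of _ "N0 + 1" _ "(N - N0) + (N - N0)"] scalar_prod_append[of _ "N - N0" _ "N - N0"]
      append_carrier_vec vec_carrier add.assoc[of "_ \<bullet> _"])

lemma blockP_pos_def: "pos_def (2 * N + 3) (blockP N0 N Pc Po pe pb p1)"
  unfolding pos_def_def
proof (intro conjI ballI impI blockP_carrier blockP_sym)
  fix v :: "real vec" assume v: "v \<in> carrier_vec (2 * N + 3)" "v \<noteq> 0\<^sub>v (2 * N + 3)"
  from pos_def_coercive[OF Pc] obtain cc where cc: "cc > 0"
    "\<And>x. x \<in> carrier_vec (N0 + 2) \<Longrightarrow> cc * (x \<bullet> x) \<le> x \<bullet> (Pc *\<^sub>v x)" by blast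
  from pos_def_coercive[OF Po] obtain co where co: "co > 0"
    "\<And>x. x \<in> carrier_vec (N0 + 1) \<Longrightarrow> co * (x \<bullet> x) \<le> x \<bullet> (Po *\<^sub>v x)" by blast
  obtain u a e where s: "v = state_vec N0 N u a e" using v(1) by (elim state_vec_surj[OF N])
  let ?xa = "vec (N0 + 2) (case_nat u a)" and ?xe = "vec (N0 + 1) e"
  let ?xb = "vec (N - N0) (\<lambda>i. a (N0 + 1 + i))" and ?xf = "vec (N - N0) (\<lambda>i. e (N0 + 1 + i))"
  have "0 < v \<bullet> v" by (rule scalar_prod_self_pos[OF v])
  then have p: "0 < (vnorm ?xa)\<^sup>2 + (vnorm ?xe)\<^sup>2 + (vnorm ?xb)\<^sup>2 + (vnorm ?xf)\<^sup>2"
    unfolding s state_vec_blocks_norm .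
  have "v \<bullet> (blockP N0 N Pc Po pe pb p1 *\<^sub>v v) = ?xa \<bullet> (Pc *\<^sub>v ?xa) + pe * (?xe \<bullet> (Po *\<^sub>v ?xe))
      + pb * (vnorm ?xb)\<^sup>2 + p1 * (vnorm ?xf)\<^sup>2"
    unfolding s blockP_form vnorm_sq scalar_prod_vec ..
  also have "\<dots> \<ge> cc * (vnorm ?xa)\<^sup>2 + pe * (co * (vnorm ?xe)\<^sup>2) + pb * (vnorm ?xb)\<^sup>2 + p1 * (vnorm ?xf)\<^sup>2"
    using cc(2)[OF vec_carrier, of "case_nat u a"]
      mult_left_mono[OF co(2)[OF vec_carrier, of e] less_imp_le[OF weights(1)]]
    unfolding vnorm_sq by linarith
  moreover have "0 < cc * p + pe * (co * q) + pb * r + p1 * s"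
    if h: "0 \<le> p" "0 \<le> q" "0 \<le> r" "0 \<le> s" "0 < p + q + r + s" for p q r s
  proof -
    have n: "0 \<le> cc * p" "0 \<le> pe * (co * q)" "0 \<le> pb * r" "0 \<le> p1 * s"
      using h cc(1) co(1) weights by simp_all
    consider "0 < p" | "0 < q" | "0 < r" | "0 < s" using h by linarith
    then show ?thesis
    proof cases
      case 1
      then have "0 < cc * p" using cc(1) by simp
      then show ?thesis using n by linarith
    next
      case 2
      then have "0 < pe * (co * q)" using co(1) weights by simp
      then show ?thesis using n by linarith
    next
      case 3
      then have "0 < pb * r" using weights by simp
      then show ?thesis using n by linarith
    next
      case 4
      then have "0 < p1 * s" using weights by simp
      then show ?thesis using n by linarith
    qed
  qed
  note this[OF zero_le_power2 zero_le_power2 zero_le_power2 zero_le_power2 p]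
  ultimately show "0 < v \<bullet> (blockP N0 N Pc Po pe pb p1 *\<^sub>v v)" by linarith
qed

end

text \<open>Each coupling is estimated by its gain alone; this brings the derivative of the block diagonal functional
  along the linear closed loop into the form that \<open>cascade_inequality\<close> treats.\<close>

lemma blockP_derivative:
  fixes N0 N :: nat and L0 K0 Pc Po :: "real mat" and u \<zeta> :: real and a e :: "nat \<Rightarrow> real"
  assumes L0: "L0 \<in> carrier_mat (N0 + 1) 1" and K0: "K0 \<in> carrier_mat 1 (N0 + 2)" and N: "N0 \<le> N"
    and Pc: "pos_def (N0 + 2) Pc" and Po: "pos_def (N0 + 1) Po"
    and w: "pe > 0" "pb > 0" "p1 > 0"
  defines "xa \<equiv> vec (N0 + 2) (case_nat u a)" and "xe \<equiv> vec (N0 + 1) e"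
    and "xb \<equiv> vec (N - N0) (\<lambda>i. a (N0 + 1 + i))" and "xf \<equiv> vec (N - N0) (\<lambda>i. e (N0 + 1 + i))"
    and "la \<equiv> vec (N0 + 2) (case_nat 0 (obs_gain N0 L0))" and "lo \<equiv> vec (N0 + 1) (obs_gain N0 L0)"
  assumes c: "2 * (xa \<bullet> (Pc *\<^sub>v ((A0t N0 - B0t N0 * K0) *\<^sub>v xa))) + 2 * \<delta> * (xa \<bullet> (Pc *\<^sub>v xa)) \<le> - (\<epsilon>c * (vnorm xa)\<^sup>2)"
    and o: "2 * (xe \<bullet> (Po *\<^sub>v ((A0 N0 - L0 * C0 N0 xs) *\<^sub>v xe))) + 2 * \<delta> * (xe \<bullet> (Po *\<^sub>v xe)) \<le> - (\<epsilon>o * (vnorm xe)\<^sup>2)"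
    and m1: "\<bar>xa \<bullet> (Pc *\<^sub>v la)\<bar> \<le> m1 * vnorm xa" and m2: "\<bar>xe \<bullet> (Po *\<^sub>v lo)\<bar> \<le> m2 * vnorm xe"
    and m0: "\<bar>\<Sum>i<N0 + 1. ccoef xs i * e i\<bar> \<le> m0 * vnorm xe" and mk: "\<bar>feedback N0 K0 u a\<bar> \<le> mk * vnorm xa"
    and s1: "\<bar>\<Sum>i<N - N0. ccoef xs (N0 + 1 + i) * e (N0 + 1 + i)\<bar> \<le> s1 * vnorm xf"
    and sb: "\<bar>\<Sum>i<N - N0. bcoef (N0 + 1 + i) * a (N0 + 1 + i)\<bar> \<le> sb * vnorm xb"
    and nn: "m1 \<ge> 0" "m2 \<ge> 0" "sb \<ge> 0"
    and \<eta>: "\<eta> = lam (N0 + 1) - \<delta>"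
  defines "x \<equiv> state_vec N0 N u a e" and "P \<equiv> blockP N0 N Pc Po pe pb p1"
  shows "2 * (x \<bullet> (P *\<^sub>v (FX N0 N xs L0 K0 *\<^sub>v x + Lzeta N0 N L0 *\<^sub>v vec 1 (\<lambda>_. \<zeta>)))) + 2 * \<delta> * (x \<bullet> (P *\<^sub>v x))
    \<le> - \<epsilon>c * (vnorm xa)\<^sup>2 + 2 * (m1 * vnorm xa * (m0 * vnorm xe + s1 * vnorm xf + \<bar>\<zeta>\<bar>))
      - pe * \<epsilon>o * (vnorm xe)\<^sup>2 + 2 * pe * (m2 * vnorm xe * (s1 * vnorm xf + \<bar>\<zeta>\<bar>))
      - 2 * pb * \<eta> * (vnorm xb)\<^sup>2 + 2 * pb * (sb * vnorm xb * (mk * vnorm xa)) - 2 * p1 * \<eta> * (vnorm xf)\<^sup>2"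
proof -
  let ?k = "feedback N0 K0 u a" and ?l = "obs_gain N0 L0"
  let ?Ga = "A0t N0 - B0t N0 * K0" and ?Ge = "A0 N0 - L0 * C0 N0 xs"
  define S0 S1 where "S0 = (\<Sum>i<N0 + 1. ccoef xs i * e i)"
    and "S1 = (\<Sum>i<N - N0. ccoef xs (N0 + 1 + i) * e (N0 + 1 + i))"
  have S: "(\<Sum>n\<le>N. ccoef xs n * e n) = S0 + S1"
    using sum_split_modes[OF N, of "\<lambda>n. ccoef xs n * e n"] by (simp add: S0_def S1_def)
  note Pcc = Pc_carrier[OF N Pc Po w] and Poc = Po_carrier[OF N Pc Po w]
  define a' e' where "a' n = - lam n * a n - bcoef n * ?k + ?l n * (S0 + S1) + ?l n * \<zeta>"
    and "e' n = - lam n * e n - ?l n * (S0 + S1) + - (?l n * \<zeta>)" for n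
  have y: "FX N0 N xs L0 K0 *\<^sub>v x + Lzeta N0 N L0 *\<^sub>v vec 1 (\<lambda>_. \<zeta>) = state_vec N0 N (- mu * u - ?k) a' e'"
    unfolding x_def FX_mult_state[OF L0 K0 N] Lzeta_mult_vec[OF L0 K0 N] state_vec_add S a'_def [abs_def] e'_def [abs_def]
    by simp
  have xac: "xa \<in> carrier_vec (N0 + 2)" and xec: "xe \<in> carrier_vec (N0 + 1)"
    and lac: "la \<in> carrier_vec (N0 + 2)" and loc: "lo \<in> carrier_vec (N0 + 1)"
    unfolding xa_def xe_def la_def lo_def by simp_all
  have Gac: "?Ga *\<^sub>v xa \<in> carrier_vec (N0 + 2)" and Gec: "?Ge *\<^sub>v xe \<in> carrier_vec (N0 + 1)"
    unfolding xa_def xe_def controller_block_mult_vec[OF L0 K0 N] observer_block_mult_vec[OF L0 K0 N] by simp_all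
  have ya: "vec (N0 + 2) (case_nat (- mu * u - ?k) a') = ?Ga *\<^sub>v xa + (S0 + S1 + \<zeta>) \<cdot>\<^sub>v la"
    unfolding xa_def controller_block_mult_vec[OF L0 K0 N] la_def a'_def [abs_def]
    by (intro eq_vecI) (auto simp: algebra_simps split: nat.split)
  have ye: "vec (N0 + 1) e' = ?Ge *\<^sub>v xe + (- (S1 + \<zeta>)) \<cdot>\<^sub>v lo"
    unfolding xe_def observer_block_mult_vec[OF L0 K0 N] lo_def e'_def [abs_def] S0_def[symmetric]
    by (intro eq_vecI) (auto simp: algebra_simps)
  have z: "?l (N0 + 1 + i) = 0" for i by (simp add: obs_gain_def)
  define Sa Sab Se where "Sa = (\<Sum>i<N - N0. lam (N0 + 1 + i) * (a (N0 + 1 + i))\<^sup>2)"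
    and "Sab = (\<Sum>i<N - N0. bcoef (N0 + 1 + i) * a (N0 + 1 + i))"
    and "Se = (\<Sum>i<N - N0. lam (N0 + 1 + i) * (e (N0 + 1 + i))\<^sup>2)"
  have sa: "(\<Sum>i<N - N0. a (N0 + 1 + i) * a' (N0 + 1 + i)) = - Sa - ?k * Sab"
    unfolding a'_def z Sa_def Sab_def
    by (simp add: sum_distrib_left sum_negf sum_subtractf power2_eq_square algebra_simps)
  have se: "(\<Sum>i<N - N0. e (N0 + 1 + i) * e' (N0 + 1 + i)) = - Se"
    unfolding e'_def z Se_def by (simp add: sum_negf power2_eq_square algebra_simps)
  have xbn: "(\<Sum>i<N - N0. a (N0 + 1 + i) * a (N0 + 1 + i)) = (vnorm xb)\<^sup>2"
    and xfn: "(\<Sum>i<N - N0. e (N0 + 1 + i) * e (N0 + 1 + i)) = (vnorm xf)\<^sup>2"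
    unfolding xb_def xf_def vnorm_sq scalar_prod_vec by simp_all
  have lower: "lam (N0 + 1) * (\<Sum>i<N - N0. q i * q i) \<le> (\<Sum>i<N - N0. lam (N0 + 1 + i) * (q i)\<^sup>2)" for q :: "nat \<Rightarrow> real"
    unfolding sum_distrib_left power2_eq_square
    by (intro sum_mono mult_right_mono lam_mono) auto
  have Sal: "lam (N0 + 1) * (vnorm xb)\<^sup>2 \<le> Sa" and Sel: "lam (N0 + 1) * (vnorm xf)\<^sup>2 \<le> Se"
    unfolding xbn[symmetric] xfn[symmetric] Sa_def Se_def by (rule lower)+
  have form1: "x \<bullet> (P *\<^sub>v state_vec N0 N (- mu * u - ?k) a' e') = xa \<bullet> (Pc *\<^sub>v (?Ga *\<^sub>v xa)) + (S0 + S1 + \<zeta>) * (xa \<bullet> (Pc *\<^sub>v la))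
      + pe * (xe \<bullet> (Po *\<^sub>v (?Ge *\<^sub>v xe)) + (- (S1 + \<zeta>)) * (xe \<bullet> (Po *\<^sub>v lo))) + pb * (- Sa - ?k * Sab) + p1 * (- Se)"
    unfolding x_def P_def blockP_form[OF N Pc Po w] ya ye sa se xa_def[symmetric] xe_def[symmetric]
      scalar_prod_mult_add_smult[OF Pcc xac Gac lac] scalar_prod_mult_add_smult[OF Poc xec Gec loc] ..
  have form2: "x \<bullet> (P *\<^sub>v x) = xa \<bullet> (Pc *\<^sub>v xa) + pe * (xe \<bullet> (Po *\<^sub>v xe)) + pb * (vnorm xb)\<^sup>2 + p1 * (vnorm xf)\<^sup>2"
    unfolding x_def P_def blockP_form[OF N Pc Po w] xbn xfn xa_def xe_def ..
  have b1: "(S0 + S1 + \<zeta>) * (xa \<bullet> (Pc *\<^sub>v la)) \<le> m1 * vnorm xa * (m0 * vnorm xe + s1 * vnorm xf + \<bar>\<zeta>\<bar>)"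
  proof -
    have "\<bar>S0 + S1 + \<zeta>\<bar> \<le> m0 * vnorm xe + s1 * vnorm xf + \<bar>\<zeta>\<bar>"
      using m0 s1 unfolding S0_def S1_def by linarith
    then have "\<bar>S0 + S1 + \<zeta>\<bar> * \<bar>xa \<bullet> (Pc *\<^sub>v la)\<bar> \<le> (m0 * vnorm xe + s1 * vnorm xf + \<bar>\<zeta>\<bar>) * (m1 * vnorm xa)"
      by (intro mult_mono m1) auto
    then show ?thesis by (simp add: abs_mult[symmetric] mult.commute)
  qed
  have b2: "(- (S1 + \<zeta>)) * (xe \<bullet> (Po *\<^sub>v lo)) \<le> m2 * vnorm xe * (s1 * vnorm xf + \<bar>\<zeta>\<bar>)"
  proof -
    have "\<bar>- (S1 + \<zeta>)\<bar> \<le> s1 * vnorm xf + \<bar>\<zeta>\<bar>" using s1 unfolding S1_def by linarith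
    then have "\<bar>- (S1 + \<zeta>)\<bar> * \<bar>xe \<bullet> (Po *\<^sub>v lo)\<bar> \<le> (s1 * vnorm xf + \<bar>\<zeta>\<bar>) * (m2 * vnorm xe)"
      by (intro mult_mono m2) auto
    then have "\<bar>(- (S1 + \<zeta>)) * (xe \<bullet> (Po *\<^sub>v lo))\<bar> \<le> m2 * vnorm xe * (s1 * vnorm xf + \<bar>\<zeta>\<bar>)"
      by (simp only: abs_mult mult.commute)
    then show ?thesis by linarith
  qed
  have b3: "- (?k * Sab) \<le> sb * vnorm xb * (mk * vnorm xa)"
  proof -
    have "\<bar>Sab\<bar> * \<bar>?k\<bar> \<le> (sb * vnorm xb) * (mk * vnorm xa)"
      using sb nn(3) unfolding Sab_def by (intro mult_mono mk) auto
    then have "\<bar>?k * Sab\<bar> \<le> sb * vnorm xb * (mk * vnorm xa)" by (simp only: abs_mult mult.commute)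
    then show ?thesis by linarith
  qed
  have "pe * (2 * (xe \<bullet> (Po *\<^sub>v (?Ge *\<^sub>v xe))) + 2 * \<delta> * (xe \<bullet> (Po *\<^sub>v xe))) \<le> pe * (- (\<epsilon>o * (vnorm xe)\<^sup>2))"
    using w o by (intro mult_left_mono) auto
  then have t1: "2 * (pe * (xe \<bullet> (Po *\<^sub>v (?Ge *\<^sub>v xe)))) + 2 * \<delta> * (pe * (xe \<bullet> (Po *\<^sub>v xe))) \<le> - pe * \<epsilon>o * (vnorm xe)\<^sup>2"
    by (simp add: algebra_simps)
  have t2: "2 * (pe * ((- (S1 + \<zeta>)) * (xe \<bullet> (Po *\<^sub>v lo)))) \<le> 2 * pe * (m2 * vnorm xe * (s1 * vnorm xf + \<bar>\<zeta>\<bar>))"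
    using mult_left_mono[OF b2, of "2 * pe"] w by (simp add: mult.assoc)
  have t3: "2 * (pb * (- Sa - ?k * Sab)) + 2 * \<delta> * (pb * (vnorm xb)\<^sup>2)
      \<le> - 2 * pb * \<eta> * (vnorm xb)\<^sup>2 + 2 * pb * (sb * vnorm xb * (mk * vnorm xa))"
  proof -
    have "- Sa - ?k * Sab + \<delta> * (vnorm xb)\<^sup>2 \<le> - \<eta> * (vnorm xb)\<^sup>2 + sb * vnorm xb * (mk * vnorm xa)"
      using Sal b3 unfolding \<eta> by (simp add: left_diff_distrib)
    from mult_left_mono[OF this, of "2 * pb"] w show ?thesis by (simp add: algebra_simps)
  qed
  have t4: "2 * (p1 * (- Se)) + 2 * \<delta> * (p1 * (vnorm xf)\<^sup>2) \<le> - 2 * p1 * \<eta> * (vnorm xf)\<^sup>2"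
  proof -
    have "- Se + \<delta> * (vnorm xf)\<^sup>2 \<le> - \<eta> * (vnorm xf)\<^sup>2"
      using Sel unfolding \<eta> by (simp add: left_diff_distrib)
    from mult_left_mono[OF this, of "2 * p1"] w show ?thesis by (simp add: algebra_simps)
  qed
  have comb: "2 * (A + B + pe * (D + E) + G + H) + 2 * \<delta> * (A' + D' + G' + H')
      = (2 * A + 2 * \<delta> * A') + 2 * B + (2 * (pe * D) + 2 * \<delta> * D') + 2 * (pe * E) + (2 * G + 2 * \<delta> * G') + (2 * H + 2 * \<delta> * H')"
    for A B D E G H A' D' G' H' :: real
    by (simp add: algebra_simps)
  show ?thesis
    unfolding y form1 form2 comb using c b1 t1 t2 t3 t4 by linarith
qed

text \<open>Suppose that the linear part decays with a margin \<open>c\<close>, up to a term in \<open>\<zeta>\<^sup>2\<close> that \<open>\<rho>\<close> outweighs.  A large \<open>\<alpha>\<close>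
  then absorbs the columns \<open>P\<^sub>X\<close> of the nonlinear terms by Young's inequality, and a small \<open>\<sigma>\<close> the terms \<open>\<alpha> \<sigma>\<^sup>2\<close>
  that this creates.\<close>

lemma Psi0_neg_def:
  fixes N0 N :: nat and L0 K0 P :: "real mat" and xs \<delta> \<sigma> \<Gamma> \<alpha> c Cp r0 :: real
  assumes L0: "L0 \<in> carrier_mat (N0 + 1) 1" and K0: "K0 \<in> carrier_mat 1 (N0 + 2)" and N: "N0 \<le> N"
    and P: "P \<in> carrier_mat (2 * N + 3) (2 * N + 3)" "P\<^sup>T = P"
    and Cp: "\<And>x y. x \<in> carrier_vec (2 * N + 3) \<Longrightarrow> y \<in> carrier_vec (2 * N + 3) \<Longrightarrow>
      \<bar>x \<bullet> (P *\<^sub>v y)\<bar> \<le> Cp * vnorm x * vnorm y"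
    and lin: "\<And>u a e \<zeta>. 2 * (state_vec N0 N u a e \<bullet> (P *\<^sub>v (FX N0 N xs L0 K0 *\<^sub>v state_vec N0 N u a e
        + Lzeta N0 N L0 *\<^sub>v vec 1 (\<lambda>_. \<zeta>)))) + 2 * \<delta> * (state_vec N0 N u a e \<bullet> (P *\<^sub>v state_vec N0 N u a e))
        + 2 * xi N / pi\<^sup>2 * (feedback N0 K0 u a)\<^sup>2
      \<le> - c * (state_vec N0 N u a e \<bullet> state_vec N0 N u a e) + r0 * \<zeta>\<^sup>2"
    and rho: "2 * rho \<delta> \<sigma> \<Gamma> \<alpha> \<alpha> 1 N \<le> - (r0 + c) + \<alpha> * \<sigma>\<^sup>2"
    and c: "c > 0" and \<alpha>: "\<alpha> > 0" "16 * Cp\<^sup>2 \<le> c * \<alpha>" and \<sigma>: "8 * \<alpha> * \<sigma>\<^sup>2 \<le> c"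
  shows "neg_def (6 * N + 10) (Psi0 \<delta> \<sigma> \<Gamma> xs N0 N L0 K0 P \<alpha> \<alpha> 1)"
proof (rule neg_defI[OF Psi0_carrier[OF L0 K0 N P(1)] Psi0_symmetric[OF L0 K0 N P]])
  fix v :: "real vec" assume v: "v \<in> carrier_vec (6 * N + 10)" and nz: "v \<noteq> 0\<^sub>v (6 * N + 10)"
  obtain x r y z where s: "x \<in> carrier_vec (2 * N + 3)" "y \<in> carrier_vec (2 * N + 3)" "z \<in> carrier_vec (2 * N + 3)"
    "v = x @\<^sub>v vec 1 (\<lambda>_. r) @\<^sub>v y @\<^sub>v z" by (rule Psi0_vec_split[OF L0 K0 N P v])
  obtain u a e where x: "x = state_vec N0 N u a e" using s(1) by (elim state_vec_surj[OF N])
  let ?k = "feedback N0 K0 u a"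
  define X Y Z where "X = x \<bullet> x" and "Y = y \<bullet> y" and "Z = z \<bullet> z"
  have XYZ: "0 \<le> X" "0 \<le> Y" "0 \<le> Z" unfolding X_def Y_def Z_def by (rule scalar_prod_self_nonneg)+
  have Xn: "(vnorm x)\<^sup>2 = X" "(vnorm y)\<^sup>2 = Y" "(vnorm z)\<^sup>2 = Z"
    unfolding X_def Y_def Z_def by (rule vnorm_sq)+
  have "0 < v \<bullet> v" by (rule scalar_prod_self_pos[OF v nz])
  also have "v \<bullet> v = X + (r\<^sup>2 + (Y + Z))"
    unfolding s(4) X_def Y_def Z_def
    by (simp only: scalar_prod_append[of _ "2 * N + 3" _ "1 + ((2 * N + 3) + (2 * N + 3))"]
      scalar_prod_append[of _ 1 _ "(2 * N + 3) + (2 * N + 3)"] scalar_prod_append[of _ "2 * N + 3" _ "2 * N + 3"]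
      s(1-3) append_carrier_vec vec_carrier scalar_prod_vec) (simp add: power2_eq_square)
  finally have pos: "0 < X + (r\<^sup>2 + (Y + Z))" .
  let ?w = "FX N0 N xs L0 K0 *\<^sub>v x" and ?l = "Lzeta N0 N L0 *\<^sub>v vec 1 (\<lambda>_. r)"
  have wc: "?w \<in> carrier_vec (2 * N + 3)" by (rule mult_mat_vec_carrier[OF block_carriers(1)[OF L0 K0 N] s(1)])
  have lc: "?l \<in> carrier_vec (2 * N + 3)" by (rule mult_mat_vec_carrier[OF block_carriers(2)[OF L0 K0 N] vec_carrier])
  have add: "x \<bullet> (P *\<^sub>v (p + q)) = x \<bullet> (P *\<^sub>v p) + x \<bullet> (P *\<^sub>v q)"
    if "p \<in> carrier_vec (2 * N + 3)" "q \<in> carrier_vec (2 * N + 3)" for p q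
    unfolding mult_add_distrib_mat_vec[OF P(1) that] using P s(1) that
    by (intro scalar_prod_add_distrib[of _ "2 * N + 3"]) auto
  have split: "x \<bullet> (P *\<^sub>v (?w + (?l + (y + z)))) = x \<bullet> (P *\<^sub>v (?w + ?l)) + (x \<bullet> (P *\<^sub>v y) + x \<bullet> (P *\<^sub>v z))"
    by (simp only: add wc lc s(2,3) add_carrier_vec add.assoc)
  have a2: "\<alpha> / 2 > 0" using \<alpha> by simp
  have coupling: "2 * (x \<bullet> (P *\<^sub>v q)) \<le> c / 8 * X + \<alpha> / 2 * (vnorm q)\<^sup>2" if "q \<in> carrier_vec (2 * N + 3)" for q
  proof -
    have "2 * (x \<bullet> (P *\<^sub>v q)) \<le> 2 * (Cp * vnorm x) * vnorm q" using Cp[OF s(1) that] by linarith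
    also have "\<dots> \<le> (Cp * vnorm x)\<^sup>2 / (\<alpha> / 2) + \<alpha> / 2 * (vnorm q)\<^sup>2" by (rule Young[OF a2])
    also have "(Cp * vnorm x)\<^sup>2 / (\<alpha> / 2) = 2 * Cp\<^sup>2 / \<alpha> * X" using Xn by (simp add: power_mult_distrib)
    also have "2 * Cp\<^sup>2 / \<alpha> * X \<le> c / 8 * X"
      using \<alpha> XYZ by (intro mult_right_mono) (simp_all add: field_simps)
    finally show ?thesis by simp
  qed
  have xe: "X = u\<^sup>2 + (\<Sum>n\<le>N. (a n)\<^sup>2) + (\<Sum>n\<le>N. (e n)\<^sup>2)"
    unfolding X_def x state_vec_inner[OF N] by (simp add: power2_eq_square)
  have sig: "2 * \<alpha> * \<sigma>\<^sup>2 * (2 / pi\<^sup>2 * u\<^sup>2 + (\<Sum>n\<le>N. (a n)\<^sup>2)) + \<alpha> * \<sigma>\<^sup>2 * (\<Sum>n\<le>N. (e n)\<^sup>2) \<le> c / 4 * X"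
  proof -
    have s0: "0 \<le> 2 * \<alpha> * \<sigma>\<^sup>2" "\<alpha> * \<sigma>\<^sup>2 \<le> 2 * \<alpha> * \<sigma>\<^sup>2" using \<alpha> by simp_all
    have "(3 :: real)\<^sup>2 \<le> pi\<^sup>2" using pi_gt3 by (intro power_mono) auto
    then have "2 / pi\<^sup>2 \<le> 1" by simp
    then have "2 / pi\<^sup>2 * u\<^sup>2 \<le> 1 * u\<^sup>2" by (intro mult_right_mono) auto
    then have "2 * \<alpha> * \<sigma>\<^sup>2 * (2 / pi\<^sup>2 * u\<^sup>2 + (\<Sum>n\<le>N. (a n)\<^sup>2)) \<le> 2 * \<alpha> * \<sigma>\<^sup>2 * (u\<^sup>2 + (\<Sum>n\<le>N. (a n)\<^sup>2))"
      by (intro mult_left_mono s0) simp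
    moreover have "\<alpha> * \<sigma>\<^sup>2 * (\<Sum>n\<le>N. (e n)\<^sup>2) \<le> 2 * \<alpha> * \<sigma>\<^sup>2 * (\<Sum>n\<le>N. (e n)\<^sup>2)"
      by (intro mult_right_mono s0 sum_nonneg) simp
    moreover have "2 * \<alpha> * \<sigma>\<^sup>2 * (u\<^sup>2 + (\<Sum>n\<le>N. (a n)\<^sup>2)) + 2 * \<alpha> * \<sigma>\<^sup>2 * (\<Sum>n\<le>N. (e n)\<^sup>2) = 2 * \<alpha> * \<sigma>\<^sup>2 * X"
      unfolding xe by (simp only: distrib_left)
    moreover have "2 * \<alpha> * \<sigma>\<^sup>2 * X \<le> c / 4 * X" using \<sigma> XYZ by (intro mult_right_mono) auto
    ultimately show ?thesis by linarith
  qed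
  have rr: "2 * rho \<delta> \<sigma> \<Gamma> \<alpha> \<alpha> 1 N * r\<^sup>2 \<le> - r0 * r\<^sup>2 - c / 2 * r\<^sup>2"
  proof -
    have "2 * rho \<delta> \<sigma> \<Gamma> \<alpha> \<alpha> 1 N \<le> - r0 - c / 2" using rho \<sigma> c by linarith
    from mult_right_mono[OF this, of "r\<^sup>2"] show ?thesis by (simp only: left_diff_distrib zero_le_power2)
  qed
  have "v \<bullet> (Psi0 \<delta> \<sigma> \<Gamma> xs N0 N L0 K0 P \<alpha> \<alpha> 1 *\<^sub>v v) = 2 * (x \<bullet> (P *\<^sub>v (?w + (?l + (y + z)))))
      + 2 * \<delta> * (x \<bullet> (P *\<^sub>v x)) + 2 * 1 * xi N / pi\<^sup>2 * ?k\<^sup>2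
      + 2 * \<alpha> * \<sigma>\<^sup>2 * (2 / pi\<^sup>2 * u\<^sup>2 + (\<Sum>n\<le>N. (a n)\<^sup>2)) + \<alpha> * \<sigma>\<^sup>2 * (\<Sum>n\<le>N. (e n)\<^sup>2)
      + 2 * rho \<delta> \<sigma> \<Gamma> \<alpha> \<alpha> 1 N * r\<^sup>2 - \<alpha> * Y - \<alpha> * Z"
    unfolding s(4) x Psi0_quadratic[OF L0 K0 N P s(2,3)] Y_def Z_def ..
  also have "\<dots> \<le> - (c / 2) * X - c / 2 * r\<^sup>2 - \<alpha> / 2 * Y - \<alpha> / 2 * Z"
  proof -
    have comb: "2 * (wl + (p + q)) + d + 2 * 1 * xi N / pi\<^sup>2 * ?k\<^sup>2 + s1 + s2 + rr - \<alpha> * Y - \<alpha> * Z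
        \<le> - (c / 2) * X - c / 2 * r\<^sup>2 - \<alpha> / 2 * Y - \<alpha> / 2 * Z"
      if "2 * wl + d + 2 * xi N / pi\<^sup>2 * ?k\<^sup>2 \<le> - c * X + r0 * r\<^sup>2" "2 * p \<le> c / 8 * X + \<alpha> / 2 * Y"
        "2 * q \<le> c / 8 * X + \<alpha> / 2 * Z" "s1 + s2 \<le> c / 4 * X" "rr \<le> - r0 * r\<^sup>2 - c / 2 * r\<^sup>2"
      for wl p q d s1 s2 rr
    proof -
      have n: "- c * X = - (c * X)" "c / 8 * X = c * X / 8" "c / 4 * X = c * X / 4" "- (c / 2) * X = - (c * X / 2)"
        "\<alpha> / 2 * Y = \<alpha> * Y / 2" "\<alpha> / 2 * Z = \<alpha> * Z / 2" "- r0 * r\<^sup>2 = - (r0 * r\<^sup>2)"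
        "2 * 1 * xi N / pi\<^sup>2 * ?k\<^sup>2 = 2 * xi N / pi\<^sup>2 * ?k\<^sup>2"
        by simp_all
      have "2 * (wl + (p + q)) + d + ke + s1 + s2 + rr - aY - aZ \<le> - (cX / 2) - cr - aY / 2 - aZ / 2"
        if "2 * wl + d + ke \<le> - cX + rr0" "2 * p \<le> cX / 8 + aY / 2" "2 * q \<le> cX / 8 + aZ / 2"
          "s1 + s2 \<le> cX / 4" "rr \<le> - rr0 - cr" for ke cX rr0 cr aY aZ :: real
        using that unfolding distrib_left by linarith
      from this[OF that[unfolded n]] show ?thesis unfolding n .
    qed
    show ?thesis
      unfolding split
      by (rule comb[OF lin[of u a e r, folded x X_def] coupling[OF s(2), unfolded Xn] coupling[OF s(3), unfolded Xn] sig rr])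
  qed
  also have "\<dots> < 0"
  proof -
    have n: "0 \<le> c / 2 * X" "0 \<le> c / 2 * r\<^sup>2" "0 \<le> \<alpha> / 2 * Y" "0 \<le> \<alpha> / 2 * Z"
      using c \<alpha> XYZ by simp_all
    have "- (c / 2) * X = - (c / 2 * X)" by simp
    moreover consider "0 < X" | "0 < r\<^sup>2" | "0 < Y" | "0 < Z" using pos by linarith
    then have "0 < c / 2 * X \<or> 0 < c / 2 * r\<^sup>2 \<or> 0 < \<alpha> / 2 * Y \<or> 0 < \<alpha> / 2 * Z"
      using c \<alpha> by cases simp_all
    ultimately show ?thesis using n by linarith
  qed
  finally show "v \<bullet> (Psi0 \<delta> \<sigma> \<Gamma> xs N0 N L0 K0 P \<alpha> \<alpha> 1 *\<^sub>v v) < 0" .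
qed

text \<open>Everything rests on the order of the choices.  The margins and the weight \<open>pe\<close> are independent of \<open>N\<close>; then
  \<open>N\<close> is taken so large that \<open>\<xi>\<close> and \<open>\<rho>\<close> satisfy bounds in terms of these; the weights \<open>pb\<close> and \<open>p1\<close>, the
  multiplier \<open>\<alpha>\<close> and finally \<open>\<sigma>\<close> may depend on \<open>N\<close>.\<close>

lemma Psi0_feasible:
  fixes \<delta> \<Gamma> xs :: real and N0 :: nat and L0 K0 Po Pc :: "real mat"
  assumes pos: "\<delta> > 0" "\<Gamma> > 0"
    and L0: "L0 \<in> carrier_mat (N0 + 1) 1" and K0: "K0 \<in> carrier_mat 1 (N0 + 2)"
    and Po: "pos_def (N0 + 1) Po" and lo: "mat_less (N0 + 1)
        (Po * (A0 N0 - L0 * C0 N0 xs) + (A0 N0 - L0 * C0 N0 xs)\<^sup>T * Po) ((- 2 * \<delta>) \<cdot>\<^sub>m Po)"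
    and Pc: "pos_def (N0 + 2) Pc" and lc: "mat_less (N0 + 2)
        (Pc * (A0t N0 - B0t N0 * K0) + (A0t N0 - B0t N0 * K0)\<^sup>T * Pc) ((- 2 * \<delta>) \<cdot>\<^sub>m Pc)"
    and gap: "lam (N0 + 1) > \<delta>"
  shows "\<exists>Ns. Ns \<ge> 1 \<and> Ns \<ge> N0 \<and>
          (\<forall>N\<ge>Ns. \<exists>\<sigma>s>0. \<forall>\<sigma>. 0 < \<sigma> \<and> \<sigma> \<le> \<sigma>s \<longrightarrow>
             (\<exists>PX \<alpha>1 \<alpha>2 \<alpha>3. pos_def (2 * N + 3) PX \<and> \<alpha>1 > 0 \<and> \<alpha>2 > 0 \<and> \<alpha>3 > 0 \<and>
                neg_def (6 * N + 10) (Psi0 \<delta> \<sigma> \<Gamma> xs N0 N L0 K0 PX \<alpha>1 \<alpha>2 \<alpha>3)))"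
proof -
  let ?Ga = "A0t N0 - B0t N0 * K0" and ?Ge = "A0 N0 - L0 * C0 N0 xs"
  define la lv where "la = vec (N0 + 2) (case_nat 0 (obs_gain N0 L0))" and "lv = vec (N0 + 1) (obs_gain N0 L0)"
  have Gac: "?Ga \<in> carrier_mat (N0 + 2) (N0 + 2)"
    unfolding B0t_eq by (rule minus_carrier_mat[OF mult_carrier_mat[OF col_mat_carrier K0]])
  have Gec: "?Ge \<in> carrier_mat (N0 + 1) (N0 + 1)"
    unfolding C0_def by (rule minus_carrier_mat[OF mult_carrier_mat[OF L0 row_mat_carrier]])
  \<comment> \<open>gains that do not depend on \<open>N\<close>\<close>
  from lyapunov_margin[OF Pc Gac lc] obtain \<epsilon>c where ec: "\<epsilon>c > 0" "\<And>x. x \<in> carrier_vec (N0 + 2) \<Longrightarrow>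
      2 * (x \<bullet> (Pc *\<^sub>v (?Ga *\<^sub>v x))) + 2 * \<delta> * (x \<bullet> (Pc *\<^sub>v x)) \<le> - (\<epsilon>c * (vnorm x)\<^sup>2)" by blast
  from lyapunov_margin[OF Po Gec lo] obtain \<epsilon>o where eo: "\<epsilon>o > 0" "\<And>x. x \<in> carrier_vec (N0 + 1) \<Longrightarrow>
      2 * (x \<bullet> (Po *\<^sub>v (?Ge *\<^sub>v x))) + 2 * \<delta> * (x \<bullet> (Po *\<^sub>v x)) \<le> - (\<epsilon>o * (vnorm x)\<^sup>2)" by blast
  have Pcc: "Pc \<in> carrier_mat (N0 + 2) (N0 + 2)" and Poc: "Po \<in> carrier_mat (N0 + 1) (N0 + 1)"
    using Pc Po by (auto simp: pos_def_def)
  from bilinear_bounded[OF Pcc] obtain C1 where C1: "C1 \<ge> 0" "\<And>x y. x \<in> carrier_vec (N0 + 2) \<Longrightarrow>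
      y \<in> carrier_vec (N0 + 2) \<Longrightarrow> \<bar>x \<bullet> (Pc *\<^sub>v y)\<bar> \<le> C1 * vnorm x * vnorm y" by blast
  from bilinear_bounded[OF Poc] obtain C2 where C2: "C2 \<ge> 0" "\<And>x y. x \<in> carrier_vec (N0 + 1) \<Longrightarrow>
      y \<in> carrier_vec (N0 + 1) \<Longrightarrow> \<bar>x \<bullet> (Po *\<^sub>v y)\<bar> \<le> C2 * vnorm x * vnorm y" by blast
  define m1 m2 where "m1 = C1 * vnorm la" and "m2 = C2 * vnorm lv"
  have m12: "0 \<le> m1" "0 \<le> m2" using C1(1) C2(1) by (simp_all add: m1_def m2_def)
  have m1: "\<bar>x \<bullet> (Pc *\<^sub>v la)\<bar> \<le> m1 * vnorm x" if "x \<in> carrier_vec (N0 + 2)" for x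
    using C1(2)[OF that, of la] by (simp add: m1_def la_def mult_ac)
  have m2: "\<bar>x \<bullet> (Po *\<^sub>v lv)\<bar> \<le> m2 * vnorm x" if "x \<in> carrier_vec (N0 + 1)" for x
    using C2(2)[OF that, of lv] by (simp add: m2_def lv_def mult_ac)
  from row_bounded[where n = "N0 + 1" and f = "ccoef xs"] obtain m0 where
    m0: "\<And>e. \<bar>\<Sum>i<N0 + 1. ccoef xs i * e i\<bar> \<le> m0 * vnorm (vec (N0 + 1) e)" by blast
  from row_bounded[where n = "N0 + 2" and f = "\<lambda>i. K0 $$ (0, i)"] obtain mk where
    mk: "\<And>f. \<bar>\<Sum>i<N0 + 2. K0 $$ (0, i) * f i\<bar> \<le> mk * vnorm (vec (N0 + 2) f)" by blast
  define pe where "pe = 32 * (m1 * m0)\<^sup>2 / \<epsilon>c / \<epsilon>o + 1"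
  have pe: "pe > 0" "8 * (m1 * m0)\<^sup>2 / \<epsilon>c \<le> pe * \<epsilon>o / 4"
  proof -
    show "pe > 0" unfolding pe_def using ec(1) eo(1) by (intro add_nonneg_pos) auto
    have "pe * \<epsilon>o = 32 * (m1 * m0)\<^sup>2 / \<epsilon>c + \<epsilon>o" unfolding pe_def using eo(1) by (simp add: distrib_right)
    then show "8 * (m1 * m0)\<^sup>2 / \<epsilon>c \<le> pe * \<epsilon>o / 4" using eo(1) by simp
  qed
  define R where "R = 8 * m1\<^sup>2 / \<epsilon>c + 4 * pe * m2\<^sup>2 / \<epsilon>o"
  have R: "R \<ge> 0" unfolding R_def using ec(1) eo(1) pe(1) by simp
  obtain n1 :: nat where n1: "2 * \<delta> + 1 + (1 + \<Gamma> + inverse \<Gamma>) * (R + 1) \<le> real n1"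
    using real_arch_simple by blast
  obtain n2 :: nat where n2: "8 * mk\<^sup>2 / \<epsilon>c \<le> real n2"
    using real_arch_simple by blast
  define \<eta> where "\<eta> = lam (N0 + 1) - \<delta>"
  have eta: "\<eta> > 0" using gap by (simp add: \<eta>_def)
  define Ns where "Ns = max (max 1 N0) (max n1 n2)"
  show ?thesis
  proof (intro exI[of _ Ns] conjI allI impI)
    show "Ns \<ge> 1" "Ns \<ge> N0" unfolding Ns_def by auto
    fix N assume "Ns \<le> N"
    then have N: "N \<ge> 1" "N0 \<le> N" "real n1 \<le> real N" "real n2 \<le> real N" unfolding Ns_def by auto
    \<comment> \<open>gains and weights for this \<open>N\<close>\<close>
    from row_bounded[where n = "N - N0" and f = "\<lambda>i. ccoef xs (N0 + 1 + i)"] obtain s1 where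
      s1: "\<And>f. \<bar>\<Sum>i<N - N0. ccoef xs (N0 + 1 + i) * f i\<bar> \<le> s1 * vnorm (vec (N - N0) f)" by blast
    from row_bounded[where n = "N - N0" and f = "\<lambda>i. bcoef (N0 + 1 + i)"] obtain sb where
      sb: "sb \<ge> 0" "\<And>f. \<bar>\<Sum>i<N - N0. bcoef (N0 + 1 + i) * f i\<bar> \<le> sb * vnorm (vec (N - N0) f)" by blast
    define pb p1 where "pb = \<eta> * \<epsilon>c / (8 * ((sb * mk)\<^sup>2 + 1))"
      and "p1 = (8 * (m1 * s1)\<^sup>2 / \<epsilon>c + 4 * pe * (m2 * s1)\<^sup>2 / \<epsilon>o) / \<eta> + 1"
    have pb: "pb > 0"
      unfolding pb_def using eta ec(1) by (intro divide_pos_pos mult_pos_pos) (auto intro: add_nonneg_pos)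
    have p1: "p1 > 0"
      unfolding p1_def using eta ec(1) eo(1) pe(1) by (intro add_nonneg_pos divide_nonneg_pos add_nonneg_nonneg) auto
    define P where "P = blockP N0 N Pc Po pe pb p1"
    note w = pe(1) pb p1
    have Pd: "pos_def (2 * N + 3) P" and Pcar: "P \<in> carrier_mat (2 * N + 3) (2 * N + 3)" and Psym: "P\<^sup>T = P"
      unfolding P_def by (rule blockP_pos_def[OF N(2) Pc Po w] blockP_carrier[OF N(2) Pc Po w] blockP_sym[OF N(2) Pc Po w])+
    define c where "c = Min {3 * \<epsilon>c / 8, pe * \<epsilon>o / 4, pb * \<eta>, p1 * \<eta>, 1}"
    have c: "c > 0" unfolding c_def using ec(1) eo(1) w eta by simp
    have cle: "c \<le> 3 * \<epsilon>c / 8" "c \<le> pe * \<epsilon>o / 4" "c \<le> pb * \<eta>" "c \<le> p1 * \<eta>" "c \<le> 1"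
      unfolding c_def by simp_all
    have xk: "2 * xi N / pi\<^sup>2 * mk\<^sup>2 \<le> \<epsilon>c / 8"
    proof -
      have "2 * xi N / pi\<^sup>2 * mk\<^sup>2 \<le> 1 / real N * mk\<^sup>2"
        by (intro mult_right_mono xi_bound N) auto
      also have "\<dots> \<le> \<epsilon>c / 8"
        using order_trans[OF n2 N(4)] ec(1) N(1) by (simp add: field_simps)
      finally show ?thesis .
    qed
    have lin: "2 * (state_vec N0 N u a e \<bullet> (P *\<^sub>v (FX N0 N xs L0 K0 *\<^sub>v state_vec N0 N u a e
        + Lzeta N0 N L0 *\<^sub>v vec 1 (\<lambda>_. \<zeta>)))) + 2 * \<delta> * (state_vec N0 N u a e \<bullet> (P *\<^sub>v state_vec N0 N u a e))
        + 2 * xi N / pi\<^sup>2 * (feedback N0 K0 u a)\<^sup>2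
      \<le> - c * (state_vec N0 N u a e \<bullet> state_vec N0 N u a e) + R * \<zeta>\<^sup>2" for u a e \<zeta>
    proof -
      define A E B G where "A = vnorm (vec (N0 + 2) (case_nat u a))" and "E = vnorm (vec (N0 + 1) e)"
        and "B = vnorm (vec (N - N0) (\<lambda>i. a (N0 + 1 + i)))" and "G = vnorm (vec (N - N0) (\<lambda>i. e (N0 + 1 + i)))"
      have k: "\<bar>feedback N0 K0 u a\<bar> \<le> mk * A" unfolding feedback_def A_def by (rule mk)
      note d = blockP_derivative[where u = u and a = a and e = e and \<zeta> = \<zeta>, OF L0 K0 N(2) Pc Po w ec(2)[OF vec_carrier] eo(2)[OF vec_carrier]
          m1[OF vec_carrier, unfolded la_def] m2[OF vec_carrier, unfolded lv_def] m0 k[unfolded A_def] s1 sb(2) m12 sb(1) \<eta>_def,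
          folded A_def E_def B_def G_def P_def]
      have "(feedback N0 K0 u a)\<^sup>2 \<le> (mk * A)\<^sup>2"
        using k by (metis abs_ge_zero power2_abs power_mono)
      moreover have "0 \<le> 2 * xi N / pi\<^sup>2" unfolding xi_def by simp
      ultimately have k2: "2 * xi N / pi\<^sup>2 * (feedback N0 K0 u a)\<^sup>2 \<le> 2 * xi N / pi\<^sup>2 * (mk * A)\<^sup>2"
        by (rule mult_left_mono)
      note casc = cascade_inequality[OF ec(1) eo(1) eta pe xk, where A = A and E = E and B = B and G = G
          and z = "\<bar>\<zeta>\<bar>" and sb = sb and ?s1.0 = s1 and ?m2.0 = m2, folded pb_def p1_def R_def]
      have n: "(vnorm (vec (N0 + 2) (case_nat u a)))\<^sup>2 + (vnorm (vec (N0 + 1) e))\<^sup>2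
          + (vnorm (vec (N - N0) (\<lambda>i. a (N0 + 1 + i))))\<^sup>2 + (vnorm (vec (N - N0) (\<lambda>i. e (N0 + 1 + i))))\<^sup>2
          = A\<^sup>2 + E\<^sup>2 + B\<^sup>2 + G\<^sup>2"
        by (simp add: A_def E_def B_def G_def)
      have "c * A\<^sup>2 \<le> 3 * \<epsilon>c / 8 * A\<^sup>2" "c * E\<^sup>2 \<le> pe * \<epsilon>o / 4 * E\<^sup>2" "c * B\<^sup>2 \<le> pb * \<eta> * B\<^sup>2" "c * G\<^sup>2 \<le> p1 * \<eta> * G\<^sup>2"
        by (intro mult_right_mono cle zero_le_power2)+
      moreover have "- c * (A\<^sup>2 + E\<^sup>2 + B\<^sup>2 + G\<^sup>2) = - (c * A\<^sup>2) - c * E\<^sup>2 - c * B\<^sup>2 - c * G\<^sup>2"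
        by (simp add: algebra_simps)
      moreover have "- (3 * \<epsilon>c / 8) * A\<^sup>2 = - (3 * \<epsilon>c / 8 * A\<^sup>2)" by simp
      ultimately show ?thesis
        unfolding state_vec_blocks_norm[OF N(2) Pc Po w] n
        using d k2 casc[unfolded power2_abs] by linarith
    qed
    from bilinear_bounded[OF Pcar] obtain Cp where Cp: "Cp \<ge> 0" "\<And>x y. x \<in> carrier_vec (2 * N + 3) \<Longrightarrow>
      y \<in> carrier_vec (2 * N + 3) \<Longrightarrow> \<bar>x \<bullet> (P *\<^sub>v y)\<bar> \<le> Cp * vnorm x * vnorm y" by blast
    define \<alpha> where "\<alpha> = 2 + 16 * Cp\<^sup>2 / c"
    have \<alpha>: "\<alpha> \<ge> 2" unfolding \<alpha>_def using c by simp
    then have \<alpha>0: "\<alpha> > 0" by linarith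
    have \<alpha>c: "16 * Cp\<^sup>2 \<le> c * \<alpha>" unfolding \<alpha>_def using c by (simp add: distrib_left)
    define \<sigma>s where "\<sigma>s = sqrt (c / (8 * \<alpha>))"
    have \<sigma>s: "\<sigma>s > 0" unfolding \<sigma>s_def using c \<alpha> by simp
    have feas: "\<exists>PX \<alpha>1 \<alpha>2 \<alpha>3. pos_def (2 * N + 3) PX \<and> \<alpha>1 > 0 \<and> \<alpha>2 > 0 \<and> \<alpha>3 > 0 \<and>
        neg_def (6 * N + 10) (Psi0 \<delta> \<sigma> \<Gamma> xs N0 N L0 K0 PX \<alpha>1 \<alpha>2 \<alpha>3)" if s: "0 < \<sigma> \<and> \<sigma> \<le> \<sigma>s" for \<sigma>
    proof -
      have "\<sigma>\<^sup>2 \<le> \<sigma>s\<^sup>2" using s by (intro power_mono) auto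
      also have "\<dots> = c / (8 * \<alpha>)" unfolding \<sigma>s_def using c \<alpha> by simp
      finally have "8 * \<alpha> * \<sigma>\<^sup>2 \<le> 8 * \<alpha> * (c / (8 * \<alpha>))" using \<alpha> by (intro mult_left_mono) auto
      then have sc: "8 * \<alpha> * \<sigma>\<^sup>2 \<le> c" using \<alpha> by simp
      have "2 * rho \<delta> \<sigma> \<Gamma> \<alpha> \<alpha> 1 N \<le> - (R + 1) + \<alpha> * \<sigma>\<^sup>2"
        by (rule rho_below_for_large_N[OF pos(2,1) order_trans[OF n1 N(3)] _ \<alpha>]) (use R in simp)
      then have rho: "2 * rho \<delta> \<sigma> \<Gamma> \<alpha> \<alpha> 1 N \<le> - (R + c) + \<alpha> * \<sigma>\<^sup>2" using cle(5) by linarith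
      have neg: "neg_def (6 * N + 10) (Psi0 \<delta> \<sigma> \<Gamma> xs N0 N L0 K0 P \<alpha> \<alpha> 1)"
        by (rule Psi0_neg_def[OF L0 K0 N(2) Pcar Psym Cp(2) lin rho c \<alpha>0 \<alpha>c sc])
      have one: "(0 :: real) < 1" by simp
      from conjI[OF Pd conjI[OF \<alpha>0 conjI[OF \<alpha>0 conjI[OF one neg]]]]
      show ?thesis by (intro exI)
    qed
    show "\<exists>\<sigma>s>0. \<forall>\<sigma>. 0 < \<sigma> \<and> \<sigma> \<le> \<sigma>s \<longrightarrow>
             (\<exists>PX \<alpha>1 \<alpha>2 \<alpha>3. pos_def (2 * N + 3) PX \<and> \<alpha>1 > 0 \<and> \<alpha>2 > 0 \<and> \<alpha>3 > 0 \<and>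
                neg_def (6 * N + 10) (Psi0 \<delta> \<sigma> \<Gamma> xs N0 N L0 K0 PX \<alpha>1 \<alpha>2 \<alpha>3))" 
      by (rule exI[of _ \<sigma>s], intro conjI allI impI, rule \<sigma>s, rule feas)
  qed
qed

section \<open>Exponential stability and feasibility\<close>

theorem theorem2p1:
  fixes \<delta> \<Gamma> xs :: real and N0 :: nat and L0 K0 :: "real mat"
  assumes "\<delta> > 0" and "\<Gamma> > 0" and "xs \<in> {0..1}"
    and "L0 \<in> carrier_mat (N0 + 1) 1" and "K0 \<in> carrier_mat 1 (N0 + 2)"
    and "\<exists>Po. pos_def (N0 + 1) Po \<and>
      mat_less (N0 + 1)
        (Po * (A0 N0 - L0 * C0 N0 xs) + (A0 N0 - L0 * C0 N0 xs)\<^sup>T * Po)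
        ((- 2 * \<delta>) \<cdot>\<^sub>m Po)"
    and "\<exists>Pc. pos_def (N0 + 2) Pc \<and>
      mat_less (N0 + 2)
        (Pc * (A0t N0 - B0t N0 * K0) + (A0t N0 - B0t N0 * K0)\<^sup>T * Pc)
        ((- 2 * \<delta>) \<cdot>\<^sub>m Pc)"
  shows
    "(\<forall>(\<sigma>::real) (g :: real \<Rightarrow> real \<Rightarrow> real \<Rightarrow> real) (N::nat).
        \<sigma> > 0 \<longrightarrow>
        locally_lipschitz (\<lambda>(t, x, z). g t x z) \<longrightarrow>
        (\<forall>t x. g t x 0 = 0) \<longrightarrow>
        (\<forall>t x z1 z2. z1 \<noteq> z2 \<longrightarrow> \<bar>g t x z1 - g t x z2\<bar> / \<bar>z1 - z2\<bar> \<le> \<sigma>) \<longrightarrow>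
        (\<forall>n>N0. - lam n + \<sigma> < - \<delta>) \<longrightarrow>
        N \<ge> 1 \<longrightarrow> N \<ge> N0 \<longrightarrow>
        (\<forall>n\<le>N0. ccoef xs n \<noteq> 0) \<longrightarrow>
        (\<exists>PX \<alpha>1 \<alpha>2 \<alpha>3. pos_def (2 * N + 3) PX \<and> \<alpha>1 > 0 \<and> \<alpha>2 > 0 \<and> \<alpha>3 > 0 \<and>
           neg_def (6 * N + 10) (Psi0 \<delta> \<sigma> \<Gamma> xs N0 N L0 K0 PX \<alpha>1 \<alpha>2 \<alpha>3)) \<longrightarrow>
        (\<exists>D\<ge>1. \<forall>w0\<in>H1. \<forall>u w wh. closed_loop_solution g xs N0 N L0 K0 w0 u w wh \<longrightarrow>
           (\<forall>t\<ge>0. (u t)\<^sup>2 + (h1_norm (w t))\<^sup>2 + (h1_norm (observer N wh t))\<^sup>2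
              \<le> D * exp (- 2 * \<delta> * t) * (h1_norm w0)\<^sup>2)))
     \<and>
     ((\<forall>n>N0. lam n > \<delta>) \<longrightarrow>
        (\<exists>Ns. Ns \<ge> 1 \<and> Ns \<ge> N0 \<and>
          (\<forall>N\<ge>Ns. \<exists>\<sigma>s>0. \<forall>\<sigma>. 0 < \<sigma> \<and> \<sigma> \<le> \<sigma>s \<longrightarrow>
             (\<exists>PX \<alpha>1 \<alpha>2 \<alpha>3. pos_def (2 * N + 3) PX \<and> \<alpha>1 > 0 \<and> \<alpha>2 > 0 \<and> \<alpha>3 > 0 \<and>
                neg_def (6 * N + 10) (Psi0 \<delta> \<sigma> \<Gamma> xs N0 N L0 K0 PX \<alpha>1 \<alpha>2 \<alpha>3)))))"
proof (intro conjI allI impI)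
  fix \<sigma> :: real and g :: "real \<Rightarrow> real \<Rightarrow> real \<Rightarrow> real" and N :: nat
  assume \<sigma>: "\<sigma> > 0" and lip: "locally_lipschitz (\<lambda>(t, x, z). g t x z)" and g0: "\<forall>t x. g t x 0 = 0"
    and slope: "\<forall>t x z1 z2. z1 \<noteq> z2 \<longrightarrow> \<bar>g t x z1 - g t x z2\<bar> / \<bar>z1 - z2\<bar> \<le> \<sigma>"
    and N: "N \<ge> 1" "N \<ge> N0"
    and lmi: "\<exists>PX \<alpha>1 \<alpha>2 \<alpha>3. pos_def (2 * N + 3) PX \<and> \<alpha>1 > 0 \<and> \<alpha>2 > 0 \<and> \<alpha>3 > 0 \<and>
           neg_def (6 * N + 10) (Psi0 \<delta> \<sigma> \<Gamma> xs N0 N L0 K0 PX \<alpha>1 \<alpha>2 \<alpha>3)"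
  from lmi obtain PX \<alpha>1 \<alpha>2 \<alpha>3 where PX: "pos_def (2 * N + 3) PX" and \<alpha>: "\<alpha>1 > 0" "\<alpha>2 > 0" "\<alpha>3 > 0"
    and neg: "neg_def (6 * N + 10) (Psi0 \<delta> \<sigma> \<Gamma> xs N0 N L0 K0 PX \<alpha>1 \<alpha>2 \<alpha>3)" by blast
  have PXc: "PX \<in> carrier_mat (2 * N + 3) (2 * N + 3)" "PX\<^sup>T = PX" using PX by (auto simp: pos_def_def)
  from pos_def_coercive[OF PX] obtain c where c: "c > 0"
    "\<And>x. x \<in> carrier_vec (2 * N + 3) \<Longrightarrow> c * (x \<bullet> x) \<le> x \<bullet> (PX *\<^sub>v x)" by blast
  from bilinear_bounded[OF PXc(1)] obtain C where C: "C \<ge> 0" "\<And>x y. x \<in> carrier_vec (2 * N + 3) \<Longrightarrow>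
      y \<in> carrier_vec (2 * N + 3) \<Longrightarrow> \<bar>x \<bullet> (PX *\<^sub>v y)\<bar> \<le> C * vnorm x * vnorm y" by blast
  have C': "x \<bullet> (PX *\<^sub>v x) \<le> C * (x \<bullet> x)" if "x \<in> carrier_vec (2 * N + 3)" for x
    using C(2)[OF that that] vnorm_sq[of x] by (simp add: power2_eq_square mult.assoc)
  have gl: "\<bar>g t x z - g t x z'\<bar> \<le> \<sigma> * \<bar>z - z'\<bar>" for t x z z'
    using slope[rule_format, of z z' t x] by (cases "z = z'") (auto simp: field_simps)
  let ?D = "max 1 ((3 * (1 + lam N) / c + 2) * (C + 1))"
  show "\<exists>D\<ge>1. \<forall>w0\<in>H1. \<forall>u w wh. closed_loop_solution g xs N0 N L0 K0 w0 u w wh \<longrightarrow>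
           (\<forall>t\<ge>0. (u t)\<^sup>2 + (h1_norm (w t))\<^sup>2 + (h1_norm (observer N wh t))\<^sup>2
              \<le> D * exp (- 2 * \<delta> * t) * (h1_norm w0)\<^sup>2)"
  proof (intro exI[of _ ?D] conjI ballI allI impI)
    fix w0 u w wh and t :: real
    assume w0: "w0 \<in> H1" and sol: "closed_loop_solution g xs N0 N L0 K0 w0 u w wh" and t: "t \<ge> 0"
    interpret lyapunov_loop g N0 N xs L0 K0 w0 u w wh \<delta> \<sigma> \<Gamma> \<alpha>1 \<alpha>2 \<alpha>3 PX
      by unfold_locales (fact assms N lip sol PXc \<alpha> \<sigma> neg g0[rule_format] gl)+
    obtain w0' where "has_H1_deriv w0 w0'" using w0 unfolding H1_def by blast
    from exponential_decay[OF this c C(1) C' t]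
    show "(u t)\<^sup>2 + (h1_norm (w t))\<^sup>2 + (h1_norm (observer N wh t))\<^sup>2
        \<le> ?D * exp (- 2 * \<delta> * t) * (h1_norm w0)\<^sup>2" .
  qed simp
next
  assume gap: "\<forall>n>N0. lam n > \<delta>"
  obtain Po Pc where "pos_def (N0 + 1) Po" "mat_less (N0 + 1)
        (Po * (A0 N0 - L0 * C0 N0 xs) + (A0 N0 - L0 * C0 N0 xs)\<^sup>T * Po) ((- 2 * \<delta>) \<cdot>\<^sub>m Po)"
    "pos_def (N0 + 2) Pc" "mat_less (N0 + 2)
        (Pc * (A0t N0 - B0t N0 * K0) + (A0t N0 - B0t N0 * K0)\<^sup>T * Pc) ((- 2 * \<delta>) \<cdot>\<^sub>m Pc)"
    using assms(6,7) by blast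
  from Psi0_feasible[OF assms(1,2,4,5) this] gap
  show "\<exists>Ns. Ns \<ge> 1 \<and> Ns \<ge> N0 \<and>
          (\<forall>N\<ge>Ns. \<exists>\<sigma>s>0. \<forall>\<sigma>. 0 < \<sigma> \<and> \<sigma> \<le> \<sigma>s \<longrightarrow>
             (\<exists>PX \<alpha>1 \<alpha>2 \<alpha>3. pos_def (2 * N + 3) PX \<and> \<alpha>1 > 0 \<and> \<alpha>2 > 0 \<and> \<alpha>3 > 0 \<and>
                neg_def (6 * N + 10) (Psi0 \<delta> \<sigma> \<Gamma> xs N0 N L0 K0 PX \<alpha>1 \<alpha>2 \<alpha>3)))"
    by simp
qed

end
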